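(* For every $\varepsilon>0$ there exists $\delta>0$ (depending only on $\varepsilon$ and on the pressure $p$) such that the following holds. Let $(n,u,\phi)$ be an $L^2$-compact solution of the Euler–Poisson system $$\partial_t n=-\partial_x((1+n)u),\qquad \partial_t u=-\partial_x\left(\tfrac12u^2+w(n)+\phi\right),\qquad -\partial_x^2\phi+q(\phi)=n,$$ with associated center $y\in C^1(\mathbb{R},\mathbb{R})$, which conserves the energy $E$ and satisfies $$\inf_{t\in\mathbb{R}}|\dot y(t)|>\sqrt{1+k}+\varepsilon,\qquad \sup_{t\in\mathbb{R}}\|(n(t),u(t))\|_{H^1}<\delta .$$ Then $(n,u,\phi)=0$ identically.
   Context: Fix $p\in C^\infty((0,\infty),\mathbb{R})$ with $p'(s)>0$ and $p''(s)\ge 0$ for all $s>0$, and put $k:=p'(1)>0$. Define $w:(-1,\infty)\to\mathbb{R}$ by $w'(s)=(1+s)^{-1}p'(1+s)$, $w(0)=0$ (so $w'(0)=k$), and $q(s)=e^s-1$. The unknowns are $n:\mathbb{R}\times\mathbb{R}\to(-1,\infty)$, $u,\phi:\mathbb{R}\times\mathbb{R}\to\mathbb{R}$, functions of $(t,x)$, with boundary condition $(n,u,\phi)\to(0,0,0)$ as $|x|\to\infty$. A global classical solution is one defined for all $t\in\mathbb{R}$, for which the derivatives in the equations exist in the classical sense and the equations hold pointwise. Norms are over $x\in\mathbb{R}$; $\dot y=dy/dt$. Energy: $E[n,u,\phi]=\int_{\mathbb{R}}\left(\frac12(1+n)u^2+W(n)+\frac12(\partial_x\phi)^2+R(\phi)\right)dx$,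 where $W(n)=\int_0^n w(s)\,ds$ and $R(\phi)=\phi q(\phi)-\int_0^\phi q(s)\,ds$. A solution conserves the energy if $E[n(t),u(t),\phi(t)]$ is finite and independent of $t$. A global classical solution $(n,u,\phi)$ is $L^2$-compact if there exists $y\in C^1(\mathbb{R},\mathbb{R})$ (the associated center) such that for all $\epsilon>0$ there is $R>0$ with $\sup_{t\in\mathbb{R}}\int_{|x-y(t)|>R}(n(t,x)^2+u(t,x)^2)\,dx<\epsilon$. *)

theory Defs
  imports "HOL-Analysis.Analysis"
begin

text \<open>Only meant for open \<open>S\<close>.\<close>
definition smooth_on :: "real set \<Rightarrow> (real \<Rightarrow> real) \<Rightarrow> bool" where
  "smooth_on S f \<longleftrightarrow> (\<forall>m. \<forall>s\<in>S. (deriv ^^ m) f differentiable (at s))"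

definition pressure :: "(real \<Rightarrow> real) \<Rightarrow> bool" where
  "pressure p \<longleftrightarrow> smooth_on {0<..} p \<and> (\<forall>s>0. deriv p s > 0) \<and> (\<forall>s>0. deriv (deriv p) s \<ge> 0)"

text \<open>This determines \<open>w\<close> on \<open>(-1,\<infinity>)\<close>; the values of \<open>w\<close> elsewhere are never used.\<close>
definition enthalpy :: "(real \<Rightarrow> real) \<Rightarrow> (real \<Rightarrow> real) \<Rightarrow> bool" where
  "enthalpy p w \<longleftrightarrow> w 0 = 0 \<and>
     (\<forall>s>-1. (w has_real_derivative inverse (1 + s) * deriv p (1 + s)) (at s))"

definition q_fun :: "real \<Rightarrow> real" where
  "q_fun s = exp s - 1"

text \<open>The integrals from \<open>0\<close> are oriented, since the upper limit may be negative.\<close>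
definition W_pot :: "(real \<Rightarrow> real) \<Rightarrow> real \<Rightarrow> real" where
  "W_pot w a = (LBINT s=ereal 0..ereal a. w s)"

definition R_pot :: "real \<Rightarrow> real" where
  "R_pot a = a * q_fun a - (LBINT s=ereal 0..ereal a. q_fun s)"

definition energy_density ::
  "(real \<Rightarrow> real) \<Rightarrow> (real \<Rightarrow> real) \<Rightarrow> (real \<Rightarrow> real) \<Rightarrow> (real \<Rightarrow> real) \<Rightarrow> real \<Rightarrow> real" where
  "energy_density w n u \<phi> x =
     1/2 * (1 + n x) * (u x)\<^sup>2 + W_pot w (n x) + 1/2 * (deriv \<phi> x)\<^sup>2 + R_pot (\<phi> x)"

definition energy ::
  "(real \<Rightarrow> real) \<Rightarrow> (real \<Rightarrow> real) \<Rightarrow> (real \<Rightarrow> real) \<Rightarrow> (real \<Rightarrow> real) \<Rightarrow> real" where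
  "energy w n u \<phi> = (LBINT x. energy_density w n u \<phi> x)"

text \<open>Space-time functions are curried, time first, so that \<open>n t\<close> is the spatial profile at
  time \<open>t\<close>. Only the derivatives that appear in the equations are required to exist.\<close>
definition EP_solution ::
  "(real \<Rightarrow> real) \<Rightarrow> (real \<Rightarrow> real \<Rightarrow> real) \<Rightarrow> (real \<Rightarrow> real \<Rightarrow> real) \<Rightarrow> (real \<Rightarrow> real \<Rightarrow> real) \<Rightarrow> bool"
  where
  "EP_solution w n u \<phi> \<longleftrightarrow>
     (\<forall>t x. n t x > -1) \<and>
     (\<forall>t. (n t \<longlongrightarrow> 0) at_infinity \<and> (u t \<longlongrightarrow> 0) at_infinity \<and> (\<phi> t \<longlongrightarrow> 0) at_infinity) \<and>
     (\<forall>t x.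
        (\<lambda>s. n s x) differentiable (at t) \<and>
        (\<lambda>z. (1 + n t z) * u t z) differentiable (at x) \<and>
        deriv (\<lambda>s. n s x) t = - deriv (\<lambda>z. (1 + n t z) * u t z) x) \<and>
     (\<forall>t x.
        (\<lambda>s. u s x) differentiable (at t) \<and>
        (\<lambda>z. 1/2 * (u t z)\<^sup>2 + w (n t z) + \<phi> t z) differentiable (at x) \<and>
        deriv (\<lambda>s. u s x) t = - deriv (\<lambda>z. 1/2 * (u t z)\<^sup>2 + w (n t z) + \<phi> t z) x) \<and>
     (\<forall>t x.
        \<phi> t differentiable (at x) \<and>
        deriv (\<phi> t) differentiable (at x) \<and>
        - deriv (deriv (\<phi> t)) x + q_fun (\<phi> t x) = n t x)"

text \<open>All terms of the energy density are nonnegative when \<open>n > -1\<close>, so integrability is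
  finiteness of the energy.\<close>
definition conserves_energy ::
  "(real \<Rightarrow> real) \<Rightarrow> (real \<Rightarrow> real \<Rightarrow> real) \<Rightarrow> (real \<Rightarrow> real \<Rightarrow> real) \<Rightarrow> (real \<Rightarrow> real \<Rightarrow> real) \<Rightarrow> bool"
  where
  "conserves_energy w n u \<phi> \<longleftrightarrow>
     (\<forall>t. integrable lborel (energy_density w (n t) (u t) (\<phi> t))) \<and>
     (\<forall>s t. energy w (n s) (u s) (\<phi> s) = energy w (n t) (u t) (\<phi> t))"

text \<open>The supremum is taken in \<open>[0,\<infinity>]\<close>, so that nothing is assumed tacitly about finiteness.\<close>
definition L2_compact_center ::
  "(real \<Rightarrow> real \<Rightarrow> real) \<Rightarrow> (real \<Rightarrow> real \<Rightarrow> real) \<Rightarrow> (real \<Rightarrow> real) \<Rightarrow> bool" where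
  "L2_compact_center n u y \<longleftrightarrow>
     y C1_differentiable_on UNIV \<and>
     (\<forall>\<epsilon>>0. \<exists>R>0.
        (SUP t. \<integral>\<^sup>+x\<in>{x. \<bar>x - y t\<bar> > R}. ennreal ((n t x)\<^sup>2 + (u t x)\<^sup>2) \<partial>lborel) < ennreal \<epsilon>)"

definition L2_fun :: "(real \<Rightarrow> real) \<Rightarrow> bool" where
  "L2_fun f \<longleftrightarrow> f \<in> borel_measurable lborel \<and> integrable lborel (\<lambda>x. (f x)\<^sup>2)"

definition test_fun :: "(real \<Rightarrow> real) \<Rightarrow> bool" where
  "test_fun \<psi> \<longleftrightarrow> smooth_on UNIV \<psi> \<and> bounded {x. \<psi> x \<noteq> 0}"

definition L2_weak_deriv :: "(real \<Rightarrow> real) \<Rightarrow> (real \<Rightarrow> real) \<Rightarrow> bool" where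
  "L2_weak_deriv f g \<longleftrightarrow> L2_fun g \<and>
     (\<forall>\<psi>. test_fun \<psi> \<longrightarrow> (LBINT x. f x * deriv \<psi> x) = - (LBINT x. g x * \<psi> x))"

definition H1_fun :: "(real \<Rightarrow> real) \<Rightarrow> bool" where
  "H1_fun f \<longleftrightarrow> L2_fun f \<and> (\<exists>g. L2_weak_deriv f g)"

text \<open>The weak derivative is unique up to null sets, so the choice does not affect the norm.\<close>
definition H1_norm :: "(real \<Rightarrow> real) \<Rightarrow> real" where
  "H1_norm f = sqrt ((LBINT x. (f x)\<^sup>2) + (LBINT x. ((SOME g. L2_weak_deriv f g) x)\<^sup>2))"

definition H1_pair_norm :: "(real \<Rightarrow> real) \<Rightarrow> (real \<Rightarrow> real) \<Rightarrow> real" where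
  "H1_pair_norm f g = sqrt ((H1_norm f)\<^sup>2 + (H1_norm g)\<^sup>2)"

end

theory Submission
  imports Defs
begin

text \<open>The energy of a small solution cannot travel faster than (essentially) \<open>c = sqrt (1 + k)\<close>, while
compactness ties all of it to a centre that moves faster than \<open>c + \<epsilon>\<close>; hence there is none.

Write \<open>J = (1 + n) u\<close> and \<open>G = u\<^sup>2/2 + w n\<close>. Formally \<open>\<psi> = J - \<partial>\<^sub>t \<partial>\<^sub>x \<phi>\<close> satisfies
\<open>\<partial>\<^sub>x \<psi> = - \<partial>\<^sub>t q \<phi>\<close> and the energy density \<open>e\<close> satisfies \<open>\<partial>\<^sub>t e + \<partial>\<^sub>x (G J + \<phi> \<psi>) = 0\<close>. Since \<open>q\<close> is
increasing, \<open>\<integral> \<psi>\<^sup>2 \<le> \<integral> \<psi> J\<close>, so \<open>\<psi>\<close> is no larger than \<open>J\<close> in \<open>L\<^sup>2\<close>. To leading order the flux is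
therefore at most \<open>\<integral> k \<bar>n\<bar> \<bar>u\<bar> + \<bar>\<phi>\<bar> \<bar>u\<bar>\<close>, and the weighted inequality between arithmetic and geometric
means with weight \<open>c\<close> bounds this by \<open>c \<integral> (u\<^sup>2 + k n\<^sup>2 + \<phi>\<^sup>2) / 2\<close>, to leading order at most \<open>c\<close> times the
energy (lemma \<open>flux_le_energy\<close>).

Now take the 1-Lipschitz weight \<open>\<eta>\<close> that clamps \<open>x\<close> to the interval between \<open>y s\<close> and \<open>y t\<close>. The moment
\<open>\<integral> \<eta> e\<close> changes by at most \<open>B en \<bar>t - s\<bar>\<close>, where \<open>en\<close> is the energy and \<open>B < c + \<epsilon>\<close> (\<open>weighted_energy_Lipschitz\<close>). But at both
end times the energy sits near the respective centre, up to an error that is small compared with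
\<open>\<bar>y t - y s\<bar>\<close>; for the field energy this is the elliptic estimate \<open>weighted_energy_le\<close>. So the moment changes
by about \<open>en \<bar>y t - y s\<bar> \<ge> (c + \<epsilon>) en \<bar>t - s\<bar>\<close>, and \<open>en = 0\<close> follows for \<open>\<bar>t - s\<bar> \<longlonglongrightarrow> \<infinity>\<close>
(\<open>fast_compact_solution_vanishes\<close>).

The rest is regularity. The derivatives in the equations exist pointwise, but they need not be
continuous or locally bounded, and \<open>\<phi>\<close> need not be differentiable in time. Three devices deal with this.
First, \<open>n = q \<phi> - \<partial>\<^sub>x\<^sup>2 \<phi>\<close> is everywhere a derivative, so the weak derivative of \<open>n\<close> integrates to its
increments at every point, with no exceptional null set (\<open>weak_derivative_FTC\<close>), and continuity of \<open>n\<close>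
and then of \<open>u\<close> follows. Second, the \<open>L\<^sup>2\<close> norms of \<open>\<partial>\<^sub>t n\<close> and \<open>\<partial>\<^sub>t u\<close> are bounded uniformly in time by
Fatou's lemma applied to difference quotients (\<open>L2_Lipschitz_derivative\<close>), and Fubini's theorem then
replaces differentiation under the integral sign (\<open>time_FTC\<close>). Third, the field energy at two times is
compared through the flux \<open>V = \<integral> J d\<tau>\<close> accumulated between them (\<open>weighted_field_increment\<close>); the
errors are quadratic in the time step and disappear by subdivision (\<open>increment_bound_linear\<close>).\<close>

section \<open>Square-integrable functions on the line\<close>

abbreviation sqnorm :: "(real \<Rightarrow> real) \<Rightarrow> real" where
  "sqnorm f \<equiv> LBINT x. (f x)^2"

lemma L2_funD: "L2_fun f \<Longrightarrow> f \<in> borel_measurable borel" "L2_fun f \<Longrightarrow> integrable lborel (\<lambda>x. (f x)^2)"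
  by (auto simp: L2_fun_def)

lemma abs_mult_le_sum_squares: "\<bar>a * b\<bar> \<le> (a^2 + b^2 :: real)"
proof -
  have "2 * (\<bar>a\<bar> * \<bar>b\<bar>) \<le> \<bar>a\<bar>^2 + \<bar>b\<bar>^2" using sum_squares_bound[of "\<bar>a\<bar>" "\<bar>b\<bar>"] by simp
  thus ?thesis unfolding abs_mult power2_abs using mult_nonneg_nonneg[of "\<bar>a\<bar>" "\<bar>b\<bar>"] by linarith
qed

lemma abs_mult_le_weighted_squares:
  fixes a b h :: real assumes "h > 0"
  shows "\<bar>a * b\<bar> \<le> h / 2 * a^2 + 1 / (2 * h) * b^2"
proof -
  have "0 \<le> (h * \<bar>a\<bar> - \<bar>b\<bar>)^2 / (2 * h)" using assms by simp
  also have "\<dots> = h / 2 * a^2 + 1 / (2 * h) * b^2 - \<bar>a * b\<bar>"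
    using assms by (simp add: field_simps power2_eq_square abs_mult)
  finally show ?thesis by simp
qed

lemma integrable_dominated:
  fixes f g :: "real \<Rightarrow> real"
  assumes "integrable lborel g" "f \<in> borel_measurable borel" "\<And>x. \<bar>f x\<bar> \<le> g x"
  shows "integrable lborel f"
proof (rule Bochner_Integration.integrable_bound[OF assms(1)])
  show "f \<in> borel_measurable lborel" using assms(2) by simp
  show "AE x in lborel. norm (f x) \<le> norm (g x)"
  proof (rule AE_I2)
    fix x show "norm (f x) \<le> norm (g x)" using assms(3)[of x] by simp
  qed
qed

lemma L2_mult_integrable:
  assumes "L2_fun f" "L2_fun g" shows "integrable lborel (\<lambda>x. f x * g x)"
proof (rule integrable_dominated)
  show "integrable lborel (\<lambda>x. (f x)^2 + (g x)^2)"
    using assms by (intro Bochner_Integration.integrable_add L2_funD)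
  show "(\<lambda>x. f x * g x) \<in> borel_measurable borel"
    using assms by (intro borel_measurable_times L2_funD)
  show "\<bar>f x * g x\<bar> \<le> (f x)^2 + (g x)^2" for x by (rule abs_mult_le_sum_squares)
qed

lemma integrable_bounded_mult:
  fixes f g :: "real \<Rightarrow> real"
  assumes "integrable lborel f" "g \<in> borel_measurable borel" "\<And>x. \<bar>g x\<bar> \<le> C"
  shows "integrable lborel (\<lambda>x. g x * f x)"
proof (rule integrable_dominated)
  show "integrable lborel (\<lambda>x. C * \<bar>f x\<bar>)" using assms(1) by simp
  have "f \<in> borel_measurable borel" using assms(1) by (auto dest: borel_measurable_integrable)
  thus "(\<lambda>x. g x * f x) \<in> borel_measurable borel" using assms(2) by simp
  show "\<bar>g x * f x\<bar> \<le> C * \<bar>f x\<bar>" for x using assms(3)[of x] by (simp add: abs_mult mult_right_mono)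
qed

lemma L2_fun_dominated:
  assumes "L2_fun g" "f \<in> borel_measurable borel" "\<And>x. \<bar>f x\<bar> \<le> C * \<bar>g x\<bar>"
  shows "L2_fun f"
  unfolding L2_fun_def
proof
  show "f \<in> borel_measurable lborel" using assms by simp
  show "integrable lborel (\<lambda>x. (f x)^2)"
  proof (rule integrable_dominated)
    show "integrable lborel (\<lambda>x. C^2 * (g x)^2)" using L2_funD(2)[OF assms(1)] by simp
    show "(\<lambda>x. (f x)^2) \<in> borel_measurable borel" using assms(2) by simp
    fix x
    have "\<bar>f x\<bar>^2 \<le> (C * \<bar>g x\<bar>)^2" using assms(3)[of x] by (intro power_mono) auto
    thus "\<bar>(f x)^2\<bar> \<le> C^2 * (g x)^2" by (simp add: power_mult_distrib)
  qed
qed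

lemma L2_fun_add:
  assumes "L2_fun f" "L2_fun g" shows "L2_fun (\<lambda>x. f x + g x)"
  unfolding L2_fun_def
proof
  show "(\<lambda>x. f x + g x) \<in> borel_measurable lborel"
    using assms by (intro borel_measurable_add) (auto simp: L2_fun_def)
  have "integrable lborel (\<lambda>x. (f x)^2 + (g x)^2 + 2 * (f x * g x))"
    using assms L2_mult_integrable by (intro Bochner_Integration.integrable_add L2_funD) auto
  thus "integrable lborel (\<lambda>x. (f x + g x)^2)" by (simp add: power2_sum mult.assoc)
qed

lemma L2_fun_scale: "L2_fun f \<Longrightarrow> L2_fun (\<lambda>x. c * f x)"
  unfolding L2_fun_def by (auto simp: power_mult_distrib)

lemma L2_fun_minus: "L2_fun f \<Longrightarrow> L2_fun (\<lambda>x. - f x)"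
  using L2_fun_scale[of f "-1"] by simp

lemma L2_fun_diff: "L2_fun f \<Longrightarrow> L2_fun g \<Longrightarrow> L2_fun (\<lambda>x. f x - g x)"
  using L2_fun_add[of f "\<lambda>x. - g x"] L2_fun_minus by simp

lemma L2_indicator: "L2_fun (indicator {y..z} :: real \<Rightarrow> real)"
  unfolding L2_fun_def by (auto simp: power2_eq_square indicator_inter_arith[symmetric] emeasure_lborel_Icc_eq)

lemma derivative_continuous:
  assumes "\<And>x. (f has_real_derivative f' x) (at x)"
  shows "continuous_on UNIV f"
  using assms by (meson DERIV_isCont continuous_at_imp_continuous_on)

lemma continuous_measurable: "continuous_on UNIV (f::real\<Rightarrow>real) \<Longrightarrow> f \<in> borel_measurable borel"
  by (rule borel_measurable_continuous_onI)

section \<open>Fubini and the fundamental theorem of calculus on a strip\<close>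

lemma set_integrable_const: "set_integrable lborel {a..b :: real} (\<lambda>_. c :: real)"
  unfolding set_integrable_def
  by (intro integrable_scaleR_left integrable_real_indicator) (auto simp: emeasure_lborel_Icc_eq)

abbreviation jointly_measurable :: "(real \<Rightarrow> real \<Rightarrow> real) \<Rightarrow> bool" where
  "jointly_measurable f \<equiv> case_prod f \<in> borel_measurable (lborel \<Otimes>\<^sub>M lborel)"

text \<open>A bound on the spatial \<open>L\<^sup>1\<close> norms that is uniform in \<open>\<tau>\<close> makes \<open>f\<close> integrable on the strip, because
the time interval is bounded. All interchanges of integrals below go through this lemma.\<close>
lemma strip_Fubini:
  fixes f :: "real \<Rightarrow> real \<Rightarrow> real"
  assumes meas: "jointly_measurable f"
    and bd: "\<forall>\<tau>\<in>{a..b}. integrable lborel (f \<tau>) \<and> (LBINT x. \<bar>f \<tau> x\<bar>) \<le> C"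
  shows "AE x in lborel. set_integrable lborel {a..b} (\<lambda>\<tau>. f \<tau> x)"
    and "integrable lborel (\<lambda>x. LBINT \<tau>:{a..b}. f \<tau> x)"
    and "set_integrable lborel {a..b} (\<lambda>\<tau>. LBINT x. f \<tau> x)"
    and "(LBINT x. LBINT \<tau>:{a..b}. f \<tau> x) = (LBINT \<tau>:{a..b}. LBINT x. f \<tau> x)"
proof -
  let ?F = "\<lambda>(\<tau>, x). indicator {a..b} \<tau> * f \<tau> x"
  have mF: "?F \<in> borel_measurable (lborel \<Otimes>\<^sub>M lborel)"
    using meas by measurable
  have m1: "f \<tau> \<in> borel_measurable lborel" for \<tau>
    using measurable_compose[OF measurable_Pair1' meas, of \<tau>] by simp
  have abs_meas: "(\<lambda>\<tau>. LBINT x. indicator {a..b} \<tau> * \<bar>f \<tau> x\<bar>) \<in> borel_measurable lborel"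
  proof -
    have "(\<lambda>(\<tau>, x). indicator {a..b} \<tau> * \<bar>f \<tau> x\<bar>) \<in> borel_measurable (lborel \<Otimes>\<^sub>M lborel)"
      using meas by measurable
    from lborel.borel_measurable_lebesgue_integral[OF this] show ?thesis by simp
  qed
  have iF: "integrable (lborel \<Otimes>\<^sub>M lborel) ?F"
  proof (rule lborel_pair.Fubini_integrable[OF mF])
    have "integrable lborel (\<lambda>\<tau>. LBINT x. indicator {a..b} \<tau> * \<bar>f \<tau> x\<bar>)"
    proof (rule integrable_dominated)
      show "integrable lborel (\<lambda>\<tau>. indicator {a..b} \<tau> * \<bar>C\<bar>)"
        by (intro integrable_mult_left integrable_real_indicator) (auto simp: emeasure_lborel_Icc_eq)
      show "(\<lambda>\<tau>. LBINT x. indicator {a..b} \<tau> * \<bar>f \<tau> x\<bar>) \<in> borel_measurable borel"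
        using abs_meas by simp
      fix \<tau>
      show "\<bar>LBINT x. indicator {a..b} \<tau> * \<bar>f \<tau> x\<bar>\<bar> \<le> indicator {a..b} \<tau> * \<bar>C\<bar>"
      proof (cases "\<tau> \<in> {a..b}")
        case True
        then have "(LBINT x. \<bar>f \<tau> x\<bar>) \<le> C" using bd by auto
        moreover have "0 \<le> (LBINT x. \<bar>f \<tau> x\<bar>)" by simp
        ultimately show ?thesis using True by simp
      qed simp
    qed
    thus "integrable lborel (\<lambda>\<tau>. LBINT x. norm (case (\<tau>, x) of (\<tau>, x) \<Rightarrow> indicator {a..b} \<tau> * f \<tau> x))"
      by (simp add: abs_mult)
    show "AE \<tau> in lborel. integrable lborel (\<lambda>x. case (\<tau>, x) of (\<tau>, x) \<Rightarrow> indicator {a..b} \<tau> * f \<tau> x)"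
      using bd by (auto split: split_indicator)
  qed
  have iF': "integrable (lborel \<Otimes>\<^sub>M lborel) (\<lambda>(\<tau>, x). indicator {a..b} \<tau> * f \<tau> x)"
    using iF .
  show "AE x in lborel. set_integrable lborel {a..b} (\<lambda>\<tau>. f \<tau> x)"
    unfolding set_integrable_def using lborel_pair.AE_integrable_snd[OF iF'] by simp
  show "integrable lborel (\<lambda>x. LBINT \<tau>:{a..b}. f \<tau> x)"
    unfolding set_lebesgue_integral_def using lborel_pair.integrable_snd[OF iF'] by simp
  have eq: "(LBINT x. indicator {a..b} \<tau> * f \<tau> x) = indicator {a..b} \<tau> * (LBINT x. f \<tau> x)" for \<tau>
    by simp
  show "set_integrable lborel {a..b} (\<lambda>\<tau>. LBINT x. f \<tau> x)"
    unfolding set_integrable_def using lborel_pair.integrable_fst'[OF iF] by (simp add: eq)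
  show "(LBINT x. LBINT \<tau>:{a..b}. f \<tau> x) = (LBINT \<tau>:{a..b}. LBINT x. f \<tau> x)"
    unfolding set_lebesgue_integral_def using lborel_pair.Fubini_integral[OF iF'] by (simp add: eq)
qed

lemma FTC_set_integral:
  fixes g f :: "real \<Rightarrow> real"
  assumes "a \<le> b" "finite S" "continuous_on {a..b} g"
    "\<And>x. x \<in> {a..b} - S \<Longrightarrow> (g has_real_derivative f x) (at x)"
    "set_integrable lborel {a..b} f"
  shows "(LBINT x:{a..b}. f x) = g b - g a"
proof -
  have "(f has_integral (g b - g a)) {a..b}"
    using assms by (intro fundamental_theorem_of_calculus_strong[of S])
      (auto simp: has_real_derivative_iff_has_vector_derivative[symmetric])
  thus ?thesis using set_borel_integral_eq_integral(2)[OF assms(5)] by (simp add: integral_unique)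
qed

text \<open>This replaces differentiation under the integral sign, for which no locally uniform bound on the time
derivative is available. For almost every \<open>x\<close> the derivative is integrable in time by Fubini, and an
everywhere existing integrable derivative integrates to the increment.\<close>
lemma time_FTC:
  fixes f g :: "real \<Rightarrow> real \<Rightarrow> real"
  assumes meas: "jointly_measurable f"
    and bd: "\<forall>\<tau>\<in>{a..b}. integrable lborel (f \<tau>) \<and> (LBINT x. \<bar>f \<tau> x\<bar>) \<le> C"
    and der: "\<And>\<tau> x. ((\<lambda>s. g s x) has_real_derivative f \<tau> x) (at \<tau>)"
    and g: "integrable lborel (g a)" "integrable lborel (g b)" and ab: "a \<le> b"
  shows "(LBINT x. g b x) - (LBINT x. g a x) = (LBINT \<tau>:{a..b}. LBINT x. f \<tau> x)"
proof -
  note F = strip_Fubini[of f a b C, OF meas bd]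
  have "(LBINT x. g b x) - (LBINT x. g a x) = (LBINT x. g b x - g a x)" using g by simp
  also have "\<dots> = (LBINT x. LBINT \<tau>:{a..b}. f \<tau> x)"
  proof (rule integral_cong_AE)
    show "(\<lambda>x. g b x - g a x) \<in> borel_measurable lborel" using g by auto
    show "(\<lambda>x. LBINT \<tau>:{a..b}. f \<tau> x) \<in> borel_measurable lborel"
      using F(2) by (rule borel_measurable_integrable)
    show "AE x in lborel. g b x - g a x = (LBINT \<tau>:{a..b}. f \<tau> x)"
      using F(1)
    proof eventually_elim
      case (elim x)
      have "continuous_on {a..b} (\<lambda>s. g s x)"
        by (intro continuous_at_imp_continuous_on ballI DERIV_isCont[OF der])
      from FTC_set_integral[OF ab finite.emptyI this der elim] show ?case by simp
    qed
  qed
  also have "\<dots> = (LBINT \<tau>:{a..b}. LBINT x. f \<tau> x)" by (rule F(4))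
  finally show ?thesis .
qed

lemma shifted_measurable:
  assumes "f \<in> borel_measurable borel"
  shows "jointly_measurable (\<lambda>\<tau> x. f (x + \<tau> :: real) :: real)"
  using assms by measurable

lemma integrable_shift:
  fixes f :: "real \<Rightarrow> real"
  assumes "integrable lborel f"
  shows "integrable lborel (\<lambda>x. f (x + t))" "(LBINT x. f (x + t)) = (LBINT x. f x)"
proof -
  show "integrable lborel (\<lambda>x. f (x + t))"
    using lborel_integrable_real_affine[OF assms, of 1 t] by (simp add: add.commute)
  show "(LBINT x. f (x + t)) = (LBINT x. f x)"
    using lborel_integral_real_affine[of 1 f t] by (simp add: add.commute)
qed

lemma set_integral_shift:
  fixes f :: "real \<Rightarrow> real"
  shows "(LBINT \<tau>:{0..h}. f (x + \<tau>)) = (LBINT z:{x..x+h}. f z)"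
proof -
  have "(LBINT z:{x..x+h}. f z) = (LBINT \<tau>. indicator {x..x+h} (x + \<tau>) * f (x + \<tau>))"
    unfolding set_lebesgue_integral_def
    using lborel_integral_real_affine[of 1 "\<lambda>z. indicator {x..x+h} z * f z" x] by simp
  also have "\<dots> = (LBINT \<tau>:{0..h}. f (x + \<tau>))"
    unfolding set_lebesgue_integral_def by (intro Bochner_Integration.integral_cong) (auto split: split_indicator)
  finally show ?thesis by simp
qed

lemma integrable_imp_set_integrable: "integrable lborel (f::real\<Rightarrow>real) \<Longrightarrow> set_integrable lborel {a..b} f"
  unfolding set_integrable_def by (rule integrable_mult_indicator) auto

text \<open>Translation invariance gives \<open>\<integral> (F (x + 1) - F x) dx = 0\<close>, and
by Fubini the same integral is \<open>\<integral> f\<close>. The finite exceptional set \<open>S\<close> admits piecewise linear weights.\<close>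
lemma integral_derivative_zero:
  fixes F f :: "real \<Rightarrow> real"
  assumes "finite S" "continuous_on UNIV F" "\<And>x. x \<notin> S \<Longrightarrow> (F has_real_derivative f x) (at x)"
    and F: "integrable lborel F" and f: "integrable lborel f"
  shows "(LBINT x. f x) = 0"
proof -
  have mf: "f \<in> borel_measurable borel" using f by (auto dest: borel_measurable_integrable)
  have *: "(LBINT x. LBINT \<tau>:{0..1}. f (x + \<tau>)) = (LBINT \<tau>:{0..1}. LBINT x. f (x + \<tau>))"
  proof (rule strip_Fubini(4)[of "\<lambda>\<tau> x. f (x + \<tau>)"])
    show "jointly_measurable (\<lambda>\<tau> x. f (x + \<tau>))"
      by (rule shifted_measurable[OF mf])
    show "\<forall>\<tau>\<in>{0..1}. integrable lborel (\<lambda>x. f (x + \<tau>)) \<and> (LBINT x. \<bar>f (x + \<tau>)\<bar>) \<le> (LBINT x. \<bar>f x\<bar>)"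
      using integrable_shift(1)[OF f] integrable_shift(2)[of "\<lambda>x. \<bar>f x\<bar>"] f by simp
  qed
  have "(LBINT \<tau>:{0..1}. LBINT x. f (x + \<tau>)) = (LBINT x. f x)"
    using integrable_shift(2)[OF f] by (simp add: set_lebesgue_integral_def)
  moreover have "(LBINT \<tau>:{0..1}. f (x + \<tau>)) = F (x + 1) - F x" for x
    unfolding set_integral_shift
    by (rule FTC_set_integral[OF _ assms(1)])
       (use assms(2,3) f in \<open>auto intro: continuous_on_subset integrable_imp_set_integrable\<close>)
  moreover have "(LBINT x. F (x + 1) - F x) = 0"
    using integrable_shift[OF F] F by simp
  ultimately show ?thesis using * by simp
qed

lemma Cauchy_Schwarz_interval:
  fixes f :: "real \<Rightarrow> real"
  assumes "set_integrable lborel {a..b} f" "set_integrable lborel {a..b} (\<lambda>x. (f x)^2)" "a \<le> b"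
  shows "(LBINT x:{a..b}. f x)^2 \<le> (b - a) * (LBINT x:{a..b}. (f x)^2)"
proof (cases "a = b")
  case True
  have "(LBINT x:{b..b}. f x) = 0"
  proof -
    have "AE x in lborel. x \<noteq> b" by (rule AE_lborel_singleton)
    hence "AE x in lborel. indicator {b..b} x *\<^sub>R f x = 0"
      by eventually_elim auto
    thus ?thesis unfolding set_lebesgue_integral_def by (rule integral_eq_zero_AE)
  qed
  thus ?thesis using True by simp
next
  case False
  \<comment> \<open>The variance about the mean \<open>m\<close> is nonnegative.\<close>
  define m where "m = (LBINT x:{a..b}. f x) / (b - a)"
  have "0 \<le> (LBINT x:{a..b}. (f x - m)^2)" unfolding set_lebesgue_integral_def by simp
  also have "(LBINT x:{a..b}. (f x - m)^2) = (LBINT x:{a..b}. (f x)^2 - 2 * m * f x + m^2)"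
    by (simp add: power2_diff algebra_simps)
  also have "\<dots> = (LBINT x:{a..b}. (f x)^2) - 2 * m * (LBINT x:{a..b}. f x) + m^2 * (b - a)"
    using assms set_integrable_const[of a b "m^2"] set_integral_add(2)[of lborel "{a..b}" "\<lambda>x. (f x)^2 - 2 * m * f x" "\<lambda>_. m^2"]
    by (auto simp: set_integral_diff) (simp add: set_lebesgue_integral_def)
  also have "\<dots> = (LBINT x:{a..b}. (f x)^2) - (LBINT x:{a..b}. f x)^2 / (b - a)"
    using False unfolding m_def by (simp add: power2_eq_square)
  finally show ?thesis using False assms(3) by (simp add: field_simps)
qed

text \<open>Minkowski's integral inequality in a form without square roots: Cauchy--Schwarz in \<open>\<tau>\<close>, then Fubini.\<close>
lemma integral_square_strip:
  fixes J :: "real \<Rightarrow> real \<Rightarrow> real"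
  assumes meas: "jointly_measurable J"
    and bd: "\<forall>\<tau>\<in>{a..b}. integrable lborel (\<lambda>x. (J \<tau> x)^2) \<and> sqnorm (J \<tau>) \<le> C" and ab: "a \<le> b"
  shows "L2_fun (\<lambda>x. LBINT \<tau>:{a..b}. J \<tau> x)"
    and "(LBINT x. (LBINT \<tau>:{a..b}. J \<tau> x)^2) \<le> (b - a) * (LBINT \<tau>:{a..b}. sqnorm (J \<tau>))"
    and "set_integrable lborel {a..b} (\<lambda>\<tau>. sqnorm (J \<tau>))"
    and "(LBINT x. (LBINT \<tau>:{a..b}. J \<tau> x)^2) \<le> (b - a)^2 * C"
proof -
  have m2: "jointly_measurable (\<lambda>\<tau> x. (J \<tau> x)^2)"
    using meas by measurable
  have bd': "\<forall>\<tau>\<in>{a..b}. integrable lborel (\<lambda>x. (J \<tau> x)^2) \<and> (LBINT x. \<bar>(J \<tau> x)^2\<bar>) \<le> C"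
    using bd by simp
  note F = strip_Fubini[of "\<lambda>\<tau> x. (J \<tau> x)^2" a b C, OF m2 bd']
  show S: "set_integrable lborel {a..b} (\<lambda>\<tau>. sqnorm (J \<tau>))" by (rule F(3))
  have mV: "(\<lambda>x. LBINT \<tau>:{a..b}. J \<tau> x) \<in> borel_measurable lborel"
  proof -
    have "(\<lambda>(x, \<tau>). indicator {a..b} \<tau> * J \<tau> x) \<in> borel_measurable (lborel \<Otimes>\<^sub>M lborel)"
      using meas by measurable
    thus ?thesis unfolding set_lebesgue_integral_def
      using lborel.borel_measurable_lebesgue_integral by auto
  qed
  have mJ: "(\<lambda>\<tau>. J \<tau> x) \<in> borel_measurable lborel" for x
    using measurable_compose[OF measurable_Pair2' meas, of x] by simp
  have le: "AE x in lborel. (LBINT \<tau>:{a..b}. J \<tau> x)^2 \<le> (b - a) * (LBINT \<tau>:{a..b}. (J \<tau> x)^2)"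
    using F(1)
  proof eventually_elim
    case (elim x)
    have "set_integrable lborel {a..b} (\<lambda>\<tau>. J \<tau> x)"
    proof (rule set_integrable_bound)
      show "set_integrable lborel {a..b} (\<lambda>\<tau>. 1 + (J \<tau> x)^2)"
        using elim by (intro set_integral_add(1) set_integrable_const)
      show "set_borel_measurable lborel {a..b} (\<lambda>\<tau>. J \<tau> x)"
        using mJ unfolding set_borel_measurable_def by measurable
      have "\<bar>z\<bar> \<le> \<bar>1 + z^2\<bar>" for z :: real using abs_mult_le_sum_squares[of 1 z] by simp
      thus "AE \<tau> in lborel. \<tau> \<in> {a..b} \<longrightarrow> norm (J \<tau> x) \<le> norm (1 + (J \<tau> x)^2)" by simp
    qed
    from Cauchy_Schwarz_interval[OF this elim ab] show ?case .
  qed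
  have iV: "integrable lborel (\<lambda>x. (LBINT \<tau>:{a..b}. J \<tau> x)^2)"
  proof (rule Bochner_Integration.integrable_bound)
    show "integrable lborel (\<lambda>x. (b - a) * (LBINT \<tau>:{a..b}. (J \<tau> x)^2))"
      using F(2) by simp
    show "(\<lambda>x. (LBINT \<tau>:{a..b}. J \<tau> x)^2) \<in> borel_measurable lborel" using mV by simp
    show "AE x in lborel. norm ((LBINT \<tau>:{a..b}. J \<tau> x)^2) \<le> norm ((b - a) * (LBINT \<tau>:{a..b}. (J \<tau> x)^2))"
      using le by eventually_elim auto
  qed
  show "L2_fun (\<lambda>x. LBINT \<tau>:{a..b}. J \<tau> x)" using iV mV by (simp add: L2_fun_def)
  have "(LBINT x. (LBINT \<tau>:{a..b}. J \<tau> x)^2) \<le> (LBINT x. (b - a) * (LBINT \<tau>:{a..b}. (J \<tau> x)^2))"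
    using iV F(2) le by (intro integral_mono_AE) auto
  also have "\<dots> = (b - a) * (LBINT \<tau>:{a..b}. sqnorm (J \<tau>))" using F(4) by simp
  finally show *: "(LBINT x. (LBINT \<tau>:{a..b}. J \<tau> x)^2) \<le> (b - a) * (LBINT \<tau>:{a..b}. sqnorm (J \<tau>))" .
  have "(LBINT \<tau>:{a..b}. sqnorm (J \<tau>)) \<le> (LBINT \<tau>:{a..b}. C)"
    using S bd by (intro set_integral_mono set_integrable_const) auto
  also have "\<dots> = (b - a) * C" using ab by (simp add: set_lebesgue_integral_def)
  finally have "(b - a) * (LBINT \<tau>:{a..b}. sqnorm (J \<tau>)) \<le> (b - a) * ((b - a) * C)"
    using ab by (intro mult_left_mono) auto
  with * show "(LBINT x. (LBINT \<tau>:{a..b}. J \<tau> x)^2) \<le> (b - a)^2 * C"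
    by (simp add: power2_eq_square mult.assoc)
qed

text \<open>Continuity in the first variable makes \<open>f\<close> the limit of its values on the grids of mesh \<open>1 / (j + 1)\<close>,
and each of these step functions in \<open>t\<close> is jointly measurable.\<close>
lemma separately_continuous_measurable:
  fixes f :: "real \<Rightarrow> real \<Rightarrow> real"
  assumes c: "\<And>x. continuous_on UNIV (\<lambda>t. f t x)" and m: "\<And>t. f t \<in> borel_measurable borel"
  shows "jointly_measurable f"
proof (rule borel_measurable_LIMSEQ_real)
  let ?g = "\<lambda>(j::nat) (p::real\<times>real). f (of_int \<lfloor>real (Suc j) * fst p\<rfloor> / real (Suc j)) (snd p)"
  show "?g j \<in> borel_measurable (lborel \<Otimes>\<^sub>M lborel)" for j
  proof -
    have "(\<lambda>p. (\<lambda>i p. f (of_int i / real (Suc j)) (snd p)) (\<lfloor>real (Suc j) * fst p\<rfloor>) p)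
       \<in> borel_measurable (lborel \<Otimes>\<^sub>M (lborel :: real measure))"
    proof (rule measurable_compose_countable[where f = "\<lambda>i p. f (of_int i / real (Suc j)) (snd p)"
          and g = "\<lambda>p. \<lfloor>real (Suc j) * fst p\<rfloor>"])
      show "(\<lambda>p. f (of_int i / real (Suc j)) (snd p)) \<in> borel_measurable (lborel \<Otimes>\<^sub>M lborel)" for i :: int
        using m by measurable
      show "(\<lambda>p. \<lfloor>real (Suc j) * fst p\<rfloor>) \<in> lborel \<Otimes>\<^sub>M lborel \<rightarrow>\<^sub>M count_space UNIV"
        by measurable
    qed
    thus ?thesis .
  qed
  fix p :: "real \<times> real"
  have "(\<lambda>j. of_int \<lfloor>real (Suc j) * fst p\<rfloor> / real (Suc j)) \<longlonglongrightarrow> fst p"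
  proof (rule tendsto_sandwich)
    show "\<forall>\<^sub>F j in sequentially. fst p - inverse (real (Suc j)) \<le> of_int \<lfloor>real (Suc j) * fst p\<rfloor> / real (Suc j)"
    proof (rule always_eventually, rule allI)
      fix j
      have "real (Suc j) * fst p - 1 \<le> of_int \<lfloor>real (Suc j) * fst p\<rfloor>" by linarith
      hence "(real (Suc j) * fst p - 1) / real (Suc j) \<le> of_int \<lfloor>real (Suc j) * fst p\<rfloor> / real (Suc j)"
        by (intro divide_right_mono) auto
      thus "fst p - inverse (real (Suc j)) \<le> of_int \<lfloor>real (Suc j) * fst p\<rfloor> / real (Suc j)"
        by (simp add: field_simps)
    qed
    show "\<forall>\<^sub>F j in sequentially. of_int \<lfloor>real (Suc j) * fst p\<rfloor> / real (Suc j) \<le> fst p"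
    proof (rule always_eventually, rule allI)
      fix j
      have "of_int \<lfloor>real (Suc j) * fst p\<rfloor> \<le> real (Suc j) * fst p" by linarith
      thus "of_int \<lfloor>real (Suc j) * fst p\<rfloor> / real (Suc j) \<le> fst p"
        by (simp add: pos_divide_le_eq mult.commute)
    qed
    show "(\<lambda>j. fst p - inverse (real (Suc j))) \<longlonglongrightarrow> fst p"
      using tendsto_diff[OF tendsto_const LIMSEQ_inverse_real_of_nat] by simp
  qed simp
  moreover have "isCont (\<lambda>t. f t (snd p)) (fst p)"
    using c continuous_on_eq_continuous_at by blast
  ultimately have "(\<lambda>j. ?g j p) \<longlonglongrightarrow> f (fst p) (snd p)"
    using isCont_tendsto_compose by fastforce
  thus "(\<lambda>j. ?g j p) \<longlonglongrightarrow> case_prod f p" by (simp add: case_prod_beta)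
qed

lemma difference_quotient_sequence:
  assumes "(f has_real_derivative D) (at x)"
  shows "(\<lambda>j. real (Suc j) * (f (x + inverse (real (Suc j))) - f x)) \<longlonglongrightarrow> D"
proof -
  have "((\<lambda>h. (f (x + h) - f x) / h) \<longlongrightarrow> D) (at 0)" using assms by (simp add: DERIV_def)
  moreover have "filterlim (\<lambda>j. inverse (real (Suc j))) (at 0) sequentially"
    unfolding filterlim_at using LIMSEQ_inverse_real_of_nat by auto
  ultimately have "(\<lambda>j. (f (x + inverse (real (Suc j))) - f x) / inverse (real (Suc j))) \<longlonglongrightarrow> D"
    by (rule filterlim_compose)
  thus ?thesis by (simp add: divide_inverse mult.commute)
qed

lemma time_derivative_measurable:
  fixes f f' :: "real \<Rightarrow> real \<Rightarrow> real"
  assumes d: "\<And>t x. ((\<lambda>s. f s x) has_real_derivative f' t x) (at t)" and m: "\<And>t. f t \<in> borel_measurable borel"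
  shows "jointly_measurable f'"
proof (rule borel_measurable_LIMSEQ_real)
  have f: "jointly_measurable f"
    using m by (intro separately_continuous_measurable derivative_continuous[OF d])
  have fs: "(\<lambda>(t, x). f (t + h) x) \<in> borel_measurable (lborel \<Otimes>\<^sub>M lborel)" for h :: real
  proof -
    have "(\<lambda>p. (fst p + h, snd p)) \<in> lborel \<Otimes>\<^sub>M lborel \<rightarrow>\<^sub>M lborel \<Otimes>\<^sub>M (lborel :: real measure)"
      by measurable
    from measurable_compose[OF this f] show ?thesis by (simp add: case_prod_beta)
  qed
  show "(\<lambda>(t, x). real (Suc j) * (f (t + inverse (real (Suc j))) x - f t x)) \<in> borel_measurable (lborel \<Otimes>\<^sub>M lborel)" for j
    using f fs[of "inverse (real (Suc j))"] by measurable
  show "(\<lambda>j. case p of (t, x) \<Rightarrow> real (Suc j) * (f (t + inverse (real (Suc j))) x - f t x)) \<longlonglongrightarrow> case_prod f' p" for p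
    using difference_quotient_sequence[OF d[of "snd p" "fst p"]] by (simp add: case_prod_beta)
qed

section \<open>From weak derivatives to increments\<close>

text \<open>The functions \<open>y\<^sup>-\<^sup>i exp (- 1 / y)\<close>, extended by zero: a family that is closed under differentiation up to linear
combinations.\<close>
definition flat_exp :: "nat \<Rightarrow> real \<Rightarrow> real" where
  "flat_exp i y = (if y > 0 then exp (- inverse y) * inverse y ^ i else 0)"

lemma flat_exp_tendsto_0: "(flat_exp i \<longlongrightarrow> 0) (at 0)"
  unfolding filterlim_at_split
proof
  show "(flat_exp i \<longlongrightarrow> 0) (at_left 0)"
    by (rule tendsto_eventually) (auto simp: eventually_at_filter flat_exp_def)
  have "((\<lambda>y. inverse y ^ i / exp (inverse y)) \<longlongrightarrow> 0) (at_right (0::real))"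
    by (rule filterlim_compose[OF tendsto_power_div_exp_0 filterlim_inverse_at_top_right])
  thus "(flat_exp i \<longlongrightarrow> 0) (at_right 0)"
    by (rule Lim_transform_eventually)
       (auto simp: eventually_at_filter flat_exp_def exp_minus divide_inverse mult.commute)
qed

lemma flat_exp_derivative:
  "(flat_exp i has_real_derivative flat_exp (i + 2) x - real i * flat_exp (Suc i) x) (at x)"
proof (cases x "0 :: real" rule: linorder_cases)
  case less
  have "((\<lambda>_. 0 :: real) has_real_derivative 0) (at x)" by simp
  hence "(flat_exp i has_real_derivative 0) (at x)"
    by (rule has_field_derivative_transform_within_open[of _ _ _ "{..<0}"]) (use less in \<open>auto simp: flat_exp_def\<close>)
  thus ?thesis using less by (simp add: flat_exp_def)
next
  case equal
  have "((\<lambda>h. (flat_exp i (0 + h) - flat_exp i 0) / h) \<longlongrightarrow> 0) (at 0)"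
    by (rule Lim_transform_eventually[OF flat_exp_tendsto_0[of "Suc i"]])
       (auto simp: eventually_at_filter flat_exp_def divide_inverse)
  thus ?thesis unfolding DERIV_def using equal by (simp add: flat_exp_def)
next
  case greater
  have "((\<lambda>y. exp (- inverse y) * inverse y ^ i) has_real_derivative
     exp (- inverse x) * (inverse x)^2 * inverse x ^ i +
     exp (- inverse x) * (real i * inverse x ^ (i - 1) * (- ((inverse x)^2)))) (at x)"
    using greater by (auto intro!: derivative_eq_intros simp: power2_eq_square)
  also have "exp (- inverse x) * (inverse x)^2 * inverse x ^ i +
     exp (- inverse x) * (real i * inverse x ^ (i - 1) * (- ((inverse x)^2))) =
     flat_exp (i + 2) x - real i * flat_exp (Suc i) x"
    using greater by (cases i) (simp_all add: flat_exp_def power2_eq_square)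
  finally have "((\<lambda>y. exp (- inverse y) * inverse y ^ i) has_real_derivative
     flat_exp (i + 2) x - real i * flat_exp (Suc i) x) (at x)" .
  thus ?thesis
    by (rule has_field_derivative_transform_within_open[of _ _ _ "{0<..}"]) (use greater in \<open>auto simp: flat_exp_def\<close>)
qed

text \<open>An algebra of smooth functions that is closed under \<open>deriv\<close>; smoothness of a member is then a plain induction
on the order of the derivative.\<close>
inductive flat_alg :: "(real \<Rightarrow> real) \<Rightarrow> bool" where
  base: "flat_alg (\<lambda>x. flat_exp i (\<alpha> * x + \<beta>))"
| scale: "flat_alg f \<Longrightarrow> flat_alg (\<lambda>x. c * f x)"
| add: "flat_alg f \<Longrightarrow> flat_alg g \<Longrightarrow> flat_alg (\<lambda>x. f x + g x)"
| mult: "flat_alg f \<Longrightarrow> flat_alg g \<Longrightarrow> flat_alg (\<lambda>x. f x * g x)"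

lemma flat_alg_derivative:
  "flat_alg f \<Longrightarrow> \<exists>f'. flat_alg f' \<and> (\<forall>x. (f has_real_derivative f' x) (at x))"
proof (induction rule: flat_alg.induct)
  case (base i \<alpha> \<beta>)
  let ?f' = "\<lambda>x. \<alpha> * (flat_exp (i + 2) (\<alpha> * x + \<beta>) + (- real i) * flat_exp (Suc i) (\<alpha> * x + \<beta>))"
  have "flat_alg ?f'" by (intro flat_alg.intros)
  moreover have "((\<lambda>x. flat_exp i (\<alpha> * x + \<beta>)) has_real_derivative ?f' x) (at x)" for x
  proof -
    have "((\<lambda>x. \<alpha> * x + \<beta>) has_real_derivative \<alpha>) (at x)"
      by (auto intro!: derivative_eq_intros)
    from DERIV_chain2[OF flat_exp_derivative this] show ?thesis by (simp add: algebra_simps)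
  qed
  ultimately show ?case by blast
next
  case (scale f c)
  then obtain f' where "flat_alg f'" "\<forall>x. (f has_real_derivative f' x) (at x)" by blast
  thus ?case by (intro exI[of _ "\<lambda>x. c * f' x"]) (auto intro: flat_alg.scale DERIV_cmult)
next
  case (add f g)
  then obtain f' g' where "flat_alg f'" "\<forall>x. (f has_real_derivative f' x) (at x)"
    "flat_alg g'" "\<forall>x. (g has_real_derivative g' x) (at x)" by blast
  thus ?case by (intro exI[of _ "\<lambda>x. f' x + g' x"]) (auto intro: flat_alg.add DERIV_add)
next
  case (mult f g)
  then obtain f' g' where *: "flat_alg f'" "\<forall>x. (f has_real_derivative f' x) (at x)"
    "flat_alg g'" "\<forall>x. (g has_real_derivative g' x) (at x)" by blast
  have "((\<lambda>x. f x * g x) has_real_derivative f' x * g x + f x * g' x) (at x)" for x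
    using * by (auto intro!: derivative_eq_intros)
  moreover have "flat_alg (\<lambda>x. f' x * g x + f x * g' x)"
    using * mult by (intro flat_alg.add flat_alg.mult)
  ultimately show ?case by blast
qed

lemma flat_alg_smooth: "flat_alg f \<Longrightarrow> (deriv ^^ m) f differentiable (at x)"
proof (induction m arbitrary: f)
  case 0
  thus ?case using flat_alg_derivative real_differentiable_def by fastforce
next
  case (Suc m)
  obtain f' where f': "flat_alg f'" "\<forall>x. (f has_real_derivative f' x) (at x)"
    using flat_alg_derivative[OF Suc.prems] by blast
  have "deriv f = f'" using f'(2) by (auto intro: DERIV_imp_deriv)
  thus ?case using Suc.IH[OF f'(1)] by (simp add: funpow_swap1)
qed

lemma smooth_antiderivative_flat_alg:
  assumes "flat_alg f" "\<And>x. (\<psi> has_real_derivative f x) (at x)"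
  shows "smooth_on UNIV \<psi>"
  unfolding smooth_on_def
proof (intro allI ballI)
  fix m x
  have "deriv \<psi> = f" using assms(2) by (auto intro: DERIV_imp_deriv)
  thus "(deriv ^^ m) \<psi> differentiable (at x)"
    using flat_alg_smooth[OF assms(1)] assms(2)
    by (cases m) (auto simp: funpow_swap1 real_differentiable_def)
qed

text \<open>Smooth, supported in \<open>[a, b]\<close>, and increasing in \<open>j\<close> to the indicator of the open interval, since both
exponents are divided by \<open>j + 1\<close>.\<close>
definition bump :: "real \<Rightarrow> real \<Rightarrow> nat \<Rightarrow> real \<Rightarrow> real" where
  "bump a b j x = flat_exp 0 (real (Suc j) * (x - a)) * flat_exp 0 (real (Suc j) * (b - x))"

lemma flat_alg_bump: "flat_alg (bump a b j)"
proof -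
  have "flat_alg (\<lambda>x. flat_exp 0 (real (Suc j) * x + - (real (Suc j) * a)) *
      flat_exp 0 (- real (Suc j) * x + real (Suc j) * b))"
    by (intro flat_alg.intros)
  moreover have "(\<lambda>x. flat_exp 0 (real (Suc j) * x + - (real (Suc j) * a)) *
      flat_exp 0 (- real (Suc j) * x + real (Suc j) * b)) = bump a b j"
    by (rule ext) (simp add: bump_def algebra_simps)
  ultimately show ?thesis by simp
qed

lemma bump_bounds: "0 \<le> bump a b j x" "bump a b j x \<le> indicator {a<..<b} x"
proof -
  have "0 \<le> flat_exp 0 y" "flat_exp 0 y \<le> 1" for y by (auto simp: flat_exp_def)
  moreover have "bump a b j x = 0" if "x \<notin> {a<..<b}"
    using that by (auto simp: bump_def flat_exp_def zero_less_mult_iff)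
  ultimately show "0 \<le> bump a b j x" "bump a b j x \<le> indicator {a<..<b} x"
    by (auto simp: bump_def mult_le_one split: split_indicator)
qed

lemma bump_tendsto: "(\<lambda>j. bump a b j x) \<longlonglongrightarrow> indicator {a<..<b} x"
proof (cases "x \<in> {a<..<b}")
  case True
  have *: "(\<lambda>j. flat_exp 0 (real (Suc j) * c)) \<longlonglongrightarrow> 1" if "c > 0" for c
  proof -
    have "(\<lambda>j. exp (- (inverse (real (Suc j)) * inverse c))) \<longlonglongrightarrow> exp (- (0 * inverse c))"
      by (intro tendsto_intros LIMSEQ_inverse_real_of_nat)
    thus ?thesis using that by (simp add: flat_exp_def zero_less_mult_iff)
  qed
  have "(\<lambda>j. bump a b j x) \<longlonglongrightarrow> 1 * 1"
    unfolding bump_def using True by (intro tendsto_mult *) auto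
  thus ?thesis using True by simp
next
  case False
  hence "bump a b j x = 0" for j using bump_bounds[of a b j x] by simp
  thus ?thesis using False by simp
qed

lemma bump_continuous: "continuous_on UNIV (bump a b j)"
  using flat_alg_derivative[OF flat_alg_bump] derivative_continuous by blast

lemma continuous_antiderivative:
  fixes f :: "real \<Rightarrow> real"
  assumes "continuous_on UNIV f"
  shows "\<exists>F. \<forall>x. (F has_real_derivative f x) (at x)"
proof -
  have "\<forall>x. isCont f x" using assms continuous_on_eq_continuous_at by blast
  thus ?thesis
    using einterval_antiderivative[of "-\<infinity>" \<infinity> f] by (auto simp: has_real_derivative_iff_has_vector_derivative)
qed

text \<open>The weak identity is extended from smooth test functions to the trapezoid whose value at \<open>x\<close> is the
length of \<open>[x - s, x] \<inter> (a, b)\<close>: it is the limit of the antiderivatives of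
\<open>bump a b j x - bump a b j (x - s)\<close>, which vanish outside \<open>[a, b + s]\<close> because the two bumps are translates
of each other.\<close>
lemma weak_derivative_trapezoid:
  assumes f: "L2_fun f" and wd: "L2_weak_deriv f g" and "a < b" "s > 0"
  shows "(LBINT x. f x * (indicator {a<..<b} x - indicator {a<..<b} (x - s))) =
     - (LBINT x. g x * (LBINT z:{x-s..x}. indicator {a<..<b} z))"
proof -
  have g: "L2_fun g" using wd by (simp add: L2_weak_deriv_def)
  have mf[measurable]: "f \<in> borel_measurable borel" "g \<in> borel_measurable borel"
    using f g L2_funD by auto
  have mb[measurable]: "bump a b j \<in> borel_measurable borel" for j
    by (intro continuous_measurable bump_continuous)
  define \<psi> where "\<psi> j x = (LBINT z:{x-s..x}. bump a b j z)" for j x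
  have ib: "set_integrable lborel {y..z} (bump a b j)" for j y z
    by (rule borel_integrable_atLeastAtMost')
       (rule continuous_on_subset[OF bump_continuous], simp)
  have d\<psi>: "(\<psi> j has_real_derivative bump a b j x - bump a b j (x - s)) (at x)" for j x
  proof -
    obtain P where P: "\<And>x. (P has_real_derivative bump a b j x) (at x)"
      using continuous_antiderivative[OF bump_continuous] by blast
    have "\<psi> j = (\<lambda>x. P x - P (x - s))"
    proof
      fix x
      have "continuous_on {x-s..x} P"
        by (intro continuous_at_imp_continuous_on ballI DERIV_isCont[OF P])
      from FTC_set_integral[OF _ finite.emptyI this P ib] show "\<psi> j x = P x - P (x - s)"
        using \<open>s > 0\<close> by (simp add: \<psi>_def)
    qed
    moreover have "((\<lambda>x. P (x - s)) has_real_derivative bump a b j (x - s)) (at x)"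
      using DERIV_shift[of P "bump a b j (x - s)" x "-s"] P by simp
    ultimately show ?thesis using P by (auto intro!: DERIV_diff)
  qed
  have b\<psi>: "\<bar>\<psi> j x\<bar> \<le> s * indicator {a..b+s} x" for j x
  proof (cases "x \<in> {a..b+s}")
    case True
    have "\<bar>\<psi> j x\<bar> = \<psi> j x"
      using bump_bounds unfolding \<psi>_def set_lebesgue_integral_def by simp
    also have "\<dots> \<le> (LBINT z:{x-s..x}. 1)"
      unfolding \<psi>_def
    proof (rule set_integral_mono[OF ib set_integrable_const])
      fix z show "bump a b j z \<le> 1"
        using bump_bounds(2)[of a b j z] by (auto split: split_indicator_asm)
    qed
    also have "\<dots> = s" using \<open>s > 0\<close> by (simp add: set_lebesgue_integral_def)
    finally show ?thesis using True by simp
  next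
    case False
    have "(\<lambda>z. indicator {x-s..x} z * bump a b j z) = (\<lambda>_. 0)"
    proof
      fix z show "indicator {x-s..x} z * bump a b j z = 0"
        using False bump_bounds[of a b j z] by (auto split: split_indicator split_indicator_asm)
    qed
    hence "\<psi> j x = 0" unfolding \<psi>_def set_lebesgue_integral_def by simp
    thus ?thesis using False by simp
  qed
  have "test_fun (\<psi> j)" for j
    unfolding test_fun_def
  proof
    have "flat_alg (\<lambda>x. bump a b j x + (-1) * bump (a + s) (b + s) j x)"
      by (intro flat_alg.add flat_alg.scale flat_alg_bump)
    moreover have "(\<lambda>x. bump a b j x + (-1) * bump (a + s) (b + s) j x) = (\<lambda>x. bump a b j x - bump a b j (x - s))"
      by (simp add: bump_def algebra_simps)
    ultimately have "flat_alg (\<lambda>x. bump a b j x - bump a b j (x - s))" by simp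
    thus "smooth_on UNIV (\<psi> j)" using d\<psi> by (rule smooth_antiderivative_flat_alg)
    have "{x. \<psi> j x \<noteq> 0} \<subseteq> {a..b+s}"
    proof
      fix x assume "x \<in> {x. \<psi> j x \<noteq> 0}"
      thus "x \<in> {a..b+s}" using b\<psi>[of j x] by (auto split: split_indicator_asm)
    qed
    thus "bounded {x. \<psi> j x \<noteq> 0}" by (rule bounded_subset[OF bounded_closed_interval])
  qed
  moreover have "deriv (\<psi> j) = (\<lambda>x. bump a b j x - bump a b j (x - s))" for j
    using d\<psi> by (auto intro: DERIV_imp_deriv)
  ultimately have eq: "(LBINT x. f x * (bump a b j x - bump a b j (x - s))) = - (LBINT x. g x * \<psi> j x)" for j
    using wd unfolding L2_weak_deriv_def by metis
  have lim1: "(\<lambda>j. LBINT x. f x * (bump a b j x - bump a b j (x - s))) \<longlonglongrightarrow>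
      (LBINT x. f x * (indicator {a<..<b} x - indicator {a<..<b} (x - s)))"
  proof (rule integral_dominated_convergence)
    show "integrable lborel (\<lambda>x. \<bar>f x * indicator {a..b+s} x\<bar>)"
      using L2_mult_integrable[OF f L2_indicator] by (rule integrable_abs)
    show "AE x in lborel. norm (f x * (bump a b j x - bump a b j (x - s))) \<le> \<bar>f x * indicator {a..b+s} x\<bar>" for j
    proof (rule AE_I2)
      fix x
      have "\<bar>bump a b j x - bump a b j (x - s)\<bar> \<le> indicator {a..b+s} x"
        using bump_bounds[of a b j x] bump_bounds[of a b j "x - s"] \<open>s > 0\<close>
        by (auto split: split_indicator_asm split_indicator)
      thus "norm (f x * (bump a b j x - bump a b j (x - s))) \<le> \<bar>f x * indicator {a..b+s} x\<bar>"
        by (simp add: abs_mult mult_left_mono)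
    qed
    show "AE x in lborel. (\<lambda>j. f x * (bump a b j x - bump a b j (x - s))) \<longlonglongrightarrow>
        f x * (indicator {a<..<b} x - indicator {a<..<b} (x - s))"
      by (intro AE_I2 tendsto_intros bump_tendsto)
  qed (measurable)
  have m\<psi>[measurable]: "\<psi> j \<in> borel_measurable borel" for j
    using derivative_continuous[OF d\<psi>] by (rule continuous_measurable)
  have l\<psi>: "(\<lambda>j. \<psi> j x) \<longlonglongrightarrow> (LBINT z:{x-s..x}. indicator {a<..<b} z)" for x
    unfolding \<psi>_def set_lebesgue_integral_def
  proof (rule integral_dominated_convergence)
    show "integrable lborel (\<lambda>z. indicator {x-s..x} z *\<^sub>R (1::real))"
      using set_integrable_const unfolding set_integrable_def .
    show "AE z in lborel. norm (indicator {x-s..x} z *\<^sub>R bump a b j z) \<le> indicator {x-s..x} z *\<^sub>R 1" for j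
    proof (rule AE_I2)
      fix z show "norm (indicator {x-s..x} z *\<^sub>R bump a b j z) \<le> indicator {x-s..x} z *\<^sub>R (1::real)"
        using bump_bounds[of a b j z] by (auto split: split_indicator split_indicator_asm)
    qed
    show "AE z in lborel. (\<lambda>j. indicator {x-s..x} z *\<^sub>R bump a b j z) \<longlonglongrightarrow> indicator {x-s..x} z *\<^sub>R indicator {a<..<b} z"
      by (intro AE_I2 tendsto_intros bump_tendsto)
  qed (measurable)
  have lim2: "(\<lambda>j. LBINT x. g x * \<psi> j x) \<longlonglongrightarrow> (LBINT x. g x * (LBINT z:{x-s..x}. indicator {a<..<b} z))"
  proof (rule integral_dominated_convergence)
    show "integrable lborel (\<lambda>x. s * \<bar>g x * indicator {a..b+s} x\<bar>)"
      using L2_mult_integrable[OF g L2_indicator] by (intro integrable_mult_right integrable_abs)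
    show "AE x in lborel. norm (g x * \<psi> j x) \<le> s * \<bar>g x * indicator {a..b+s} x\<bar>" for j
    proof (rule AE_I2)
      fix x
      have "\<bar>g x\<bar> * \<bar>\<psi> j x\<bar> \<le> \<bar>g x\<bar> * (s * indicator {a..b+s} x)"
        by (rule mult_left_mono[OF b\<psi>]) simp
      thus "norm (g x * \<psi> j x) \<le> s * \<bar>g x * indicator {a..b+s} x\<bar>"
        by (simp add: abs_mult mult_ac)
    qed
    show "AE x in lborel. (\<lambda>j. g x * \<psi> j x) \<longlonglongrightarrow> g x * (LBINT z:{x-s..x}. indicator {a<..<b} z)"
      by (intro AE_I2 tendsto_intros l\<psi>)
    show "(\<lambda>x. g x * (LBINT z:{x-s..x}. indicator {a<..<b} z)) \<in> borel_measurable lborel"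
    proof -
      have "(\<lambda>x. LBINT z:{x-s..x}. indicator {a<..<b} z :: real) \<in> borel_measurable lborel"
        by (rule borel_measurable_LIMSEQ_real[OF l\<psi>]) simp
      thus ?thesis by simp
    qed
  qed (measurable)
  have "(\<lambda>j. - (LBINT x. g x * \<psi> j x)) \<longlonglongrightarrow> - (LBINT x. g x * (LBINT z:{x-s..x}. indicator {a<..<b} z))"
    by (rule tendsto_minus[OF lim2])
  with lim1 show ?thesis unfolding eq by (rule LIMSEQ_unique)
qed

lemma overlap_length:
  fixes a b s x :: real
  assumes "a < b"
  shows "0 \<le> (LBINT z:{x-s..x}. indicator {a<..<b} z :: real)" "(LBINT z:{x-s..x}. indicator {a<..<b} z :: real) \<le> b - a"
    "x - s \<le> a \<Longrightarrow> b \<le> x \<Longrightarrow> (LBINT z:{x-s..x}. indicator {a<..<b} z :: real) = b - a"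
    "x \<le> a \<or> b \<le> x - s \<Longrightarrow> (LBINT z:{x-s..x}. indicator {a<..<b} z :: real) = 0"
proof -
  show "0 \<le> (LBINT z:{x-s..x}. indicator {a<..<b} z :: real)" by (simp add: set_lebesgue_integral_def)
  have len: "(LBINT z. indicator {a<..<b} z :: real) = b - a" and i: "integrable lborel (indicator {a<..<b} :: real \<Rightarrow> real)"
    using assms by auto
  have "(LBINT z:{x-s..x}. indicator {a<..<b} z :: real) \<le> (LBINT z. indicator {a<..<b} z :: real)"
    unfolding set_lebesgue_integral_def
    using i integrable_mult_indicator[OF _ i, of "{x-s..x}"] by (intro integral_mono) (auto split: split_indicator)
  thus "(LBINT z:{x-s..x}. indicator {a<..<b} z :: real) \<le> b - a" unfolding len .
  show "(LBINT z:{x-s..x}. indicator {a<..<b} z :: real) = b - a" if "x - s \<le> a" "b \<le> x"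
    unfolding len[symmetric] set_lebesgue_integral_def
    using that by (intro Bochner_Integration.integral_cong) (auto split: split_indicator)
  show "(LBINT z:{x-s..x}. indicator {a<..<b} z :: real) = 0" if "x \<le> a \<or> b \<le> x - s"
  proof -
    have "indicator {x-s..x} z *\<^sub>R (indicator {a<..<b} z :: real) = 0" for z
      using that by (auto split: split_indicator)
    thus ?thesis unfolding set_lebesgue_integral_def by (simp only: Bochner_Integration.integral_zero)
  qed
qed

lemma L2_set_integrable: "L2_fun f \<Longrightarrow> set_integrable lborel {a..b} f"
  and L2_square_set_integrable: "L2_fun f \<Longrightarrow> set_integrable lborel {a..b} (\<lambda>x. (f x)^2)"
proof -
  assume f: "L2_fun f"
  from L2_mult_integrable[OF L2_indicator f] show "set_integrable lborel {a..b} f"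
    by (simp add: set_integrable_def)
  show "set_integrable lborel {a..b} (\<lambda>x. (f x)^2)"
    by (rule integrable_imp_set_integrable[OF L2_funD(2)[OF f]])
qed

text \<open>As \<open>b\<close> decreases to \<open>a\<close>, the trapezoids divided by \<open>b - a\<close> tend to the indicator of \<open>(a, a + s]\<close>, while
the other side of the identity becomes a difference of difference quotients of the primitive \<open>G\<close> of \<open>f\<close>.
These converge at every single point, so \<open>f\<close> needs no modification on a null set.\<close>
lemma weak_derivative_FTC:
  assumes f: "L2_fun f" and wd: "L2_weak_deriv f g"
    and G: "\<And>x. (G has_real_derivative f x) (at x)" and s: "s > 0"
  shows "f (a + s) - f a = (LBINT x:{a..a+s}. g x)"
proof -
  have g: "L2_fun g" using wd by (simp add: L2_weak_deriv_def)
  have mg[measurable]: "g \<in> borel_measurable borel" using g by (rule L2_funD)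
  define d where "d j = inverse (real (Suc j))" for j
  have d: "d j > 0" for j by (simp add: d_def)
  define T where "T j x = (LBINT z:{x-s..x}. indicator {a<..<a+d j} z :: real)" for j x
  have ind: "(LBINT x. f x * indicator {y<..<z} x) = G z - G y" "integrable lborel (\<lambda>x. f x * indicator {y<..<z} x)" if "y < z" for y z
  proof -
    have c: "continuous_on {y..z} G" by (intro continuous_at_imp_continuous_on ballI DERIV_isCont[OF G])
    have AE: "AE x in lborel. f x * indicator {y<..<z} x = indicator {y..z} x * f x"
      using AE_lborel_singleton[of y] AE_lborel_singleton[of z]
      by eventually_elim (auto split: split_indicator)
    have m: "(\<lambda>x. f x * indicator {y<..<z} x) \<in> borel_measurable lborel"
      "(\<lambda>x. indicator {y..z} x * f x) \<in> borel_measurable lborel"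
      using f by (auto simp: L2_fun_def)
    have i: "integrable lborel (\<lambda>x. indicator {y..z} x * f x)"
      using L2_set_integrable[OF f, of y z] by (simp add: set_integrable_def)
    from integrable_cong_AE[OF m AE] i show "integrable lborel (\<lambda>x. f x * indicator {y<..<z} x)" by simp
    have "(LBINT x. f x * indicator {y<..<z} x) = (LBINT x. indicator {y..z} x * f x)"
      by (rule integral_cong_AE[OF m AE])
    also have "\<dots> = (LBINT x:{y..z}. f x)" by (simp add: set_lebesgue_integral_def)
    also have "\<dots> = G z - G y"
      by (rule FTC_set_integral[OF _ finite.emptyI c G L2_set_integrable[OF f]]) (use that in simp)
    finally show "(LBINT x. f x * indicator {y<..<z} x) = G z - G y" .
  qed
  have eq: "real (Suc j) * (G (a + d j) - G a) - real (Suc j) * (G (a + s + d j) - G (a + s)) =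
      - (LBINT x. g x * (real (Suc j) * T j x))" for j
  proof -
    have "(LBINT x. f x * (indicator {a<..<a+d j} x - indicator {a<..<a+d j} (x - s))) =
        (LBINT x. f x * indicator {a<..<a+d j} x - f x * indicator {a+s<..<a+s+d j} x)"
      by (intro Bochner_Integration.integral_cong) (auto split: split_indicator)
    also have "\<dots> = (G (a + d j) - G a) - (G (a + s + d j) - G (a + s))"
      using d[of j] by (simp add: ind)
    finally have "(G (a + d j) - G a) - (G (a + s + d j) - G (a + s)) = - (LBINT x. g x * T j x)"
      using weak_derivative_trapezoid[OF f wd, of a "a + d j" s] d[of j] s by (simp add: T_def)
    moreover have "(LBINT x. g x * (real (Suc j) * T j x)) = real (Suc j) * (LBINT x. g x * T j x)"
      by (subst integral_mult_right_zero[symmetric]) (simp add: mult_ac)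
    ultimately show ?thesis by (metis minus_mult_right right_diff_distrib)
  qed
  have lim1: "(\<lambda>j. real (Suc j) * (G (a + d j) - G a) - real (Suc j) * (G (a + s + d j) - G (a + s)))
      \<longlonglongrightarrow> f a - f (a + s)"
    unfolding d_def by (intro tendsto_diff difference_quotient_sequence G)
  have lim2: "(\<lambda>j. LBINT x. g x * (real (Suc j) * T j x)) \<longlonglongrightarrow> (LBINT x. g x * indicator {a<..a+s} x)"
  proof (rule integral_dominated_convergence)
    show "integrable lborel (\<lambda>x. \<bar>indicator {a..a+s+1} x * g x\<bar>)"
      using L2_set_integrable[OF g, of a "a+s+1"] by (simp add: set_integrable_def)
    have d1: "d j \<le> 1" for j by (simp add: d_def field_simps)
    show "AE x in lborel. norm (g x * (real (Suc j) * T j x)) \<le> \<bar>indicator {a..a+s+1} x * g x\<bar>" for j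
    proof (rule AE_I2)
      fix x
      have "\<bar>real (Suc j) * T j x\<bar> \<le> indicator {a..a+s+1} x"
      proof (cases "x \<in> {a..a+s+1}")
        case True
        have "0 \<le> T j x" "T j x \<le> d j" using overlap_length(1,2)[of a "a + d j" x s] d[of j] by (simp_all add: T_def)
        moreover have "real (Suc j) * d j = 1" by (simp add: d_def)
        ultimately have "\<bar>real (Suc j) * T j x\<bar> \<le> 1"
          by (metis abs_of_nonneg mult_left_mono mult_nonneg_nonneg of_nat_0_le_iff)
        thus ?thesis using True by simp
      next
        case False
        hence "x \<le> a \<or> a + d j \<le> x - s" using d1[of j] by auto
        thus ?thesis using overlap_length(4)[of a "a + d j" x s] d[of j] by (simp add: T_def)
      qed
      hence "\<bar>g x\<bar> * \<bar>real (Suc j) * T j x\<bar> \<le> \<bar>g x\<bar> * indicator {a..a+s+1} x" by (intro mult_left_mono) auto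
      thus "norm (g x * (real (Suc j) * T j x)) \<le> \<bar>indicator {a..a+s+1} x * g x\<bar>"
        by (simp add: abs_mult mult_ac)
    qed
    show "AE x in lborel. (\<lambda>j. g x * (real (Suc j) * T j x)) \<longlonglongrightarrow> g x * indicator {a<..a+s} x"
    proof (rule AE_I2)
      fix x
      have d0: "d \<longlonglongrightarrow> 0" unfolding d_def by (rule LIMSEQ_inverse_real_of_nat)
      have "\<forall>\<^sub>F j in sequentially. real (Suc j) * T j x = indicator {a<..a+s} x"
      proof -
        consider "x \<le> a" | "a < x" "x \<le> a + s" | "a + s < x" by linarith
        thus ?thesis
        proof cases
          case 1
          hence "T j x = 0" for j using overlap_length(4)[of a "a + d j" x s] d[of j] by (simp add: T_def)
          thus ?thesis using 1 by simp
        next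
          case 2
          hence "\<forall>\<^sub>F j in sequentially. d j < x - a" using d0 by (intro order_tendstoD(2)) auto
          thus ?thesis
          proof eventually_elim
            case (elim j)
            have "T j x = d j" using overlap_length(3)[of a "a + d j" x s] d[of j] elim 2 by (simp add: T_def)
            thus ?case using 2 by (simp add: d_def)
          qed
        next
          case 3
          hence "\<forall>\<^sub>F j in sequentially. d j < x - s - a" using d0 by (intro order_tendstoD(2)) auto
          thus ?thesis
          proof eventually_elim
            case (elim j)
            have "T j x = 0" using overlap_length(4)[of a "a + d j" x s] d[of j] elim 3 by (simp add: T_def)
            thus ?case using 3 by simp
          qed
        qed
      qed
      hence "(\<lambda>j. real (Suc j) * T j x) \<longlonglongrightarrow> indicator {a<..a+s} x" by (rule tendsto_eventually)
      thus "(\<lambda>j. g x * (real (Suc j) * T j x)) \<longlonglongrightarrow> g x * indicator {a<..a+s} x" by (intro tendsto_intros)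
    qed
    show "(\<lambda>x. g x * (real (Suc j) * T j x)) \<in> borel_measurable lborel" for j
    proof -
      have "(\<lambda>(x, z). indicator {x-s..x} z * indicator {a<..<a+d j} z :: real) \<in> borel_measurable (lborel \<Otimes>\<^sub>M lborel)"
      proof -
        have "(\<lambda>(x, z). indicator {x-s..x} z * indicator {a<..<a+d j} z :: real) =
          (\<lambda>(x, z). (if x - s \<le> z then 1 else 0) * (if z \<le> x then 1 else 0) * indicator {a<..<a+d j} z)"
          by (auto split: split_indicator)
        thus ?thesis by simp
      qed
      from lborel.borel_measurable_lebesgue_integral[OF this] have "T j \<in> borel_measurable lborel"
        by (simp add: T_def[abs_def] set_lebesgue_integral_def)
      thus ?thesis by simp
    qed
  qed (measurable)
  have "(LBINT x. g x * indicator {a<..a+s} x) = (LBINT x:{a..a+s}. g x)"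
    unfolding set_lebesgue_integral_def
  proof (rule integral_cong_AE)
    show "AE x in lborel. g x * indicator {a<..a+s} x = indicator {a..a+s} x *\<^sub>R g x"
      using AE_lborel_singleton[of a] by eventually_elim (auto split: split_indicator)
  qed (measurable)
  moreover have "f a - f (a + s) = - (LBINT x. g x * indicator {a<..a+s} x)"
    by (rule LIMSEQ_unique[OF lim1]) (use tendsto_minus[OF lim2] in \<open>simp only: eq\<close>)
  ultimately show ?thesis by simp
qed

text \<open>The characterisation of \<open>H\<^sup>1\<close> by \<open>L\<^sup>2\<close> difference quotients. In contrast to a weak derivative it passes to
Lipschitz functions of several such functions by a pointwise estimate.\<close>
definition L2_Lipschitz :: "real \<Rightarrow> (real \<Rightarrow> real) \<Rightarrow> bool" where
  "L2_Lipschitz C f \<longleftrightarrow> f \<in> borel_measurable borel \<and>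
     (\<forall>h>0. integrable lborel (\<lambda>x. (f (x + h) - f x)^2) \<and> (LBINT x. (f (x + h) - f x)^2) \<le> C * h^2)"

lemma L2_Lipschitz_of_primitive:
  assumes "f \<in> borel_measurable borel" and g: "L2_fun g"
    and FTC: "\<And>a s. s > 0 \<Longrightarrow> f (a + s) - f a = (LBINT x:{a..a+s}. g x)"
  shows "L2_Lipschitz (sqnorm g) f"
  unfolding L2_Lipschitz_def
proof (intro conjI allI impI)
  fix h :: real assume h: "h > 0"
  have bd: "\<forall>\<tau>\<in>{0..h}. integrable lborel (\<lambda>x. (g (x + \<tau>))^2) \<and> (LBINT x. (g (x + \<tau>))^2) \<le> sqnorm g"
    using integrable_shift[OF L2_funD(2)[OF g]] by simp
  note S = integral_square_strip[OF shifted_measurable[OF L2_funD(1)[OF g]] bd]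
  have eq: "f (x + h) - f x = (LBINT \<tau>:{0..h}. g (x + \<tau>))" for x
    using FTC[OF h] by (simp add: set_integral_shift)
  show "integrable lborel (\<lambda>x. (f (x + h) - f x)^2)"
    unfolding eq using S(1) h by (auto simp: L2_fun_def)
  show "(LBINT x. (f (x + h) - f x)^2) \<le> sqnorm g * h^2"
    unfolding eq using S(4) h by (simp add: mult.commute)
qed (rule assms)

lemma L2_Lipschitz_mono: "L2_Lipschitz C f \<Longrightarrow> C \<le> D \<Longrightarrow> L2_Lipschitz D f"
  unfolding L2_Lipschitz_def by (meson mult_right_mono order_trans zero_le_power2)

lemma L2_Lipschitz_combine:
  assumes f: "L2_Lipschitz C f" and g: "L2_Lipschitz D g" and m: "F \<in> borel_measurable borel"
    and F: "\<And>x y. \<bar>F y - F x\<bar> \<le> A * \<bar>f y - f x\<bar> + A * \<bar>g y - g x\<bar>"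
  shows "L2_Lipschitz (2 * A^2 * (C + D)) F"
  unfolding L2_Lipschitz_def
proof (intro conjI allI impI)
  fix h :: real assume h: "h > 0"
  let ?B = "\<lambda>x. 2 * A^2 * ((f (x + h) - f x)^2 + (g (x + h) - g x)^2)"
  have le: "(F (x + h) - F x)^2 \<le> ?B x" for x
  proof -
    let ?u = "\<bar>f (x + h) - f x\<bar>" and ?v = "\<bar>g (x + h) - g x\<bar>"
    have "(F (x + h) - F x)^2 \<le> (A * ?u + A * ?v)^2"
      using F[of "x + h" x] by (rule abs_le_square_iff[THEN iffD1, OF order_trans]) simp
    also have "\<dots> = A^2 * (?u + ?v)^2" by (simp add: power_mult_distrib flip: distrib_left)
    also have "\<dots> \<le> A^2 * (2 * (?u^2 + ?v^2))"
      using sum_squares_bound[of ?u ?v] by (intro mult_left_mono) (auto simp: power2_sum)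
    finally show ?thesis by (simp add: algebra_simps)
  qed
  have i: "integrable lborel ?B" using f g h by (simp add: L2_Lipschitz_def)
  show I: "integrable lborel (\<lambda>x. (F (x + h) - F x)^2)"
    by (rule integrable_dominated[OF i]) (use m le in auto)
  have "(LBINT x. (F (x + h) - F x)^2) \<le> (LBINT x. ?B x)"
    by (rule integral_mono[OF I i le])
  also have "\<dots> = 2 * A^2 * ((LBINT x. (f (x + h) - f x)^2) + (LBINT x. (g (x + h) - g x)^2))"
    using f g h by (simp add: L2_Lipschitz_def)
  also have "\<dots> \<le> 2 * A^2 * (C * h^2 + D * h^2)"
    using f g h by (intro mult_left_mono add_mono) (auto simp: L2_Lipschitz_def)
  finally show "(LBINT x. (F (x + h) - F x)^2) \<le> 2 * A^2 * (C + D) * h^2"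
    by (simp add: algebra_simps)
qed (rule m)

text \<open>Fatou's lemma for the difference quotients with step \<open>1 / (j + 1)\<close>.\<close>
lemma L2_Lipschitz_derivative:
  assumes f: "L2_Lipschitz C f" and d: "\<And>x. (f has_real_derivative f' x) (at x)"
  shows "L2_fun f'" "sqnorm f' \<le> C"
proof -
  let ?q = "\<lambda>j x. real (Suc j) * (f (x + inverse (real (Suc j))) - f x)"
  have [measurable]: "f \<in> borel_measurable borel" using f by (simp add: L2_Lipschitz_def)
  have lim: "(\<lambda>j. ?q j x) \<longlonglongrightarrow> f' x" for x by (rule difference_quotient_sequence[OF d])
  have m[measurable]: "f' \<in> borel_measurable borel"
    by (rule borel_measurable_LIMSEQ_real[OF lim]) measurable
  have qb: "(\<integral>\<^sup>+x. ennreal ((?q j x)^2) \<partial>lborel) \<le> ennreal C" for j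
  proof -
    have h: "inverse (real (Suc j)) > 0" by simp
    let ?D = "\<lambda>x. (f (x + inverse (real (Suc j))) - f x)^2"
    have D: "integrable lborel ?D" "(LBINT x. ?D x) \<le> C * (inverse (real (Suc j)))^2"
      using f h unfolding L2_Lipschitz_def by blast+
    have eq: "(?q j x)^2 = (real (Suc j))^2 * ?D x" for x by (simp only: power_mult_distrib)
    have "(\<integral>\<^sup>+x. ennreal ((?q j x)^2) \<partial>lborel) = ennreal (LBINT x. (real (Suc j))^2 * ?D x)"
      unfolding eq using D(1) by (intro nn_integral_eq_integral integrable_mult_right) auto
    also have "(LBINT x. (real (Suc j))^2 * ?D x) = (real (Suc j))^2 * (LBINT x. ?D x)" by simp
    also have "\<dots> \<le> (real (Suc j))^2 * (C * (inverse (real (Suc j)))^2)"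
      by (intro mult_left_mono D) simp
    also have "\<dots> = C" by (simp add: power_inverse)
    finally show ?thesis by (simp add: ennreal_leI)
  qed
  have C: "C \<ge> 0"
  proof -
    have "(LBINT x. (f (x + 1) - f x)^2) \<le> C * 1^2" using f unfolding L2_Lipschitz_def by (meson zero_less_one)
    moreover have "0 \<le> (LBINT x. (f (x + 1) - f x)^2)" by simp
    ultimately have "0 \<le> C * 1^2" by (rule order_trans[rotated])
    thus ?thesis by simp
  qed
  have "(\<integral>\<^sup>+x. ennreal ((f' x)^2) \<partial>lborel) = (\<integral>\<^sup>+x. liminf (\<lambda>j. ennreal ((?q j x)^2)) \<partial>lborel)"
  proof (rule nn_integral_cong)
    fix x
    have "(\<lambda>j. ennreal ((?q j x)^2)) \<longlonglongrightarrow> ennreal ((f' x)^2)"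
      by (intro tendsto_ennrealI tendsto_power lim)
    from lim_imp_Liminf[OF _ this] show "ennreal ((f' x)^2) = liminf (\<lambda>j. ennreal ((?q j x)^2))" by simp
  qed
  also have "\<dots> \<le> liminf (\<lambda>j. \<integral>\<^sup>+x. ennreal ((?q j x)^2) \<partial>lborel)"
    by (rule nn_integral_liminf) measurable
  also have "\<dots> \<le> ennreal C"
    using qb by (intro Liminf_le) (auto intro: always_eventually)
  finally have le: "(\<integral>\<^sup>+x. ennreal ((f' x)^2) \<partial>lborel) \<le> ennreal C" .
  have i: "integrable lborel (\<lambda>x. (f' x)^2)"
    using le by (intro integrableI_nonneg) (auto simp: le_less_trans)
  thus "L2_fun f'" by (simp add: L2_fun_def)
  have "ennreal (sqnorm f') \<le> ennreal C"
    using le nn_integral_eq_integral[OF i] by simp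
  thus "sqnorm f' \<le> C" using C by simp
qed

text \<open>The increment over \<open>[x, z]\<close> is at most the \<open>L\<^sup>2\<close> norm of \<open>g\<close>; average over \<open>z \<in> [x, x + 1]\<close>.\<close>
lemma Sobolev_sup_bound:
  assumes f: "L2_fun f" and g: "L2_fun g"
    and FTC: "\<And>a s. s > 0 \<Longrightarrow> f (a + s) - f a = (LBINT x:{a..a+s}. g x)"
  shows "(f x)^2 \<le> 2 * sqnorm f + 2 * sqnorm g"
proof -
  have b: "(f x)^2 \<le> 2 * (f z)^2 + 2 * sqnorm g" if "z \<in> {x..x+1}" for z
  proof (cases "z = x")
    case True
    have "0 \<le> sqnorm g" by simp
    thus ?thesis using True by (smt (verit) zero_le_power2)
  next
    case False
    define s where "s = z - x"
    have s: "0 < s" "s \<le> 1" using False that by (auto simp: s_def)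
    have "(LBINT x:{x..x+s}. g x)^2 \<le> (x + s - x) * (LBINT x:{x..x+s}. (g x)^2)"
      using s by (intro Cauchy_Schwarz_interval L2_set_integrable L2_square_set_integrable g) auto
    also have "\<dots> \<le> 1 * sqnorm g"
    proof (rule mult_mono)
      show "(LBINT x:{x..x+s}. (g x)^2) \<le> sqnorm g"
        unfolding set_lebesgue_integral_def
        using L2_funD(2)[OF g] L2_square_set_integrable[OF g, of x "x+s"]
        by (intro integral_mono) (auto simp: set_integrable_def split: split_indicator)
      show "0 \<le> (LBINT x:{x..x+s}. (g x)^2)" by (simp add: set_lebesgue_integral_def)
    qed (use s in auto)
    finally have "(f z - f x)^2 \<le> sqnorm g"
      using FTC[OF s(1), of x] by (simp add: s_def)
    moreover have "(f x)^2 \<le> 2 * (f z)^2 + 2 * (f z - f x)^2"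
    proof -
      have "0 \<le> (2 * f z - f x)^2" by simp
      thus ?thesis by (simp add: power2_eq_square algebra_simps)
    qed
    ultimately show ?thesis by linarith
  qed
  have len: "(LBINT z:{x..x+1}. c) = c" for c :: real by (simp add: set_lebesgue_integral_def)
  have "(f x)^2 = (LBINT z:{x..x+1}. (f x)^2)" by (simp add: len)
  also have "\<dots> \<le> (LBINT z:{x..x+1}. 2 * (f z)^2 + 2 * sqnorm g)"
    using b by (intro set_integral_mono set_integral_add(1) set_integrable_mult_right set_integrable_const L2_square_set_integrable f)
  also have "\<dots> = 2 * (LBINT z:{x..x+1}. (f z)^2) + 2 * sqnorm g"
    by (subst set_integral_add(2)) (auto simp: len intro!: set_integrable_mult_right set_integrable_const L2_square_set_integrable f)
  also have "(LBINT z:{x..x+1}. (f z)^2) \<le> sqnorm f"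
    unfolding set_lebesgue_integral_def
    using L2_funD(2)[OF f] L2_square_set_integrable[OF f, of x "x+1"]
    by (intro integral_mono) (auto simp: set_integrable_def split: split_indicator)
  finally show ?thesis by simp
qed

section \<open>The potentials near zero and a maximum principle\<close>

lemma nonneg_of_derivative_sign:
  fixes h h' :: "real \<Rightarrow> real"
  assumes "h 0 = 0" and d: "\<And>s. \<bar>s\<bar> \<le> \<bar>a\<bar> \<Longrightarrow> (h has_real_derivative h' s) (at s)"
    and sgn: "\<And>s. \<bar>s\<bar> \<le> \<bar>a\<bar> \<Longrightarrow> s * h' s \<ge> 0"
  shows "h a \<ge> 0"
proof (cases a "0 :: real" rule: linorder_cases)
  case less
  have *: "(h has_real_derivative h' s) (at s)" "h' s \<le> 0" if "a \<le> s" "s < 0" for s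
    using d[of s] sgn[of s] that by (simp_all add: zero_le_mult_iff)
  have le: "h s \<le> h a" if "a < s" "s < 0" for s
  proof (rule DERIV_nonpos_imp_nonincreasing[where f = h])
    show "a \<le> s" using that by simp
    fix x assume "a \<le> x" "x \<le> s"
    thus "\<exists>y. (h has_real_derivative y) (at x) \<and> y \<le> 0" using * that by (intro exI[of _ "h' x"]) simp
  qed
  have "isCont h 0" by (rule DERIV_isCont[OF d[of 0]]) simp
  hence "(h \<longlongrightarrow> h 0) (at_left 0)" by (simp add: isCont_def filterlim_at_split)
  moreover have "\<forall>\<^sub>F s in at_left 0. h s \<le> h a"
    using eventually_at_left_real[OF less] by eventually_elim (simp add: le)
  ultimately have "h 0 \<le> h a" by (rule tendsto_upperbound) simp
  thus ?thesis using assms(1) by simp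
next
  case equal
  thus ?thesis using assms by simp
next
  case greater
  have *: "(h has_real_derivative h' s) (at s)" "h' s \<ge> 0" if "s \<le> a" "0 < s" for s
    using d[of s] sgn[of s] that by (simp_all add: zero_le_mult_iff)
  have le: "h s \<le> h a" if "0 < s" "s < a" for s
  proof (rule DERIV_nonneg_imp_nondecreasing[where f = h])
    show "s \<le> a" using that by simp
    fix x assume "s \<le> x" "x \<le> a"
    thus "\<exists>y. (h has_real_derivative y) (at x) \<and> y \<ge> 0" using * that by (intro exI[of _ "h' x"]) simp
  qed
  have "isCont h 0" by (rule DERIV_isCont[OF d[of 0]]) simp
  hence "(h \<longlongrightarrow> h 0) (at_right 0)" by (simp add: isCont_def filterlim_at_split)
  moreover have "\<forall>\<^sub>F s in at_right 0. h s \<le> h a"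
    using eventually_at_right_real[OF greater] by eventually_elim (simp add: le)
  ultimately have "h 0 \<le> h a" by (rule tendsto_upperbound) simp
  thus ?thesis using assms(1) by simp
qed

lemma R_pot_eq: "R_pot a = a * exp a - exp a + 1"
proof -
  have "((\<lambda>s. exp s - s) has_real_derivative q_fun s) (at s within S)" for s S
    unfolding q_fun_def by (auto intro!: derivative_eq_intros)
  hence "(LBINT s=ereal 0..ereal a. q_fun s) = (exp a - a) - (exp 0 - 0)"
    by (intro interval_integral_FTC_finite[where F = "\<lambda>s. exp s - s"])
       (auto simp: q_fun_def has_real_derivative_iff_has_vector_derivative intro!: continuous_intros)
  thus ?thesis by (simp add: R_pot_def q_fun_def algebra_simps)
qed

text \<open>Convexity of the field energy \<open>R\<close> as a function of \<open>q \<phi>\<close>, whose slope is \<open>\<phi>\<close>: the increment differs from the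
linear one by at most the product of the two increments, which is quadratic in the time step below.\<close>
lemma R_pot_increment: "a * (q_fun b - q_fun a) \<le> R_pot b - R_pot a"
    "R_pot b - R_pot a - a * (q_fun b - q_fun a) \<le> (b - a) * (q_fun b - q_fun a)"
proof -
  have e: "exp y * (1 + (x - y)) \<le> exp x" for x y :: real
  proof -
    have "exp y * (1 + (x - y)) \<le> exp y * exp (x - y)" by (intro mult_left_mono exp_ge_add_one_self) auto
    thus ?thesis by (simp add: exp_diff)
  qed
  show "a * (q_fun b - q_fun a) \<le> R_pot b - R_pot a"
    using e[of b a] by (simp add: R_pot_eq q_fun_def algebra_simps)
  show "R_pot b - R_pot a - a * (q_fun b - q_fun a) \<le> (b - a) * (q_fun b - q_fun a)"
    using e[of a b] by (simp add: R_pot_eq q_fun_def algebra_simps)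
qed

lemma R_pot_le: "R_pot a \<le> a * q_fun a"
  using exp_ge_add_one_self[of a] by (simp add: R_pot_eq q_fun_def algebra_simps)

lemma R_pot_lower:
  assumes "\<bar>a\<bar> \<le> \<rho>" shows "(1 - \<rho>) / 2 * a^2 \<le> R_pot a"
proof -
  have "0 \<le> R_pot a - (1 - \<rho>) / 2 * a^2"
  proof (rule nonneg_of_derivative_sign[where h' = "\<lambda>s. s * exp s - (1 - \<rho>) * s" and h = "\<lambda>a. R_pot a - (1 - \<rho>) / 2 * a^2"])
    show "R_pot 0 - (1 - \<rho>) / 2 * 0^2 = 0" by (simp add: R_pot_eq)
    fix s :: real assume s: "\<bar>s\<bar> \<le> \<bar>a\<bar>"
    show "((\<lambda>a. R_pot a - (1 - \<rho>) / 2 * a^2) has_real_derivative s * exp s - (1 - \<rho>) * s) (at s)"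
      unfolding R_pot_eq by (auto intro!: derivative_eq_intros)
    have "1 - \<rho> \<le> exp s" using exp_ge_add_one_self[of s] s assms by linarith
    hence "0 \<le> s^2 * (exp s - (1 - \<rho>))" by simp
    thus "0 \<le> s * (s * exp s - (1 - \<rho>) * s)" by (simp add: power2_eq_square algebra_simps)
  qed
  thus ?thesis by simp
qed

lemma R_pot_nonneg: "0 \<le> R_pot a"
proof -
  have "exp a * (1 + (0 - a)) \<le> exp a * exp (0 - a)" by (intro mult_left_mono exp_ge_add_one_self) auto
  thus ?thesis by (simp add: R_pot_eq algebra_simps exp_minus)
qed

lemma q_fun_increment:
  assumes "\<bar>a\<bar> \<le> 1/2" "\<bar>b\<bar> \<le> 1/2"
  shows "(b - a)^2 / 2 \<le> (q_fun b - q_fun a) * (b - a)" "\<bar>q_fun b - q_fun a\<bar> \<le> 2 * \<bar>b - a\<bar>"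
proof -
  have main: "(y - x) / 2 \<le> q_fun y - q_fun x \<and> q_fun y - q_fun x \<le> 2 * (y - x)"
    if xy: "x < y" "\<bar>x\<bar> \<le> 1/2" "\<bar>y\<bar> \<le> 1/2" for x y
  proof -
    obtain z where z: "x < z" "z < y" "exp y - exp x = (y - x) * exp z"
      using MVT2[of x y exp exp] xy by auto
    have 1: "1/2 \<le> exp z" using exp_ge_add_one_self[of z] z xy by linarith
    have "exp z * (1 + - z) \<le> exp z * exp (- z)" by (intro mult_left_mono exp_ge_add_one_self) auto
    hence "exp z * (1 - z) \<le> 1" by (simp add: exp_minus)
    moreover have "exp z * (1/2) \<le> exp z * (1 - z)" using z xy by (intro mult_left_mono) auto
    ultimately have 2: "exp z \<le> 2" by linarith
    show ?thesis using mult_left_mono[OF 1, of "y - x"] mult_left_mono[OF 2, of "y - x"] z xy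
      by (simp add: q_fun_def)
  qed
  consider "a < b" | "a = b" | "b < a" by linarith
  hence "(b - a)^2 / 2 \<le> (q_fun b - q_fun a) * (b - a) \<and> \<bar>q_fun b - q_fun a\<bar> \<le> 2 * \<bar>b - a\<bar>"
  proof cases
    case 1
    note m = main[OF 1 assms]
    have "(b - a) / 2 * (b - a) \<le> (q_fun b - q_fun a) * (b - a)"
      using m 1 by (intro mult_right_mono) auto
    moreover have "\<bar>q_fun b - q_fun a\<bar> \<le> 2 * \<bar>b - a\<bar>" using m[THEN conjunct1] m[THEN conjunct2] 1 by linarith
    ultimately show ?thesis by (simp add: power2_eq_square)
  next
    case 3
    note m = main[OF 3 assms(2) assms(1)]
    have "(a - b) / 2 * (a - b) \<le> (q_fun a - q_fun b) * (a - b)"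
      using m 3 by (intro mult_right_mono) auto
    hence "(b - a)^2 / 2 \<le> (q_fun b - q_fun a) * (b - a)"
      by (simp add: power2_eq_square algebra_simps)
    moreover have "\<bar>q_fun b - q_fun a\<bar> = q_fun a - q_fun b"
      using m[THEN conjunct1] 3 by (intro abs_of_nonpos[THEN trans]) auto
    hence "\<bar>q_fun b - q_fun a\<bar> \<le> 2 * \<bar>b - a\<bar>" using m 3 by simp
    ultimately show ?thesis by simp
  qed simp
  thus "(b - a)^2 / 2 \<le> (q_fun b - q_fun a) * (b - a)" "\<bar>q_fun b - q_fun a\<bar> \<le> 2 * \<bar>b - a\<bar>"
    by blast+
qed

lemma W_pot_derivative:
  assumes w: "enthalpy p w" and a: "a > -1"
  shows "(W_pot w has_real_derivative w a) (at a)"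
proof -
  have c: "isCont w s" if "s > -1" for s
  proof (rule DERIV_isCont)
    show "(w has_real_derivative inverse (1 + s) * deriv p (1 + s)) (at s)"
      using w that by (simp add: enthalpy_def)
  qed
  have "isCont w s" if "ereal (-1) < ereal s" for s using that by (intro c) simp
  then obtain F where F: "\<And>s. ereal (-1) < ereal s \<Longrightarrow> (F has_vector_derivative w s) (at s)"
    using einterval_antiderivative[of "ereal (-1)" \<infinity> w] by auto
  have F': "(F has_vector_derivative w s) (at s)" if "s > -1" for s using that by (intro F) simp
  have W: "W_pot w s = F s - F 0" if "s > -1" for s
    unfolding W_pot_def
  proof (rule interval_integral_FTC_finite)
    show "continuous_on {min 0 s..max 0 s} w"
      using that by (intro continuous_at_imp_continuous_on ballI c) (simp, linarith)
    fix x assume "min 0 s \<le> x" "x \<le> max 0 s"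
    hence "x > -1" using that by linarith
    thus "(F has_vector_derivative w x) (at x within {min 0 s..max 0 s})"
      by (rule has_vector_derivative_at_within[OF F'])
  qed
  have "((\<lambda>s. F s - F 0) has_real_derivative w a - 0) (at a)"
    using F'[OF a] by (intro DERIV_diff DERIV_const) (simp add: has_real_derivative_iff_has_vector_derivative)
  hence "(W_pot w has_real_derivative w a - 0) (at a)"
    by (rule has_field_derivative_transform_within_open[of _ _ _ "{-1<..}"]) (use a W in auto)
  thus ?thesis by simp
qed

lemma enthalpy_near_zero:
  assumes w: "enthalpy p w" and r: "r < 1"
    and near: "\<And>s. \<bar>s\<bar> \<le> r \<Longrightarrow> \<bar>inverse (1 + s) * deriv p (1 + s) - k\<bar> \<le> \<mu>"
  shows "\<bar>s\<bar> \<le> r \<Longrightarrow> \<bar>s'\<bar> \<le> r \<Longrightarrow> \<mu> \<le> k \<Longrightarrow> \<bar>w s - w s'\<bar> \<le> (k + \<mu>) * \<bar>s - s'\<bar>"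
    and "\<bar>s\<bar> \<le> r \<Longrightarrow> (k - \<mu>) / 2 * s^2 \<le> W_pot w s"
    and "\<bar>s\<bar> \<le> r \<Longrightarrow> W_pot w s \<le> (k + \<mu>) / 2 * s^2"
proof -
  define w' where "w' s = inverse (1 + s) * deriv p (1 + s)" for s
  have w0: "w 0 = 0" using w by (simp add: enthalpy_def)
  have dw: "(w has_real_derivative w' s) (at s)" if "\<bar>s\<bar> \<le> r" for s
  proof -
    have "s > -1" using that r by linarith
    thus ?thesis using w unfolding enthalpy_def w'_def by blast
  qed
  have dW: "(W_pot w has_real_derivative w s) (at s)" if "\<bar>s\<bar> \<le> r" for s
    using that r by (intro W_pot_derivative[OF w]) auto
  have b: "k - \<mu> \<le> w' s" "w' s \<le> k + \<mu>" if "\<bar>s\<bar> \<le> r" for s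
    using near[OF that] by (auto simp: w'_def abs_le_iff)
  have lip: "(k - \<mu>) * (y - x) \<le> w y - w x \<and> w y - w x \<le> (k + \<mu>) * (y - x)"
    if xy: "x < y" "\<bar>x\<bar> \<le> r" "\<bar>y\<bar> \<le> r" for x y
  proof -
    have "\<And>z. x \<le> z \<Longrightarrow> z \<le> y \<Longrightarrow> (w has_real_derivative w' z) (at z)" using xy by (intro dw) auto
    from MVT2[OF xy(1) this] obtain z where z: "x < z" "z < y" "w y - w x = (y - x) * w' z" by blast
    have "\<bar>z\<bar> \<le> r" using z xy by auto
    thus ?thesis using z xy mult_left_mono[OF b(1), of z "y - x"] mult_left_mono[OF b(2), of z "y - x"]
      by (simp add: mult.commute)
  qed
  show "\<bar>w s - w s'\<bar> \<le> (k + \<mu>) * \<bar>s - s'\<bar>" if "\<bar>s\<bar> \<le> r" "\<bar>s'\<bar> \<le> r" "\<mu> \<le> k"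
  proof -
    have "\<bar>w y - w x\<bar> \<le> (k + \<mu>) * \<bar>y - x\<bar>" if xy: "x < y" "\<bar>x\<bar> \<le> r" "\<bar>y\<bar> \<le> r" for x y
    proof -
      have "0 \<le> (k - \<mu>) * (y - x)" using xy \<open>\<mu> \<le> k\<close> by simp
      thus ?thesis using lip[OF xy] xy by simp
    qed
    note L = this
    show ?thesis
    proof (cases s s' rule: linorder_cases)
      case less
      from L[OF this that(1,2)] show ?thesis by (simp add: abs_minus_commute)
    next
      case greater
      from L[OF this that(2,1)] show ?thesis .
    qed simp
  qed
  have sgn: "(k - \<mu>) * s^2 \<le> s * w s" "s * w s \<le> (k + \<mu>) * s^2" if s: "\<bar>s\<bar> \<le> r" for s
  proof -
    have "0 \<le> r" using s by linarith
    consider "s < 0" | "s = 0" | "s > 0" by linarith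
    hence "(k - \<mu>) * s^2 \<le> s * w s \<and> s * w s \<le> (k + \<mu>) * s^2"
    proof cases
      case 1
      have "(k - \<mu>) * (0 - s) \<le> w 0 - w s" "w 0 - w s \<le> (k + \<mu>) * (0 - s)"
        using lip[OF 1 s] \<open>0 \<le> r\<close> by simp_all
      hence "(-s) * ((k - \<mu>) * (0 - s)) \<le> (-s) * (w 0 - w s)" "(-s) * (w 0 - w s) \<le> (-s) * ((k + \<mu>) * (0 - s))"
        using 1 by (intro mult_left_mono; simp)+
      thus ?thesis by (simp add: w0 power2_eq_square algebra_simps)
    next
      case 3
      have "(k - \<mu>) * (s - 0) \<le> w s - w 0" "w s - w 0 \<le> (k + \<mu>) * (s - 0)"
        using lip[OF 3 _ s] \<open>0 \<le> r\<close> by simp_all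
      hence "s * ((k - \<mu>) * (s - 0)) \<le> s * (w s - w 0)" "s * (w s - w 0) \<le> s * ((k + \<mu>) * (s - 0))"
        using 3 by (intro mult_left_mono; simp)+
      thus ?thesis by (simp add: w0 power2_eq_square algebra_simps)
    qed simp
    thus "(k - \<mu>) * s^2 \<le> s * w s" "s * w s \<le> (k + \<mu>) * s^2" by blast+
  qed
  have W0: "W_pot w 0 = 0" by (simp add: W_pot_def)
  show "(k - \<mu>) / 2 * s^2 \<le> W_pot w s" if s: "\<bar>s\<bar> \<le> r"
  proof -
    have "0 \<le> W_pot w s - (k - \<mu>) / 2 * s^2"
    proof (rule nonneg_of_derivative_sign[where h = "\<lambda>s. W_pot w s - (k - \<mu>) / 2 * s^2" and h' = "\<lambda>z. w z - (k - \<mu>) * z"])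
      show "W_pot w 0 - (k - \<mu>) / 2 * 0^2 = 0" by (simp add: W0)
      fix z :: real assume "\<bar>z\<bar> \<le> \<bar>s\<bar>"
      hence z: "\<bar>z\<bar> \<le> r" using s by simp
      show "((\<lambda>s. W_pot w s - (k - \<mu>) / 2 * s^2) has_real_derivative w z - (k - \<mu>) * z) (at z)"
        using dW[OF z] by (auto intro!: derivative_eq_intros)
      show "0 \<le> z * (w z - (k - \<mu>) * z)" using sgn[OF z] by (simp add: power2_eq_square algebra_simps)
    qed
    thus ?thesis by simp
  qed
  show "W_pot w s \<le> (k + \<mu>) / 2 * s^2" if s: "\<bar>s\<bar> \<le> r"
  proof -
    have "0 \<le> (k + \<mu>) / 2 * s^2 - W_pot w s"
    proof (rule nonneg_of_derivative_sign[where h = "\<lambda>s. (k + \<mu>) / 2 * s^2 - W_pot w s" and h' = "\<lambda>z. (k + \<mu>) * z - w z"])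
      show "(k + \<mu>) / 2 * 0^2 - W_pot w 0 = 0" by (simp add: W0)
      fix z :: real assume "\<bar>z\<bar> \<le> \<bar>s\<bar>"
      hence z: "\<bar>z\<bar> \<le> r" using s by simp
      show "((\<lambda>s. (k + \<mu>) / 2 * s^2 - W_pot w s) has_real_derivative (k + \<mu>) * z - w z) (at z)"
        using dW[OF z] by (auto intro!: derivative_eq_intros)
      show "0 \<le> z * ((k + \<mu>) * z - w z)" using sgn[OF z] by (simp add: power2_eq_square algebra_simps)
    qed
    thus ?thesis by simp
  qed
qed

lemma positive_maximum_second_derivative:
  fixes f f' f'' :: "real \<Rightarrow> real"
  assumes lim: "(f \<longlongrightarrow> 0) at_infinity"
    and d1: "\<And>x. (f has_real_derivative f' x) (at x)"
    and d2: "\<And>x. (f' has_real_derivative f'' x) (at x)"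
    and c: "c \<ge> 0" "f x1 > c"
  shows "\<exists>x0. f x0 > c \<and> f'' x0 \<le> 0"
proof -
  have "f x1 > 0" using c by simp
  hence "\<forall>\<^sub>F x in at_infinity. f x < f x1" using lim by (intro order_tendstoD(2))
  then obtain N where N: "\<And>x. N \<le> \<bar>x\<bar> \<Longrightarrow> f x < f x1" unfolding eventually_at_infinity by auto
  define K where "K = {-\<bar>N\<bar>-\<bar>x1\<bar>..\<bar>N\<bar>+\<bar>x1\<bar>}"
  have cont: "continuous_on K f" using derivative_continuous[OF d1] continuous_on_subset by blast
  have "compact K" "x1 \<in> K" by (auto simp: K_def)
  then obtain x0 where x0: "x0 \<in> K" "\<And>y. y \<in> K \<Longrightarrow> f y \<le> f x0"
    using continuous_attains_sup[OF _ _ cont] by blast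
  have max: "f y \<le> f x0" for y
  proof (cases "y \<in> K")
    case False
    hence "N \<le> \<bar>y\<bar>" by (auto simp: K_def)
    thus ?thesis using N x0(2)[OF \<open>x1 \<in> K\<close>] by (meson less_imp_le order_trans)
  qed (rule x0)
  have "f' x0 = 0" by (rule DERIV_local_max[OF d1, of 1]) (use max in auto)
  have "f'' x0 \<le> 0"
  proof (rule ccontr)
    assume "\<not> f'' x0 \<le> 0"
    then obtain e where e: "e > 0" "\<And>h. h > 0 \<Longrightarrow> h < e \<Longrightarrow> f' x0 < f' (x0 + h)"
      using DERIV_pos_inc_right[OF d2[of x0]] by force
    have "x0 < x0 + e / 2" using e by simp
    from MVT2[OF this d1] obtain z where z: "x0 < z" "z < x0 + e/2" "f (x0 + e/2) - f x0 = e/2 * f' z" by auto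
    have "f' z > 0" using e(2)[of "z - x0"] z e(1) \<open>f' x0 = 0\<close> by simp
    hence "f (x0 + e/2) > f x0" using z(3) e(1) by (smt (verit) mult_pos_pos half_gt_zero)
    thus False using max[of "x0 + e/2"] by simp
  qed
  thus ?thesis using x0(2)[OF \<open>x1 \<in> K\<close>] c by (intro exI[of _ x0]) auto
qed

text \<open>At a maximum of \<open>\<phi>\<close> one has \<open>\<phi> \<le> q \<phi> \<le> n\<close>, and at a minimum \<open>q \<phi> \<ge> n\<close>; the factor 2 absorbs the
convexity of \<open>exp\<close> in the second case.\<close>
lemma Poisson_maximum_principle:
  fixes \<phi> \<phi>' \<phi>'' n :: "real \<Rightarrow> real"
  assumes lim: "(\<phi> \<longlongrightarrow> 0) at_infinity"
    and d1: "\<And>x. (\<phi> has_real_derivative \<phi>' x) (at x)"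
    and d2: "\<And>x. (\<phi>' has_real_derivative \<phi>'' x) (at x)"
    and eq: "\<And>x. - \<phi>'' x + q_fun (\<phi> x) = n x"
    and n: "\<And>x. \<bar>n x\<bar> \<le> r" and r: "0 < r" "r \<le> 1/4"
  shows "\<bar>\<phi> x\<bar> \<le> 2 * r"
proof -
  have "\<phi> x \<le> 2 * r"
  proof (rule ccontr)
    assume "\<not> \<phi> x \<le> 2 * r"
    then obtain x0 where x0: "\<phi> x0 > 2 * r" "\<phi>'' x0 \<le> 0"
      using positive_maximum_second_derivative[OF lim d1 d2, of "2 * r" x] r by auto
    have "q_fun (\<phi> x0) \<ge> \<phi> x0" using exp_ge_add_one_self[of "\<phi> x0"] unfolding q_fun_def by linarith
    thus False using x0 eq[of x0] n[of x0] r by (simp add: abs_le_iff)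
  qed
  moreover have "- \<phi> x \<le> 2 * r"
  proof (rule ccontr)
    assume "\<not> - \<phi> x \<le> 2 * r"
    then obtain x0 where x0: "- \<phi> x0 > 2 * r" "- \<phi>'' x0 \<le> 0"
      using positive_maximum_second_derivative[OF tendsto_minus[OF lim, simplified] DERIV_minus[OF d1] DERIV_minus[OF d2], of "2 * r" x] r by auto
    have "exp (\<phi> x0) * (1 + - \<phi> x0) \<le> exp (\<phi> x0) * exp (- \<phi> x0)"
      by (intro mult_left_mono exp_ge_add_one_self) auto
    hence "exp (\<phi> x0) * (1 - \<phi> x0) \<le> 1" by (simp add: exp_minus)
    moreover have "exp (\<phi> x0) * (1 + 2 * r) \<le> exp (\<phi> x0) * (1 - \<phi> x0)"
      using x0 by (intro mult_left_mono) auto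
    ultimately have le: "exp (\<phi> x0) * (1 + 2 * r) \<le> 1" by linarith
    have "exp (\<phi> x0) \<ge> 1 - r" using eq[of x0] x0(2) n[of x0] by (simp add: q_fun_def abs_le_iff)
    hence "(1 - r) * (1 + 2 * r) \<le> exp (\<phi> x0) * (1 + 2 * r)" using r by (intro mult_right_mono) auto
    with le have "(1 - r) * (1 + 2 * r) \<le> 1" by linarith
    hence "r * (1 - 2 * r) \<le> 0" by (simp add: algebra_simps)
    moreover have "r * (1 - 2 * r) > 0" using r by (intro mult_pos_pos) auto
    ultimately show False by simp
  qed
  ultimately show ?thesis by linarith
qed

section \<open>Bounded Lipschitz weights\<close>

text \<open>Bounded weights with slope at most 1 off a finite set. The energy balance depends on the bound
\<open>X\<close> only through errors of second order in the time step, so \<open>X\<close> may be large there.\<close>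
definition weight :: "(real \<Rightarrow> real) \<Rightarrow> (real \<Rightarrow> real) \<Rightarrow> real \<Rightarrow> bool" where
  "weight \<eta> \<eta>' X \<longleftrightarrow> continuous_on UNIV \<eta> \<and> (\<forall>x. \<bar>\<eta> x\<bar> \<le> X) \<and>
     \<eta>' \<in> borel_measurable borel \<and> (\<forall>x. \<bar>\<eta>' x\<bar> \<le> 1) \<and>
     (\<exists>S. finite S \<and> (\<forall>x. x \<notin> S \<longrightarrow> (\<eta> has_real_derivative \<eta>' x) (at x)))"

lemma weightD:
  assumes "weight \<eta> \<eta>' X"
  shows "continuous_on UNIV \<eta>" "\<eta> \<in> borel_measurable borel" "\<eta>' \<in> borel_measurable borel"
    "\<bar>\<eta> x\<bar> \<le> X" "\<bar>\<eta>' x\<bar> \<le> 1" "0 \<le> X"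
  using assms unfolding weight_def
  by (auto intro: continuous_measurable order_trans[OF abs_ge_zero])

lemma weight_integrable:
  assumes "weight \<eta> \<eta>' X" "integrable lborel (f :: real \<Rightarrow> real)"
  shows "integrable lborel (\<lambda>x. \<eta> x * f x)" "integrable lborel (\<lambda>x. \<eta>' x * f x)"
  using integrable_bounded_mult[OF assms(2)] weightD[OF assms(1)] by blast+

lemma weight_abs_bound:
  assumes "weight \<eta> \<eta>' X" "integrable lborel (f :: real \<Rightarrow> real)"
  shows "\<bar>LBINT x. \<eta> x * f x\<bar> \<le> X * (LBINT x. \<bar>f x\<bar>)" "\<bar>LBINT x. \<eta>' x * f x\<bar> \<le> (LBINT x. \<bar>f x\<bar>)"
    "(LBINT x. \<bar>\<eta> x * f x\<bar>) \<le> X * (LBINT x. \<bar>f x\<bar>)"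
proof -
  note i = weight_integrable[OF assms]
  show 1: "(LBINT x. \<bar>\<eta> x * f x\<bar>) \<le> X * (LBINT x. \<bar>f x\<bar>)"
  proof -
    have "(LBINT x. \<bar>\<eta> x * f x\<bar>) \<le> (LBINT x. X * \<bar>f x\<bar>)"
    proof (rule integral_mono)
      show "integrable lborel (\<lambda>x. \<bar>\<eta> x * f x\<bar>)" using i(1) by (rule integrable_abs)
      show "integrable lborel (\<lambda>x. X * \<bar>f x\<bar>)" using assms(2) by simp
      show "\<bar>\<eta> x * f x\<bar> \<le> X * \<bar>f x\<bar>" for x
        using weightD(4)[OF assms(1), of x] by (simp add: abs_mult mult_right_mono)
    qed
    thus ?thesis by simp
  qed
  have "\<bar>LBINT x. \<eta> x * f x\<bar> \<le> (LBINT x. \<bar>\<eta> x * f x\<bar>)" by (rule integral_abs_bound)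
  with 1 show "\<bar>LBINT x. \<eta> x * f x\<bar> \<le> X * (LBINT x. \<bar>f x\<bar>)" by linarith
  have "\<bar>LBINT x. \<eta>' x * f x\<bar> \<le> (LBINT x. \<bar>\<eta>' x * f x\<bar>)" by (rule integral_abs_bound)
  also have "\<dots> \<le> (LBINT x. \<bar>f x\<bar>)"
  proof (rule integral_mono)
    fix x show "\<bar>\<eta>' x * f x\<bar> \<le> \<bar>f x\<bar>"
      using mult_right_mono[OF weightD(5)[OF assms(1), of x], of "\<bar>f x\<bar>"] by (simp add: abs_mult)
  qed (use assms(2) i in auto)
  finally show "\<bar>LBINT x. \<eta>' x * f x\<bar> \<le> (LBINT x. \<bar>f x\<bar>)" .
qed

lemma weighted_integration_by_parts:
  assumes w: "weight \<eta> \<eta>' X" and d: "\<And>x. (F has_real_derivative f x) (at x)"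
    and F: "integrable lborel F" and f: "integrable lborel f"
  shows "(LBINT x. \<eta> x * f x) = - (LBINT x. \<eta>' x * F x)"
proof -
  note i = weight_integrable[OF w]
  obtain S where S: "finite S" "\<And>x. x \<notin> S \<Longrightarrow> (\<eta> has_real_derivative \<eta>' x) (at x)"
    using w unfolding weight_def by blast
  have "(LBINT x. \<eta>' x * F x + \<eta> x * f x) = 0"
  proof (rule integral_derivative_zero[OF S(1)])
    show "continuous_on UNIV (\<lambda>x. \<eta> x * F x)"
      by (intro continuous_on_mult weightD(1)[OF w] derivative_continuous[OF d])
    show "((\<lambda>x. \<eta> x * F x) has_real_derivative \<eta>' x * F x + \<eta> x * f x) (at x)" if "x \<notin> S" for x
      using DERIV_mult[OF S(2)[OF that] d[of x]] by (simp add: mult.commute add.commute)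
    show "integrable lborel (\<lambda>x. \<eta> x * F x)" by (rule i(1)[OF F])
    show "integrable lborel (\<lambda>x. \<eta>' x * F x + \<eta> x * f x)"
      by (intro Bochner_Integration.integrable_add i F f)
  qed
  thus ?thesis using i F f by simp
qed

lemma integral_abs_mult_le:
  assumes "L2_fun f" "L2_fun g" "h > 0"
  shows "(LBINT x. \<bar>f x * g x\<bar>) \<le> h / 2 * sqnorm f + 1 / (2 * h) * sqnorm g"
proof -
  have "(LBINT x. \<bar>f x * g x\<bar>) \<le> (LBINT x. h / 2 * (f x)^2 + 1 / (2 * h) * (g x)^2)"
  proof (rule integral_mono)
    show "integrable lborel (\<lambda>x. \<bar>f x * g x\<bar>)" using L2_mult_integrable[OF assms(1,2)] by simp
    show "integrable lborel (\<lambda>x. h / 2 * (f x)^2 + 1 / (2 * h) * (g x)^2)"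
      using L2_funD(2)[OF assms(1)] L2_funD(2)[OF assms(2)] by simp
    show "\<bar>f x * g x\<bar> \<le> h / 2 * (f x)^2 + 1 / (2 * h) * (g x)^2" for x
      by (rule abs_mult_le_weighted_squares[OF assms(3)])
  qed
  also have "\<dots> = h / 2 * sqnorm f + 1 / (2 * h) * sqnorm g"
    using L2_funD(2)[OF assms(1)] L2_funD(2)[OF assms(2)] by simp
  finally show ?thesis .
qed

lemma integral_square_sum_le:
  assumes "L2_fun f" "L2_fun g"
  shows "(LBINT x. (f x + g x)^2) \<le> 2 * sqnorm f + 2 * sqnorm g"
proof -
  have "(LBINT x. (f x + g x)^2) \<le> (LBINT x. 2 * (f x)^2 + 2 * (g x)^2)"
  proof (rule integral_mono)
    show "integrable lborel (\<lambda>x. (f x + g x)^2)" by (rule L2_funD(2)[OF L2_fun_add[OF assms]])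
    show "integrable lborel (\<lambda>x. 2 * (f x)^2 + 2 * (g x)^2)"
      using L2_funD(2)[OF assms(1)] L2_funD(2)[OF assms(2)] by simp
    show "(f x + g x)^2 \<le> 2 * (f x)^2 + 2 * (g x)^2" for x
      using sum_squares_bound[of "f x" "g x"] by (simp add: power2_sum)
  qed
  also have "\<dots> = 2 * sqnorm f + 2 * sqnorm g"
    using L2_funD(2)[OF assms(1)] L2_funD(2)[OF assms(2)] by simp
  finally show ?thesis .
qed

lemma integral_square_diff_le:
  assumes "L2_fun f" "L2_fun g"
  shows "(LBINT x. (f x - g x)^2) \<le> 2 * sqnorm f + 2 * sqnorm g"
  using integral_square_sum_le[OF assms(1) L2_fun_minus[OF assms(2)]] by simp

lemma has_derivative_of_increments:
  fixes F N :: "real \<Rightarrow> real"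
  assumes N: "continuous_on UNIV N" and inc: "\<And>y z. y < z \<Longrightarrow> (LBINT x:{y..z}. N x) = F z - F y"
  shows "(F has_real_derivative N x) (at x)"
proof -
  have c: "continuous_on {x-1..y} N" for y by (rule continuous_on_subset[OF N]) simp
  have eq: "F z = F (x - 1) + integral {x-1..z} N" if "z > x - 1" for z
    using inc[OF that] set_borel_integral_eq_integral(2)[OF borel_integrable_atLeastAtMost'[OF c]] by simp
  have "((\<lambda>z. integral {x-1..z} N) has_real_derivative N x) (at x within {x-1..x+1})"
    by (rule integral_has_real_derivative[OF c]) simp
  hence "((\<lambda>z. integral {x-1..z} N) has_real_derivative N x) (at x)"
    by (simp add: at_within_Icc_at)
  hence "((\<lambda>z. F (x - 1) + integral {x-1..z} N) has_real_derivative 0 + N x) (at x)"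
    by (intro DERIV_add DERIV_const)
  hence "(F has_real_derivative 0 + N x) (at x)"
    by (rule has_field_derivative_transform_within_open[of _ _ _ "{x-1<..}"]) (use eq in auto)
  thus ?thesis by simp
qed

text \<open>The two weights measure the distances of the clamped point from the ends of \<open>[a, b]\<close>; they add up to \<open>b - a\<close>.\<close>
lemma weight_clamp:
  fixes a b :: real
  assumes ab: "a < b"
  shows "weight (\<lambda>x. max a (min b x) - a) (indicator {a<..<b}) (b - a)"
    and "weight (\<lambda>x. b - max a (min b x)) (\<lambda>x. - indicator {a<..<b} x) (b - a)"
proof -
  have d: "((\<lambda>x. max a (min b x)) has_real_derivative indicator {a<..<b} x) (at x)" if x: "x \<notin> {a, b}" for x
  proof -
    consider "x < a" | "a < x" "x < b" | "b < x" using x by force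
    thus ?thesis
    proof cases
      case 1
      have "((\<lambda>_. a) has_real_derivative 0) (at x)" by simp
      hence "((\<lambda>x. max a (min b x)) has_real_derivative 0) (at x)"
        by (rule has_field_derivative_transform_within_open[of _ _ _ "{..<a}"]) (use 1 ab in auto)
      thus ?thesis using 1 by simp
    next
      case 2
      have "((\<lambda>x. x) has_real_derivative 1) (at x)" by simp
      hence "((\<lambda>x. max a (min b x)) has_real_derivative 1) (at x)"
        by (rule has_field_derivative_transform_within_open[of _ _ _ "{a<..<b}"]) (use 2 in auto)
      thus ?thesis using 2 by simp
    next
      case 3
      have "((\<lambda>_. b) has_real_derivative 0) (at x)" by simp
      hence "((\<lambda>x. max a (min b x)) has_real_derivative 0) (at x)"
        by (rule has_field_derivative_transform_within_open[of _ _ _ "{b<..}"]) (use 3 ab in auto)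
      thus ?thesis using 3 by simp
    qed
  qed
  have c: "continuous_on UNIV (\<lambda>x. max a (min b x))" by (intro continuous_intros)
  have S: "finite {a, b}" by simp
  have "((\<lambda>x. max a (min b x) - a) has_real_derivative indicator {a<..<b} x) (at x)"
       "((\<lambda>x. b - max a (min b x)) has_real_derivative - indicator {a<..<b} x) (at x)" if "x \<notin> {a, b}" for x
    using DERIV_diff[OF d[OF that] DERIV_const[of a]] DERIV_diff[OF DERIV_const[of b] d[OF that]] by simp_all
  note D = this
  have b1: "\<bar>indicator {a<..<b} x :: real\<bar> \<le> 1" for x by (simp split: split_indicator)
  have b2: "\<bar>max a (min b x) - a\<bar> \<le> b - a" "\<bar>b - max a (min b x)\<bar> \<le> b - a" for x using ab by auto
  show "weight (\<lambda>x. max a (min b x) - a) (indicator {a<..<b}) (b - a)"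
    unfolding weight_def using b1 b2 D(1) S
    by (intro conjI allI exI[of _ "{a, b}"] continuous_on_diff c continuous_on_const impI) auto
  show "weight (\<lambda>x. b - max a (min b x)) (\<lambda>x. - indicator {a<..<b} x) (b - a)"
    unfolding weight_def using b1 b2 D(2) S
    by (intro conjI allI exI[of _ "{a, b}"] continuous_on_diff c continuous_on_const impI) auto
qed

text \<open>Subdivide \<open>[a, b]\<close> into equal steps: the quadratic errors add up to \<open>C (b - a)\<^sup>2 / (j + 1)\<close>.\<close>
lemma increment_bound_linear:
  fixes M :: "real \<Rightarrow> real"
  assumes inc: "\<And>a b. a < b \<Longrightarrow> \<bar>M b - M a\<bar> \<le> \<beta> * (b - a) + C * (b - a)^2" and ab: "a < b"
  shows "\<bar>M b - M a\<bar> \<le> \<beta> * (b - a)"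
proof -
  define d where "d j = (b - a) / real (Suc j)" for j
  have d: "d j > 0" for j using ab by (simp add: d_def)
  have step: "\<bar>M (a + real i * d j) - M a\<bar> \<le> real i * (\<beta> * d j + C * (d j)^2)" for i j
  proof (induction i)
    case (Suc i)
    have "a + real (Suc i) * d j - (a + real i * d j) = d j" by (simp add: algebra_simps)
    moreover have "a + real i * d j < a + real (Suc i) * d j" using d[of j] by (simp add: algebra_simps)
    ultimately have "\<bar>M (a + real (Suc i) * d j) - M (a + real i * d j)\<bar> \<le> \<beta> * d j + C * (d j)^2"
      using inc by metis
    hence "\<bar>M (a + real (Suc i) * d j) - M a\<bar> \<le> real i * (\<beta> * d j + C * (d j)^2) + (\<beta> * d j + C * (d j)^2)"
      using Suc.IH by linarith
    thus ?case by (simp add: algebra_simps)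
  qed simp
  have le: "\<bar>M b - M a\<bar> \<le> \<beta> * (b - a) + C * (b - a)^2 * inverse (real (Suc j))" for j
  proof -
    have e: "real (Suc j) * d j = b - a" by (simp add: d_def)
    have "real (Suc j) * (\<beta> * d j + C * (d j)^2) = \<beta> * (real (Suc j) * d j) + C * (real (Suc j) * d j) * d j"
      by (simp only: distrib_left power2_eq_square mult_ac)
    also have "\<dots> = \<beta> * (b - a) + C * (b - a)^2 * inverse (real (Suc j))"
      unfolding e by (simp add: d_def power2_eq_square divide_inverse mult_ac)
    finally show ?thesis using step[where i = "Suc j" and j = j] unfolding e by simp
  qed
  have "(\<lambda>j. \<beta> * (b - a) + C * (b - a)^2 * inverse (real (Suc j))) \<longlonglongrightarrow> \<beta> * (b - a) + C * (b - a)^2 * 0"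
    by (intro tendsto_intros LIMSEQ_inverse_real_of_nat)
  from LIMSEQ_le_const[OF this] le show ?thesis by simp
qed

section \<open>Small solutions of the Euler--Poisson system\<close>

text \<open>Here \<open>r\<close> bounds \<open>n\<close> and \<open>u\<close> pointwise, \<open>km\<close> and \<open>kp\<close> enclose the slope of \<open>w\<close> on \<open>[-r, r]\<close>, and \<open>D\<close>
bounds, uniformly in time, the squares of the \<open>L\<^sup>2\<close> norms of \<open>n\<close> and \<open>u\<close> and of their first difference quotients.\<close>
locale small_EP_solution =
  fixes p w :: "real \<Rightarrow> real" and n u \<phi> :: "real \<Rightarrow> real \<Rightarrow> real" and r km kp D :: real
  assumes enth: "enthalpy p w" and sol: "EP_solution w n u \<phi>"
    and cons: "conserves_energy w n u \<phi>"
    and r: "0 < r" "r \<le> 1/4" and km: "0 < km" and kp: "0 \<le> kp"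
    and w_Lip: "\<And>s s'. \<bar>s\<bar> \<le> r \<Longrightarrow> \<bar>s'\<bar> \<le> r \<Longrightarrow> \<bar>w s - w s'\<bar> \<le> kp * \<bar>s - s'\<bar>"
    and W_lower: "\<And>s. \<bar>s\<bar> \<le> r \<Longrightarrow> km / 2 * s^2 \<le> W_pot w s"
    and W_upper: "\<And>s. \<bar>s\<bar> \<le> r \<Longrightarrow> W_pot w s \<le> kp / 2 * s^2"
    and n_le: "\<And>t x. \<bar>n t x\<bar> \<le> r" and u_le: "\<And>t x. \<bar>u t x\<bar> \<le> r"
    and n_cont: "\<And>t. continuous_on UNIV (n t)" and u_cont: "\<And>t. continuous_on UNIV (u t)"
    and n_L2: "\<And>t. L2_fun (n t)" and u_L2: "\<And>t. L2_fun (u t)"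
    and n_bd: "\<And>t. sqnorm (n t) \<le> D" and u_bd: "\<And>t. sqnorm (u t) \<le> D"
    and n_Lip: "\<And>t. L2_Lipschitz D (n t)" and u_Lip: "\<And>t. L2_Lipschitz D (u t)"
begin

text \<open>The mass flux \<open>J\<close>; the Bernoulli function \<open>G\<close> without its electric part, so that \<open>\<partial>\<^sub>t u = - \<partial>\<^sub>x (G + \<phi>)\<close>; the
field \<open>E\<close>, whose sign is opposite to that of the electric field; the kinetic and internal energy \<open>kin\<close> and the field energy \<open>fld\<close>, which add up to the energy density; the conserved
energy \<open>en\<close>.\<close>
definition "J t x = (1 + n t x) * u t x"
definition "G t x = 1/2 * (u t x)^2 + w (n t x)"
definition "n_t t x = deriv (\<lambda>s. n s x) t"
definition "u_t t x = deriv (\<lambda>s. u s x) t"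
definition "E t x = deriv (\<phi> t) x"
definition "kin t x = 1/2 * (1 + n t x) * (u t x)^2 + W_pot w (n t x)"
definition "fld t x = 1/2 * (E t x)^2 + R_pot (\<phi> t x)"
definition "en = energy w (n 0) (u 0) (\<phi> 0)"

lemma n_gt: "n t x > -1" using n_le[of t x] r by linarith

text \<open>The equations in terms of \<open>J\<close> and \<open>G\<close>. Time derivatives of \<open>n\<close> and \<open>u\<close> are at the same time space derivatives of
\<open>- J\<close> and \<open>- (G + \<phi>)\<close>, which is how they are estimated.\<close>
lemma dn: "((\<lambda>s. n s x) has_real_derivative n_t t x) (at t)"
  and du: "((\<lambda>s. u s x) has_real_derivative u_t t x) (at t)"
  and dJ: "(J t has_real_derivative - n_t t x) (at x)"
  and dH: "((\<lambda>z. G t z + \<phi> t z) has_real_derivative - u_t t x) (at x)"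
  and d\<phi>: "(\<phi> t has_real_derivative E t x) (at x)"
  and dE: "(E t has_real_derivative q_fun (\<phi> t x) - n t x) (at x)"
proof -
  have e: "(J t) = (\<lambda>z. (1 + n t z) * u t z)" "E t = deriv (\<phi> t)"
    "(\<lambda>z. G t z + \<phi> t z) = (\<lambda>z. 1/2 * (u t z)^2 + w (n t z) + \<phi> t z)"
    by (auto simp: J_def E_def G_def)
  show "((\<lambda>s. n s x) has_real_derivative n_t t x) (at t)" "((\<lambda>s. u s x) has_real_derivative u_t t x) (at t)"
    using sol unfolding n_t_def u_t_def EP_solution_def DERIV_deriv_iff_real_differentiable by blast+
  have "(\<lambda>z. (1 + n t z) * u t z) differentiable (at x)" "n_t t x = - deriv (\<lambda>z. (1 + n t z) * u t z) x"
    using sol unfolding n_t_def EP_solution_def by blast+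
  thus "(J t has_real_derivative - n_t t x) (at x)"
    unfolding e by (simp add: DERIV_deriv_iff_real_differentiable)
  have "(\<lambda>z. 1/2 * (u t z)^2 + w (n t z) + \<phi> t z) differentiable (at x)"
    "u_t t x = - deriv (\<lambda>z. 1/2 * (u t z)^2 + w (n t z) + \<phi> t z) x"
    using sol unfolding u_t_def EP_solution_def by blast+
  thus "((\<lambda>z. G t z + \<phi> t z) has_real_derivative - u_t t x) (at x)"
    unfolding e by (simp add: DERIV_deriv_iff_real_differentiable)
  have P: "\<phi> t differentiable (at x)" "deriv (\<phi> t) differentiable (at x)"
    "- deriv (deriv (\<phi> t)) x + q_fun (\<phi> t x) = n t x"
    using sol unfolding EP_solution_def by blast+
  show "(\<phi> t has_real_derivative E t x) (at x)"
    using P(1) by (simp add: e DERIV_deriv_iff_real_differentiable)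
  have "deriv (deriv (\<phi> t)) x = q_fun (\<phi> t x) - n t x" using P(3) by simp
  thus "(E t has_real_derivative q_fun (\<phi> t x) - n t x) (at x)"
    using P(2) unfolding e by (metis DERIV_deriv_iff_real_differentiable)
qed

lemma dG: "(G t has_real_derivative - u_t t x - E t x) (at x)"
  using DERIV_diff[OF dH[of t x] d\<phi>[of t x]] by simp

lemma \<phi>_le: "\<bar>\<phi> t x\<bar> \<le> 2 * r"
proof (rule Poisson_maximum_principle[OF _ d\<phi> dE _ n_le r])
  show "(\<phi> t \<longlongrightarrow> 0) at_infinity" using sol unfolding EP_solution_def by blast
qed simp

lemma \<phi>_half: "\<bar>\<phi> t x\<bar> \<le> 1/2" using \<phi>_le[of t x] r by linarith

lemma w_n_le: "\<bar>w (n t x)\<bar> \<le> kp * \<bar>n t x\<bar>"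
  using w_Lip[of "n t x" 0] n_le[of t x] r enth by (simp add: enthalpy_def)

lemma W_n_cont: "continuous_on UNIV (\<lambda>x. W_pot w (n t x))"
proof (rule continuous_at_imp_continuous_on, rule ballI)
  fix x
  have "isCont (n t) x" using n_cont continuous_on_eq_continuous_at by blast
  moreover have "isCont (W_pot w) (n t x)" by (rule DERIV_isCont[OF W_pot_derivative[OF enth n_gt]])
  ultimately show "isCont (\<lambda>x. W_pot w (n t x)) x" by (rule isCont_o2)
qed

lemma \<phi>_cont: "continuous_on UNIV (\<phi> t)" by (rule derivative_continuous[OF d\<phi>])
lemma E_cont: "continuous_on UNIV (E t)" by (rule derivative_continuous[OF dE])

lemma R_\<phi>_cont: "continuous_on UNIV (\<lambda>x. R_pot (\<phi> t x))"
  unfolding R_pot_eq by (intro continuous_intros \<phi>_cont)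

lemma q_\<phi>_cont: "continuous_on UNIV (\<lambda>x. q_fun (\<phi> t x))"
  unfolding q_fun_def by (intro continuous_intros \<phi>_cont)

lemma kin_cont: "continuous_on UNIV (kin t)"
  unfolding kin_def by (intro continuous_intros n_cont u_cont W_n_cont)

lemma fld_cont: "continuous_on UNIV (fld t)"
  unfolding fld_def by (intro continuous_intros E_cont R_\<phi>_cont)

lemmas meas = n_cont[THEN continuous_measurable] u_cont[THEN continuous_measurable]
  \<phi>_cont[THEN continuous_measurable]
  E_cont[THEN continuous_measurable] kin_cont[THEN continuous_measurable]
  fld_cont[THEN continuous_measurable] q_\<phi>_cont[THEN continuous_measurable]

lemma kin_lower: "(1 - r) / 2 * (u t x)^2 + km / 2 * (n t x)^2 \<le> kin t x"
proof -
  have "(1 - r) * (u t x)^2 \<le> (1 + n t x) * (u t x)^2"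
    using n_le[of t x] by (intro mult_right_mono) auto
  thus ?thesis using W_lower[OF n_le[of t x]] by (simp add: kin_def)
qed

lemma kin_upper: "kin t x \<le> (1 + kp) * ((n t x)^2 + (u t x)^2)"
proof -
  have "1/2 * (1 + n t x) * (u t x)^2 \<le> 1 * (u t x)^2"
    using n_le[of t x] r by (intro mult_right_mono) auto
  moreover have "kp / 2 * (n t x)^2 \<le> (1 + kp) * (n t x)^2" using kp by (intro mult_right_mono) auto
  moreover have "0 \<le> kp * (u t x)^2" using kp by simp
  moreover have "(1 + kp) * ((n t x)^2 + (u t x)^2) = (1 + kp) * (n t x)^2 + 1 * (u t x)^2 + kp * (u t x)^2"
    by (simp add: algebra_simps)
  ultimately show ?thesis using W_upper[OF n_le[of t x]] unfolding kin_def by linarith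
qed

lemma kin_nonneg: "0 \<le> kin t x"
proof -
  have "0 \<le> (1 - r) / 2 * (u t x)^2 + km / 2 * (n t x)^2" using r km by simp
  thus ?thesis using kin_lower[of t x] by linarith
qed

lemma R_\<phi>_lower: "(1 - 2 * r) / 2 * (\<phi> t x)^2 \<le> R_pot (\<phi> t x)"
  by (rule R_pot_lower[OF \<phi>_le])

lemma fld_nonneg: "0 \<le> fld t x" using R_pot_nonneg[of "\<phi> t x"] by (simp add: fld_def)

lemma energy_split: "energy_density w (n t) (u t) (\<phi> t) x = kin t x + fld t x"
  by (simp add: energy_density_def kin_def fld_def E_def)

lemma energy_integrable: "integrable lborel (\<lambda>x. kin t x + fld t x)"
  using cons unfolding conserves_energy_def energy_split[symmetric] by (simp add: eta_contract_eq)

lemma energy_integral: "(LBINT x. kin t x + fld t x) = en"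
  using cons unfolding conserves_energy_def energy_def en_def energy_split by blast

lemma kin_int: "integrable lborel (kin t)"
  by (rule integrable_dominated[OF energy_integrable[of t]])
     (use meas kin_nonneg fld_nonneg in \<open>auto simp: abs_of_nonneg\<close>)

lemma fld_int: "integrable lborel (fld t)"
  by (rule integrable_dominated[OF energy_integrable[of t]])
     (use meas kin_nonneg fld_nonneg in \<open>auto simp: abs_of_nonneg\<close>)

lemma fld_le: "(LBINT x. fld t x) \<le> en"
proof -
  have "(LBINT x. fld t x) \<le> (LBINT x. kin t x + fld t x)"
    by (intro integral_mono fld_int energy_integrable) (simp add: kin_nonneg)
  thus ?thesis by (simp add: energy_integral)
qed

lemma en_nonneg: "0 \<le> en"
  unfolding energy_integral[of 0, symmetric] using kin_nonneg fld_nonneg by (intro integral_nonneg_AE AE_I2 add_nonneg_nonneg)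

lemma \<phi>_L2: "L2_fun (\<phi> t)" and \<phi>_bd: "sqnorm (\<phi> t) \<le> 4 * en"
  and E_L2: "L2_fun (E t)" and E_bd: "sqnorm (E t) \<le> 2 * en"
proof -
  have 1: "(\<phi> t x)^2 \<le> 4 * fld t x" for x
  proof -
    have "1/4 * (\<phi> t x)^2 \<le> (1 - 2 * r) / 2 * (\<phi> t x)^2" using r by (intro mult_right_mono) auto
    moreover note R_\<phi>_lower[of t x]
    ultimately have "1/4 * (\<phi> t x)^2 \<le> R_pot (\<phi> t x)" by (meson order_trans)
    hence "(\<phi> t x)^2 \<le> 4 * R_pot (\<phi> t x)" by simp
    also have "\<dots> \<le> 4 * fld t x" by (simp add: fld_def)
    finally show ?thesis .
  qed
  have 2: "(E t x)^2 \<le> 2 * fld t x" for x using R_pot_nonneg[of "\<phi> t x"] by (simp add: fld_def)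
  have i1: "integrable lborel (\<lambda>x. (\<phi> t x)^2)"
    by (rule integrable_dominated[of "\<lambda>x. 4 * fld t x"]) (use 1 meas fld_int in auto)
  have i2: "integrable lborel (\<lambda>x. (E t x)^2)"
    by (rule integrable_dominated[of "\<lambda>x. 2 * fld t x"]) (use 2 meas fld_int in auto)
  show "L2_fun (\<phi> t)" "L2_fun (E t)" using i1 i2 meas by (auto simp: L2_fun_def)
  have "sqnorm (\<phi> t) \<le> (LBINT x. 4 * fld t x)" by (intro integral_mono i1 1) (simp add: fld_int)
  thus "sqnorm (\<phi> t) \<le> 4 * en" using fld_le[of t] by simp
  have "sqnorm (E t) \<le> (LBINT x. 2 * fld t x)" by (intro integral_mono i2 2) (simp add: fld_int)
  thus "sqnorm (E t) \<le> 2 * en" using fld_le[of t] by simp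
qed

lemma J_le: "\<bar>J t x\<bar> \<le> (1 + r) * \<bar>u t x\<bar>"
  using n_le[of t x] r unfolding J_def abs_mult by (intro mult_right_mono) auto

lemma G_le: "\<bar>G t x\<bar> \<le> r / 2 * \<bar>u t x\<bar> + kp * \<bar>n t x\<bar>"
proof -
  have "\<bar>u t x\<bar> * \<bar>u t x\<bar> \<le> r * \<bar>u t x\<bar>" using u_le by (intro mult_right_mono) auto
  hence "1/2 * (u t x)^2 \<le> r / 2 * \<bar>u t x\<bar>" "0 \<le> 1/2 * (u t x)^2" by (simp_all add: power2_eq_square)
  thus ?thesis using w_n_le[of t x] unfolding G_def by linarith
qed

lemma J_cont: "continuous_on UNIV (J t)" by (rule derivative_continuous[OF dJ])
lemma G_cont: "continuous_on UNIV (G t)" by (rule derivative_continuous[OF dG])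

lemma J_L2: "L2_fun (J t)"
  by (rule L2_fun_dominated[OF u_L2 continuous_measurable[OF J_cont] J_le])

lemma G_L2: "L2_fun (G t)"
proof (rule L2_fun_dominated)
  show "L2_fun (\<lambda>x. r / 2 * \<bar>u t x\<bar> + kp * \<bar>n t x\<bar>)"
    by (intro L2_fun_add L2_fun_scale L2_fun_dominated[OF u_L2[of t], of _ 1] L2_fun_dominated[OF n_L2[of t], of _ 1])
       (use meas in auto)
  show "G t \<in> borel_measurable borel" by (rule continuous_measurable[OF G_cont])
  show "\<bar>G t x\<bar> \<le> 1 * \<bar>r / 2 * \<bar>u t x\<bar> + kp * \<bar>n t x\<bar>\<bar>" for x
    using order_trans[OF G_le abs_ge_self] by simp
qed

text \<open>One common bound, uniform in time, for the \<open>L\<^sup>2\<close> norms squared of \<open>J\<close>, \<open>\<phi>\<close>, \<open>E\<close>, \<open>n_t\<close> and \<open>u_t\<close>.\<close>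
definition "K = 16 * D + 8 * (1 + kp)^2 * D + 4 * en"

lemma D_nonneg: "0 \<le> D"
proof -
  have "0 \<le> sqnorm (n 0)" by simp
  thus ?thesis using n_bd[of 0] by linarith
qed

lemma K_nonneg: "0 \<le> K" using D_nonneg en_nonneg by (simp add: K_def)

lemma K_ge: "16 * D \<le> K" "4 * en \<le> K" "8 * (1 + kp)^2 * D + 4 * en \<le> K"
  using D_nonneg en_nonneg by (simp_all add: K_def)

lemma J_K: "sqnorm (J t) \<le> K"
proof -
  have "sqnorm (J t) \<le> (LBINT x. 2 * (u t x)^2)"
  proof (rule integral_mono)
    show "integrable lborel (\<lambda>x. (J t x)^2)" by (rule L2_funD(2)[OF J_L2])
    show "integrable lborel (\<lambda>x. 2 * (u t x)^2)" using L2_funD(2)[OF u_L2] by simp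
    fix x
    have "\<bar>J t x\<bar>^2 \<le> ((1 + r) * \<bar>u t x\<bar>)^2" by (intro power_mono J_le) simp
    also have "\<dots> = (1 + r)^2 * (u t x)^2" by (simp add: power_mult_distrib)
    also have "\<dots> \<le> 2 * (u t x)^2"
    proof (rule mult_right_mono)
      have "(1 + r)^2 \<le> (1 + 1/4)^2" using r by (intro power_mono) auto
      thus "(1 + r)^2 \<le> 2" by (simp add: power2_eq_square)
    qed simp
    finally show "(J t x)^2 \<le> 2 * (u t x)^2" by simp
  qed
  thus ?thesis using u_bd[of t] K_ge(1) D_nonneg by simp
qed

lemma \<phi>_K: "sqnorm (\<phi> t) \<le> K" and E_K: "sqnorm (E t) \<le> K"
  using \<phi>_bd[of t] E_bd[of t] K_ge(2) en_nonneg by linarith+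

text \<open>The product \<open>J\<close> inherits \<open>L\<^sup>2\<close> difference quotients from \<open>n\<close> and \<open>u\<close>, and \<open>- n_t\<close> is its derivative.\<close>
lemma n_t_L2: "L2_fun (n_t t)" and n_t_K: "sqnorm (n_t t) \<le> K"
proof -
  have *: "\<bar>J t y - J t x\<bar> \<le> 2 * \<bar>n t y - n t x\<bar> + 2 * \<bar>u t y - u t x\<bar>" for x y
  proof -
    have "J t y - J t x = (1 + n t y) * (u t y - u t x) + (n t y - n t x) * u t x"
      by (simp add: J_def algebra_simps)
    hence "\<bar>J t y - J t x\<bar> \<le> \<bar>1 + n t y\<bar> * \<bar>u t y - u t x\<bar> + \<bar>u t x\<bar> * \<bar>n t y - n t x\<bar>"
      by (metis abs_mult abs_triangle_ineq mult.commute)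
    also have "\<dots> \<le> 2 * \<bar>u t y - u t x\<bar> + 2 * \<bar>n t y - n t x\<bar>"
      using n_le[of t y] u_le[of t x] r by (intro add_mono mult_right_mono) auto
    finally show ?thesis by simp
  qed
  have "L2_Lipschitz (2 * 2^2 * (D + D)) (J t)"
    by (rule L2_Lipschitz_combine[OF n_Lip u_Lip continuous_measurable[OF J_cont] *])
  note L = L2_Lipschitz_derivative[OF this dJ]
  from L2_fun_minus[OF L(1)] show "L2_fun (n_t t)" by simp
  show "sqnorm (n_t t) \<le> K" using L(2) K_ge(1) by simp
qed

lemma u_t_L2: "L2_fun (u_t t)" and u_t_K: "sqnorm (u_t t) \<le> K"
proof -
  have *: "\<bar>G t y - G t x\<bar> \<le> (1 + kp) * \<bar>n t y - n t x\<bar> + (1 + kp) * \<bar>u t y - u t x\<bar>" for x y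
  proof -
    have "1/2 * (u t y)^2 - 1/2 * (u t x)^2 = (1/2 * (u t y + u t x)) * (u t y - u t x)"
      by (simp add: field_simps power2_eq_square)
    hence "\<bar>1/2 * (u t y)^2 - 1/2 * (u t x)^2\<bar> = \<bar>1/2 * (u t y + u t x)\<bar> * \<bar>u t y - u t x\<bar>"
      by (simp only: abs_mult)
    also have "\<dots> \<le> (1 + kp) * \<bar>u t y - u t x\<bar>"
    proof (rule mult_right_mono)
      show "\<bar>1/2 * (u t y + u t x)\<bar> \<le> 1 + kp" 
      proof -
        have "\<bar>u t y + u t x\<bar> \<le> r + r" using abs_triangle_ineq[of "u t y" "u t x"] u_le[of t y] u_le[of t x] by linarith
        thus ?thesis using r kp by (simp add: abs_mult)
      qed
    qed simp
    finally have 1: "\<bar>1/2 * (u t y)^2 - 1/2 * (u t x)^2\<bar> \<le> (1 + kp) * \<bar>u t y - u t x\<bar>" .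
    have "\<bar>w (n t y) - w (n t x)\<bar> \<le> kp * \<bar>n t y - n t x\<bar>" by (rule w_Lip[OF n_le n_le])
    also have "\<dots> \<le> (1 + kp) * \<bar>n t y - n t x\<bar>" by (intro mult_right_mono) auto
    finally show ?thesis using 1 unfolding G_def by linarith
  qed
  have "L2_Lipschitz (2 * (1 + kp)^2 * (D + D)) (G t)"
    by (rule L2_Lipschitz_combine[OF n_Lip u_Lip continuous_measurable[OF G_cont] *])
  moreover have "L2_Lipschitz (sqnorm (E t)) (\<phi> t)"
  proof (rule L2_Lipschitz_of_primitive[OF _ E_L2])
    show "\<phi> t \<in> borel_measurable borel" using meas by blast
    fix a s :: real assume "s > 0"
    thus "\<phi> t (a + s) - \<phi> t a = (LBINT x:{a..a+s}. E t x)"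
      by (intro FTC_set_integral[symmetric, OF _ finite.emptyI _ d\<phi>] L2_set_integrable E_L2)
         (auto intro: continuous_on_subset[OF \<phi>_cont])
  qed
  ultimately have "L2_Lipschitz (2 * 1^2 * (2 * (1 + kp)^2 * (D + D) + sqnorm (E t))) (\<lambda>x. G t x + \<phi> t x)"
  proof (rule L2_Lipschitz_combine)
    show "(\<lambda>x. G t x + \<phi> t x) \<in> borel_measurable borel"
      by (intro continuous_measurable continuous_on_add G_cont \<phi>_cont)
    show "\<bar>G t y + \<phi> t y - (G t x + \<phi> t x)\<bar> \<le> 1 * \<bar>G t y - G t x\<bar> + 1 * \<bar>\<phi> t y - \<phi> t x\<bar>" for x y by simp
  qed
  note L = L2_Lipschitz_derivative[OF this dH]
  from L2_fun_minus[OF L(1)] show "L2_fun (u_t t)" by simp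
  show "sqnorm (u_t t) \<le> K" using L(2) K_ge(3) E_bd[of t] by simp
qed

lemma J_joint: "jointly_measurable J"
proof (rule separately_continuous_measurable)
  show "continuous_on UNIV (\<lambda>t. J t x)" for x
    unfolding J_def
    by (intro continuous_intros derivative_continuous[OF dn] derivative_continuous[OF du])
  show "J t \<in> borel_measurable borel" for t by (rule continuous_measurable[OF J_cont])
qed

section \<open>Balance of kinetic and field energy\<close>

definition "kin_t t x = G t x * n_t t x + J t x * u_t t x"

lemma dkin: "((\<lambda>s. kin s x) has_real_derivative kin_t t x) (at t)"
proof -
  have "((\<lambda>s. W_pot w (n s x)) has_real_derivative w (n t x) * n_t t x) (at t)"
    by (rule DERIV_chain2[OF W_pot_derivative[OF enth n_gt] dn])
  moreover have "((\<lambda>s. 1/2 * (1 + n s x) * (u s x)^2) has_real_derivative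
      1/2 * n_t t x * (u t x)^2 + (1 + n t x) * u t x * u_t t x) (at t)"
    by (rule derivative_eq_intros dn du refl | simp)+
  ultimately have "((\<lambda>s. 1/2 * (1 + n s x) * (u s x)^2 + W_pot w (n s x)) has_real_derivative
      (1/2 * n_t t x * (u t x)^2 + (1 + n t x) * u t x * u_t t x) + w (n t x) * n_t t x) (at t)"
    by (intro DERIV_add)
  thus ?thesis by (simp add: kin_def kin_t_def G_def J_def algebra_simps)
qed

lemma kin_t_joint: "jointly_measurable kin_t"
  by (rule time_derivative_measurable[OF dkin]) (rule meas)

lemma n_t_joint: "jointly_measurable n_t"
  by (rule time_derivative_measurable[OF dn]) (rule meas)

text \<open>The mass that has crossed the point \<open>x\<close> during \<open>[a, b]\<close>.\<close>
definition "V a b x = (LBINT s:{a..b}. J s x)"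

lemma J_time_integrable: "set_integrable lborel {a..b} (\<lambda>s. J s x)"
proof (rule borel_integrable_atLeastAtMost')
  show "continuous_on {a..b} (\<lambda>s. J s x)"
    unfolding J_def
    by (intro continuous_intros continuous_on_subset[OF derivative_continuous[OF dn]]
      continuous_on_subset[OF derivative_continuous[OF du]]) auto
qed

text \<open>Integrated conservation of mass. Equality of the integrals over every space interval suffices, because the increment of
\<open>n\<close> is continuous in \<open>x\<close>.\<close>
lemma V_derivative:
  assumes "a \<le> b" shows "(V a b has_real_derivative - (n b x - n a x)) (at x)"
proof (rule has_derivative_of_increments)
  show "continuous_on UNIV (\<lambda>x. - (n b x - n a x))" by (intro continuous_intros n_cont)
  fix y z :: real assume yz: "y < z"
  let ?g = "\<lambda>s x. indicator {y..z} x * n s x" and ?f = "\<lambda>s x. indicator {y..z} x * n_t s x"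
  have ig: "integrable lborel (?g s)" for s by (rule L2_mult_integrable[OF L2_indicator n_L2])
  have "(LBINT x. ?g b x) - (LBINT x. ?g a x) = (LBINT s:{a..b}. LBINT x. ?f s x)"
  proof (rule time_FTC[where C = "1/2 * (LBINT x. (indicator {y..z} x)^2) + 1 / 2 * K"])
    show "jointly_measurable ?f" using n_t_joint by measurable
    show "\<forall>s\<in>{a..b}. integrable lborel (?f s) \<and> (LBINT x. \<bar>?f s x\<bar>) \<le> 1/2 * (LBINT x. (indicator {y..z} x)^2) + 1 / 2 * K"
    proof
      fix s
      show "integrable lborel (?f s) \<and> (LBINT x. \<bar>?f s x\<bar>) \<le> 1/2 * (LBINT x. (indicator {y..z} x)^2) + 1 / 2 * K"
        using L2_mult_integrable[OF L2_indicator n_t_L2] integral_abs_mult_le[OF L2_indicator n_t_L2, of 1 y z s] n_t_K[of s]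
        by simp
    qed
    show "((\<lambda>s. ?g s x) has_real_derivative ?f s x) (at s)" for s x by (rule DERIV_cmult[OF dn])
  qed (use ig assms in auto)
  also have "\<dots> = (LBINT s:{a..b}. J s y - J s z)"
  proof -
    have "(LBINT x. ?f s x) = J s y - J s z" for s
    proof -
      have "(LBINT x:{y..z}. n_t s x) = - J s z - (- J s y)"
        by (rule FTC_set_integral[where g = "\<lambda>x. - J s x", OF _ finite.emptyI])
           (use yz DERIV_minus[OF dJ, of s] in \<open>auto intro!: continuous_on_minus continuous_on_subset[OF J_cont] L2_set_integrable n_t_L2\<close>)
      thus ?thesis by (simp add: set_lebesgue_integral_def)
    qed
    thus ?thesis by simp
  qed
  also have "\<dots> = V a b y - V a b z"
    unfolding V_def by (rule set_integral_diff(2)[OF J_time_integrable J_time_integrable])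
  finally have "(LBINT x. ?g b x - ?g a x) = V a b y - V a b z" using ig by simp
  moreover have "(LBINT x:{y..z}. - (n b x - n a x)) = - (LBINT x. ?g b x - ?g a x)"
    unfolding set_lebesgue_integral_def Bochner_Integration.integral_minus[symmetric]
    by (rule Bochner_Integration.integral_cong) (auto simp: algebra_simps)
  ultimately show "(LBINT x:{y..z}. - (n b x - n a x)) = V a b z - V a b y" by simp
qed

lemma V_bounds:
  assumes "a \<le> b"
  shows "L2_fun (V a b)" "sqnorm (V a b) \<le> (b - a) * (LBINT s:{a..b}. sqnorm (J s))"
    "set_integrable lborel {a..b} (\<lambda>s. sqnorm (J s))" "sqnorm (V a b) \<le> (b - a)^2 * K"
proof -
  have "\<forall>s\<in>{a..b}. integrable lborel (\<lambda>x. (J s x)^2) \<and> sqnorm (J s) \<le> K"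
    using J_K L2_funD(2)[OF J_L2] by blast
  from integral_square_strip[OF J_joint this assms]
  show "L2_fun (V a b)" "sqnorm (V a b) \<le> (b - a) * (LBINT s:{a..b}. sqnorm (J s))"
    "set_integrable lborel {a..b} (\<lambda>s. sqnorm (J s))" "sqnorm (V a b) \<le> (b - a)^2 * K"
    by (simp_all add: V_def[abs_def])
qed

text \<open>\<open>\<Psi>\<close> is the time integral of the current \<open>\<psi> = J - \<partial>\<^sub>t \<partial>\<^sub>x \<phi>\<close>, written so that no time derivative of \<open>\<phi>\<close> is required.\<close>
definition "\<Psi> a b x = V a b x - (E b x - E a x)"
definition "dq a b x = q_fun (\<phi> b x) - q_fun (\<phi> a x)"
definition "dphi a b x = \<phi> b x - \<phi> a x"

text \<open>In the sum the second derivatives of \<open>\<phi>\<close> cancel against those contained in \<open>n\<close>.\<close>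
lemma \<Psi>_derivative:
  assumes "a \<le> b" shows "(\<Psi> a b has_real_derivative - dq a b x) (at x)"
  using DERIV_diff[OF V_derivative[OF assms, of x] DERIV_diff[OF dE[of b x] dE[of a x]]]
  by (simp add: \<Psi>_def[abs_def] dq_def)

lemma \<Psi>_L2: "a \<le> b \<Longrightarrow> L2_fun (\<Psi> a b)"
  unfolding \<Psi>_def[abs_def] by (intro L2_fun_diff V_bounds E_L2)

lemma dphi_L2: "L2_fun (dphi a b)"
  unfolding dphi_def[abs_def] by (intro L2_fun_diff \<phi>_L2)

lemma dq_L2: "L2_fun (dq a b)"
proof (rule L2_fun_dominated[OF dphi_L2[of a b]])
  show "dq a b \<in> borel_measurable borel"
    unfolding dq_def[abs_def] by (intro borel_measurable_diff meas)
  show "\<bar>dq a b x\<bar> \<le> 2 * \<bar>dphi a b x\<bar>" for x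
    unfolding dq_def dphi_def by (rule q_fun_increment(2)[OF \<phi>_half \<phi>_half])
qed

lemma dq_dphi: "(dphi a b x)^2 / 2 \<le> dq a b x * dphi a b x"
  unfolding dq_def dphi_def by (rule q_fun_increment(1)[OF \<phi>_half \<phi>_half])

text \<open>Integrating the derivative of \<open>\<Psi> dphi\<close> gives \<open>\<integral> \<Psi>\<^sup>2 + \<integral> dq dphi = \<integral> \<Psi> V\<close>. Both terms on the left are nonnegative because
\<open>q\<close> is increasing. The first estimate has the sharp constant 1, on which the critical speed depends; the others
make the field Lipschitz in time.\<close>
lemma field_increment_bounds:
  assumes ab: "a \<le> b"
  shows "sqnorm (\<Psi> a b) \<le> sqnorm (V a b)"
    and "(LBINT x. dq a b x * dphi a b x) \<le> sqnorm (V a b) / 2"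
    and "sqnorm (dphi a b) \<le> sqnorm (V a b)"
    and "(LBINT x. (E b x - E a x)^2) \<le> 4 * sqnorm (V a b)"
proof -
  note L2 = \<Psi>_L2[OF ab] V_bounds(1)[OF ab] dq_L2[of a b] dphi_L2[of a b]
  have i: "integrable lborel (\<lambda>x. dq a b x * dphi a b x)" "integrable lborel (\<lambda>x. (\<Psi> a b x)^2)"
    "integrable lborel (\<lambda>x. \<Psi> a b x * V a b x)" "integrable lborel (\<lambda>x. (dphi a b x)^2)"
    by (intro L2_mult_integrable L2_funD(2) L2)+
  have "(LBINT x. - (dq a b x * dphi a b x) + (\<Psi> a b x * V a b x - (\<Psi> a b x)^2)) = 0"
  proof (rule integral_derivative_zero[OF finite.emptyI])
    show d: "((\<lambda>x. \<Psi> a b x * dphi a b x) has_real_derivative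
        - (dq a b x * dphi a b x) + (\<Psi> a b x * V a b x - (\<Psi> a b x)^2)) (at x)" for x
    proof -
      have "(dphi a b has_real_derivative E b x - E a x) (at x)"
        unfolding dphi_def[abs_def] by (rule DERIV_diff[OF d\<phi> d\<phi>])
      from DERIV_mult[OF \<Psi>_derivative[OF ab, of x] this]
      have "((\<lambda>x. \<Psi> a b x * dphi a b x) has_real_derivative
        - dq a b x * dphi a b x + (E b x - E a x) * \<Psi> a b x) (at x)" .
      moreover have "- dq a b x * dphi a b x + (E b x - E a x) * \<Psi> a b x =
         - (dq a b x * dphi a b x) + (\<Psi> a b x * V a b x - (\<Psi> a b x)^2)"
        by (simp add: \<Psi>_def power2_eq_square algebra_simps)
      ultimately show ?thesis by simp
    qed
    show "continuous_on UNIV (\<lambda>x. \<Psi> a b x * dphi a b x)" by (rule derivative_continuous[OF d])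
    show "integrable lborel (\<lambda>x. \<Psi> a b x * dphi a b x)" by (intro L2_mult_integrable L2)
    show "integrable lborel (\<lambda>x. - (dq a b x * dphi a b x) + (\<Psi> a b x * V a b x - (\<Psi> a b x)^2))"
      using i by simp
  qed
  hence eq: "sqnorm (\<Psi> a b) + (LBINT x. dq a b x * dphi a b x) = (LBINT x. \<Psi> a b x * V a b x)"
    using i by simp
  have "(LBINT x. \<Psi> a b x * V a b x) \<le> (LBINT x. \<bar>\<Psi> a b x * V a b x\<bar>)"
    using i(3) by (intro integral_mono) auto
  also have "\<dots> \<le> 1 / 2 * sqnorm (\<Psi> a b) + 1 / (2 * 1) * sqnorm (V a b)"
    by (intro integral_abs_mult_le L2) simp
  finally have le: "(LBINT x. \<Psi> a b x * V a b x) \<le> 1 / 2 * sqnorm (\<Psi> a b) + 1 / 2 * sqnorm (V a b)" by simp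
  have "(LBINT x. (dphi a b x)^2 / 2) \<le> (LBINT x. dq a b x * dphi a b x)"
    using i dq_dphi by (intro integral_mono) auto
  hence half: "sqnorm (dphi a b) / 2 \<le> (LBINT x. dq a b x * dphi a b x)" by simp
  have nn: "0 \<le> sqnorm (dphi a b)" "0 \<le> sqnorm (\<Psi> a b)" by simp_all
  show 1: "sqnorm (\<Psi> a b) \<le> sqnorm (V a b)" using eq le half nn by linarith
  show "(LBINT x. dq a b x * dphi a b x) \<le> sqnorm (V a b) / 2" using eq le half nn by linarith
  show "sqnorm (dphi a b) \<le> sqnorm (V a b)" using eq le half nn by linarith
  have "(LBINT x. (V a b x - \<Psi> a b x)^2) \<le> 2 * sqnorm (V a b) + 2 * sqnorm (\<Psi> a b)"
    by (intro integral_square_diff_le L2)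
  moreover have "V a b x - \<Psi> a b x = E b x - E a x" for x by (simp add: \<Psi>_def)
  ultimately show "(LBINT x. (E b x - E a x)^2) \<le> 4 * sqnorm (V a b)" using 1 by simp
qed

text \<open>The field energy gains \<open>E V\<close>, which the kinetic energy loses, and is transported by the flux \<open>\<phi> \<Psi>\<close>. The remainder
consists of terms quadratic in the increments of \<open>E\<close> and \<open>\<phi>\<close>.\<close>
lemma weighted_field_increment:
  assumes w: "weight \<eta> \<eta>' X" and ab: "a \<le> b"
  shows "\<bar>(LBINT x. \<eta> x * fld b x) - (LBINT x. \<eta> x * fld a x) - (LBINT x. \<eta> x * (E a x * V a b x))\<bar>
     \<le> (LBINT x. \<bar>\<phi> a x * \<Psi> a b x\<bar>) + 3 * X * sqnorm (V a b)"
proof -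
  note L2 = \<Psi>_L2[OF ab] V_bounds(1)[OF ab] dq_L2[of a b] dphi_L2[of a b] \<phi>_L2 E_L2 L2_fun_diff[OF E_L2 E_L2]
  \<comment> \<open>What is left of the increment after its linear part at time \<open>a\<close>.\<close>
  define rem where "rem x = 1/2 * (E b x - E a x)^2 + (R_pot (\<phi> b x) - R_pot (\<phi> a x) - \<phi> a x * dq a b x)" for x
  have rem: "0 \<le> rem x" "rem x \<le> 1/2 * (E b x - E a x)^2 + dq a b x * dphi a b x" for x
    using R_pot_increment[where a = "\<phi> a x" and b = "\<phi> b x"] by (simp_all add: rem_def dq_def dphi_def mult.commute)
  have split: "fld b x - fld a x = E a x * V a b x - (E a x * \<Psi> a b x - \<phi> a x * dq a b x) + rem x" for x
    by (simp add: fld_def rem_def \<Psi>_def power2_eq_square field_simps)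
  have ibd: "integrable lborel (\<lambda>x. 1/2 * (E b x - E a x)^2 + dq a b x * dphi a b x)"
    by (intro Bochner_Integration.integrable_add integrable_mult_right L2_funD(2) L2_mult_integrable L2)
  have irem: "integrable lborel rem"
  proof (rule integrable_dominated[OF ibd])
    show "rem \<in> borel_measurable borel"
      unfolding rem_def[abs_def] dq_def
      by (intro continuous_measurable continuous_intros E_cont R_\<phi>_cont q_\<phi>_cont \<phi>_cont)
    show "\<bar>rem x\<bar> \<le> 1/2 * (E b x - E a x)^2 + dq a b x * dphi a b x" for x using rem[of x] by simp
  qed
  have i: "integrable lborel (\<lambda>x. E a x * V a b x)" "integrable lborel (\<lambda>x. E a x * \<Psi> a b x - \<phi> a x * dq a b x)"
    "integrable lborel (\<lambda>x. \<phi> a x * \<Psi> a b x)"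
    by (intro Bochner_Integration.integrable_diff L2_mult_integrable L2)+
  note wi = weight_integrable(1)[OF w]
  have parts: "(LBINT x. \<eta> x * (E a x * \<Psi> a b x - \<phi> a x * dq a b x)) = - (LBINT x. \<eta>' x * (\<phi> a x * \<Psi> a b x))"
  proof (rule weighted_integration_by_parts[OF w _ i(3) i(2)])
    show "((\<lambda>x. \<phi> a x * \<Psi> a b x) has_real_derivative E a x * \<Psi> a b x - \<phi> a x * dq a b x) (at x)" for x
      using DERIV_mult[OF d\<phi>[of a x] \<Psi>_derivative[OF ab, of x]] by (simp add: algebra_simps)
  qed
  have "(LBINT x. \<eta> x * fld b x) - (LBINT x. \<eta> x * fld a x) = (LBINT x. \<eta> x * (fld b x - fld a x))"
    using wi[OF fld_int] by (simp add: right_diff_distrib)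
  also have "\<dots> = (LBINT x. \<eta> x * (E a x * V a b x)) - (LBINT x. \<eta> x * (E a x * \<Psi> a b x - \<phi> a x * dq a b x)) + (LBINT x. \<eta> x * rem x)"
  proof -
    have "\<eta> x * (fld b x - fld a x) = \<eta> x * (E a x * V a b x) - \<eta> x * (E a x * \<Psi> a b x - \<phi> a x * dq a b x) + \<eta> x * rem x" for x
      unfolding split by (simp add: algebra_simps)
    thus ?thesis using wi[OF i(1)] wi[OF i(2)] wi[OF irem] by simp
  qed
  finally have eq: "(LBINT x. \<eta> x * fld b x) - (LBINT x. \<eta> x * fld a x) - (LBINT x. \<eta> x * (E a x * V a b x))
      = (LBINT x. \<eta>' x * (\<phi> a x * \<Psi> a b x)) + (LBINT x. \<eta> x * rem x)"
    unfolding parts by simp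
  have "(LBINT x. \<bar>rem x\<bar>) \<le> (LBINT x. 1/2 * (E b x - E a x)^2 + dq a b x * dphi a b x)"
    using irem ibd rem by (intro integral_mono) auto
  also have "\<dots> = 1/2 * (LBINT x. (E b x - E a x)^2) + (LBINT x. dq a b x * dphi a b x)"
    using L2_funD(2)[OF L2(7)] L2_mult_integrable[OF L2(3,4)] by simp
  also have "\<dots> \<le> 3 * sqnorm (V a b)"
  proof -
    have "0 \<le> sqnorm (V a b)" by simp
    thus ?thesis using field_increment_bounds(2,4)[OF ab] by linarith
  qed
  finally have "X * (LBINT x. \<bar>rem x\<bar>) \<le> X * (3 * sqnorm (V a b))"
    using weightD(6)[OF w] by (intro mult_left_mono)
  thus ?thesis unfolding eq
    using weight_abs_bound(1)[OF w irem] weight_abs_bound(2)[OF w i(3)] by (simp add: mult_ac)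
qed

lemma GJ_int: "integrable lborel (\<lambda>x. G t x * J t x)" by (intro L2_mult_integrable G_L2 J_L2)

lemma kin_t_int: "integrable lborel (kin_t t)"
  unfolding kin_t_def[abs_def]
  by (intro Bochner_Integration.integrable_add L2_mult_integrable G_L2 J_L2 n_t_L2 u_t_L2)

lemma G_bd: "sqnorm (G t) \<le> 4 * (1 + kp)^2 * D"
proof -
  have b: "(G t x)^2 \<le> 2 * (1 + kp)^2 * (n t x)^2 + 2 * (1 + kp)^2 * (u t x)^2" for x
  proof -
    have "\<bar>G t x\<bar> \<le> (1 + kp) * \<bar>u t x\<bar> + (1 + kp) * \<bar>n t x\<bar>"
      by (rule order_trans[OF G_le]) (use r kp in \<open>intro add_mono mult_right_mono; simp\<close>)
    hence "\<bar>G t x\<bar>^2 \<le> ((1 + kp) * (\<bar>u t x\<bar> + \<bar>n t x\<bar>))^2" by (intro power_mono) (auto simp: distrib_left)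
    also have "\<dots> = (1 + kp)^2 * (\<bar>u t x\<bar> + \<bar>n t x\<bar>)^2" by (simp add: power_mult_distrib)
    also have "\<dots> \<le> (1 + kp)^2 * (2 * (n t x)^2 + 2 * (u t x)^2)"
    proof (rule mult_left_mono)
      show "(\<bar>u t x\<bar> + \<bar>n t x\<bar>)^2 \<le> 2 * (n t x)^2 + 2 * (u t x)^2"
        using sum_squares_bound[of "\<bar>u t x\<bar>" "\<bar>n t x\<bar>"] by (simp add: power2_sum)
    qed simp
    finally show ?thesis by (simp add: algebra_simps)
  qed
  have "sqnorm (G t) \<le> (LBINT x. 2 * (1 + kp)^2 * (n t x)^2 + 2 * (1 + kp)^2 * (u t x)^2)"
    by (intro integral_mono b Bochner_Integration.integrable_add integrable_mult_right L2_funD(2) G_L2 n_L2 u_L2)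
  also have "\<dots> = 2 * (1 + kp)^2 * sqnorm (n t) + 2 * (1 + kp)^2 * sqnorm (u t)"
    using L2_funD(2)[OF n_L2[of t]] L2_funD(2)[OF u_L2[of t]] by simp
  also have "\<dots> \<le> 2 * (1 + kp)^2 * D + 2 * (1 + kp)^2 * D"
    by (intro add_mono mult_left_mono n_bd u_bd) auto
  finally show ?thesis by (simp add: mult_ac)
qed

lemma kin_t_bd: "(LBINT x. \<bar>kin_t t x\<bar>) \<le> 2 * (1 + kp)^2 * D + 3/2 * K"
proof -
  have "(LBINT x. \<bar>kin_t t x\<bar>) \<le> (LBINT x. \<bar>G t x * n_t t x\<bar> + \<bar>J t x * u_t t x\<bar>)"
    by (intro integral_mono Bochner_Integration.integrable_add integrable_abs kin_t_int L2_mult_integrable G_L2 J_L2 n_t_L2 u_t_L2)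
       (simp add: kin_t_def abs_triangle_ineq)
  also have "\<dots> = (LBINT x. \<bar>G t x * n_t t x\<bar>) + (LBINT x. \<bar>J t x * u_t t x\<bar>)"
    by (intro Bochner_Integration.integral_add integrable_abs L2_mult_integrable G_L2 J_L2 n_t_L2 u_t_L2)
  also have "\<dots> \<le> (1/2 * (4 * (1 + kp)^2 * D) + 1/2 * K) + (1/2 * K + 1/2 * K)"
  proof (rule add_mono)
    show "(LBINT x. \<bar>G t x * n_t t x\<bar>) \<le> 1/2 * (4 * (1 + kp)^2 * D) + 1/2 * K"
    proof -
      have "(LBINT x. \<bar>G t x * n_t t x\<bar>) \<le> 1/2 * sqnorm (G t) + 1 / (2 * 1) * sqnorm (n_t t)"
        by (rule integral_abs_mult_le[OF G_L2 n_t_L2]) simp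
      also have "\<dots> \<le> 1/2 * (4 * (1 + kp)^2 * D) + 1/2 * K"
        unfolding mult_1_right by (intro add_mono mult_left_mono G_bd n_t_K) auto
      finally show ?thesis .
    qed
    show "(LBINT x. \<bar>J t x * u_t t x\<bar>) \<le> 1/2 * K + 1/2 * K"
    proof -
      have "(LBINT x. \<bar>J t x * u_t t x\<bar>) \<le> 1/2 * sqnorm (J t) + 1 / (2 * 1) * sqnorm (u_t t)"
        by (rule integral_abs_mult_le[OF J_L2 u_t_L2]) simp
      also have "\<dots> \<le> 1/2 * K + 1/2 * K"
        unfolding mult_1_right by (intro add_mono mult_left_mono J_K u_t_K) auto
      finally show ?thesis .
    qed
  qed
  finally show ?thesis by (simp add: mult_ac)
qed

text \<open>This is \<open>\<partial>\<^sub>t kin = - \<partial>\<^sub>x (G J) - E J\<close>, tested with the weight.\<close>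
lemma kinetic_production:
  assumes w: "weight \<eta> \<eta>' X"
  shows "(LBINT x. \<eta> x * kin_t t x) = (LBINT x. \<eta>' x * (G t x * J t x)) - (LBINT x. \<eta> x * (E t x * J t x))"
proof -
  note i = L2_mult_integrable[OF E_L2[of t] J_L2[of t]]
  have id: "integrable lborel (\<lambda>x. - kin_t t x - E t x * J t x)"
    using kin_t_int i by simp
  have "(LBINT x. \<eta> x * (- kin_t t x - E t x * J t x)) = - (LBINT x. \<eta>' x * (G t x * J t x))"
  proof (rule weighted_integration_by_parts[OF w _ GJ_int id])
    show "((\<lambda>x. G t x * J t x) has_real_derivative - kin_t t x - E t x * J t x) (at x)" for x
      using DERIV_mult[OF dG[of t x] dJ[of t x]] by (simp add: kin_t_def algebra_simps)
  qed
  moreover have "(LBINT x. \<eta> x * (- kin_t t x - E t x * J t x)) =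
      - (LBINT x. \<eta> x * kin_t t x) - (LBINT x. \<eta> x * (E t x * J t x))"
    using weight_integrable(1)[OF w kin_t_int[of t]] weight_integrable(1)[OF w i]
    by (simp add: right_diff_distrib)
  ultimately show ?thesis by simp
qed

text \<open>The exchange term is evaluated with the field \<open>E\<close> frozen at the initial time \<open>a\<close>, so that it cancels exactly against
the corresponding term of \<open>weighted_field_increment\<close>.\<close>
lemma kinetic_increment:
  assumes w: "weight \<eta> \<eta>' X" and ab: "a \<le> b"
  shows "(LBINT x. \<eta> x * kin b x) - (LBINT x. \<eta> x * kin a x) + (LBINT x. \<eta> x * (E a x * V a b x))
     = (LBINT s:{a..b}. (LBINT x. \<eta> x * kin_t s x) + (LBINT x. \<eta> x * (E a x * J s x)))"
    and "set_integrable lborel {a..b} (\<lambda>s. (LBINT x. \<eta> x * kin_t s x) + (LBINT x. \<eta> x * (E a x * J s x)))"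
proof -
  have [measurable]: "\<eta> \<in> borel_measurable borel" "E a \<in> borel_measurable borel"
    using weightD[OF w] meas by auto
  have j1: "jointly_measurable (\<lambda>s x. \<eta> x * kin_t s x)"
    using kin_t_joint by measurable
  have j2: "jointly_measurable (\<lambda>s x. \<eta> x * (E a x * J s x))"
    using J_joint by measurable
  have b1: "\<forall>s\<in>{a..b}. integrable lborel (\<lambda>x. \<eta> x * kin_t s x) \<and>
      (LBINT x. \<bar>\<eta> x * kin_t s x\<bar>) \<le> X * (2 * (1 + kp)^2 * D + 3/2 * K)"
    using weight_integrable(1)[OF w kin_t_int] order_trans[OF weight_abs_bound(3)[OF w kin_t_int]
      mult_left_mono[OF kin_t_bd weightD(6)[OF w]]] by blast
  have jb: "(LBINT x. \<bar>E a x * J s x\<bar>) \<le> K" for s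
    using integral_abs_mult_le[OF E_L2 J_L2, of 1 a s] E_K[of a] J_K[of s] by simp
  have b2: "\<forall>s\<in>{a..b}. integrable lborel (\<lambda>x. \<eta> x * (E a x * J s x)) \<and>
      (LBINT x. \<bar>\<eta> x * (E a x * J s x)\<bar>) \<le> X * K"
    using weight_integrable(1)[OF w L2_mult_integrable[OF E_L2 J_L2]]
      order_trans[OF weight_abs_bound(3)[OF w L2_mult_integrable[OF E_L2 J_L2]] mult_left_mono[OF jb weightD(6)[OF w]]]
    by blast
  note F1 = strip_Fubini(3)[OF j1 b1] and F2 = strip_Fubini(3)[OF j2 b2]
  show "set_integrable lborel {a..b} (\<lambda>s. (LBINT x. \<eta> x * kin_t s x) + (LBINT x. \<eta> x * (E a x * J s x)))"
    by (intro set_integral_add F1 F2)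
  have "(LBINT x. \<eta> x * kin b x) - (LBINT x. \<eta> x * kin a x) = (LBINT s:{a..b}. LBINT x. \<eta> x * kin_t s x)"
    by (rule time_FTC[OF j1 b1]) (use ab weight_integrable(1)[OF w kin_int] DERIV_cmult[OF dkin] in auto)
  moreover have "(LBINT x. \<eta> x * (E a x * V a b x)) = (LBINT s:{a..b}. LBINT x. \<eta> x * (E a x * J s x))"
    using strip_Fubini(4)[OF j2 b2] by (simp add: V_def)
  ultimately show "(LBINT x. \<eta> x * kin b x) - (LBINT x. \<eta> x * kin a x) + (LBINT x. \<eta> x * (E a x * V a b x))
     = (LBINT s:{a..b}. (LBINT x. \<eta> x * kin_t s x) + (LBINT x. \<eta> x * (E a x * J s x)))"
    using set_integral_add(2)[OF F1 F2] by simp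
qed

section \<open>The speed of energy transport\<close>

text \<open>The coefficients of \<open>\<phi>\<^sup>2\<close>, \<open>n\<^sup>2\<close> and \<open>u\<^sup>2\<close> in the comparison of the flux with \<open>B\<close> times the energy. For \<open>r = 0\<close> and
\<open>km = kp = k\<close> all three conditions read \<open>c \<le> B\<close> when \<open>c = sqrt (1 + k)\<close>; this is the choice of \<open>c\<close> that balances them.\<close>
definition "admissible c B \<longleftrightarrow> 0 < c \<and> c \<le> B * (1 - 2 * r) \<and> (1 + r) * kp * c \<le> B * km \<and>
    (1 + r) * r + (1 + r) * kp / c + (1 + r)^2 / c \<le> B * (1 - r)"

lemma admissibleD:
  assumes "admissible c B"
  shows "0 < c" "c \<le> B * (1 - 2 * r)" "(1 + r) * kp * c \<le> B * km"
    "(1 + r) * r + (1 + r) * kp / c + (1 + r)^2 / c \<le> B * (1 - r)" "0 < B"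
proof -
  show *: "0 < c" "c \<le> B * (1 - 2 * r)" "(1 + r) * kp * c \<le> B * km"
    "(1 + r) * r + (1 + r) * kp / c + (1 + r)^2 / c \<le> B * (1 - r)"
    using assms unfolding admissible_def by blast+
  hence "0 < B * (1 - 2 * r)" by linarith
  thus "0 < B" using r by (simp add: zero_less_mult_iff)
qed

text \<open>The mixed products are split with weight \<open>c\<close>. The last two terms on the left are what the field flux costs.\<close>
lemma flux_le_energy:
  assumes adm: "admissible c B"
  shows "(LBINT x. \<bar>G t x * J t x\<bar>) + c / 2 * sqnorm (\<phi> t) + 1 / (2 * c) * sqnorm (J t) \<le> B * en"
proof -
  note c = admissibleD(1)[OF adm] and B1 = admissibleD(4)[OF adm] and B2 = admissibleD(3)[OF adm]
    and B3 = admissibleD(2)[OF adm]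
  have B: "0 \<le> B" using admissibleD(5)[OF adm] by simp
  have pt: "\<bar>G t x * J t x\<bar> + c / 2 * (\<phi> t x)^2 + 1 / (2 * c) * (J t x)^2 \<le> B * (kin t x + fld t x)" for x
  proof -
    let ?n = "\<bar>n t x\<bar>" and ?u = "\<bar>u t x\<bar>"
    have "\<bar>G t x * J t x\<bar> \<le> (r / 2 * ?u + kp * ?n) * ((1 + r) * ?u)"
      unfolding abs_mult using G_le J_le r kp by (intro mult_mono) auto
    also have "\<dots> = (1 + r) * r / 2 * ?u^2 + (1 + r) * kp * (?n * ?u)"
      by (simp add: algebra_simps power2_eq_square)
    also have "\<dots> \<le> (1 + r) * r / 2 * ?u^2 + (1 + r) * kp * (c / 2 * ?n^2 + 1 / (2 * c) * ?u^2)"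
      using abs_mult_le_weighted_squares[OF c, of ?n ?u] r kp by (intro add_left_mono mult_left_mono) auto
    finally have 1: "\<bar>G t x * J t x\<bar> \<le> (1 + r) * r / 2 * ?u^2 + (1 + r) * kp * (c / 2 * ?n^2 + 1 / (2 * c) * ?u^2)" .
    have "\<bar>J t x\<bar>^2 \<le> ((1 + r) * ?u)^2" by (intro power_mono J_le) simp
    hence 2: "1 / (2 * c) * (J t x)^2 \<le> 1 / (2 * c) * ((1 + r)^2 * ?u^2)"
      using c by (intro mult_left_mono) (auto simp: power_mult_distrib)
    have "((1 + r) * r + (1 + r) * kp / c + (1 + r)^2 / c) * (?u^2 / 2) \<le> B * (1 - r) * (?u^2 / 2)"
      by (intro mult_right_mono B1) simp
    moreover have "(1 + r) * kp * c * (?n^2 / 2) \<le> B * km * (?n^2 / 2)" by (intro mult_right_mono B2) simp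
    moreover have "(1 + r) * r / 2 * ?u^2 + (1 + r) * kp * (c / 2 * ?n^2 + 1 / (2 * c) * ?u^2)
        + 1 / (2 * c) * ((1 + r)^2 * ?u^2) =
        ((1 + r) * r + (1 + r) * kp / c + (1 + r)^2 / c) * (?u^2 / 2) + (1 + r) * kp * c * (?n^2 / 2)"
      using c by (simp add: field_simps)
    ultimately have 3: "(1 + r) * r / 2 * ?u^2 + (1 + r) * kp * (c / 2 * ?n^2 + 1 / (2 * c) * ?u^2)
        + 1 / (2 * c) * ((1 + r)^2 * ?u^2) \<le> B * (1 - r) * (?u^2 / 2) + B * km * (?n^2 / 2)"
      by linarith
    have "c * ((\<phi> t x)^2 / 2) \<le> B * (1 - 2 * r) * ((\<phi> t x)^2 / 2)" by (intro mult_right_mono B3) simp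
    also have "\<dots> \<le> B * fld t x"
    proof -
      have "(1 - 2 * r) / 2 * (\<phi> t x)^2 \<le> fld t x"
        by (rule order_trans[OF R_\<phi>_lower]) (simp add: fld_def)
      from mult_left_mono[OF this B] show ?thesis by (simp add: mult_ac)
    qed
    finally have 4: "c / 2 * (\<phi> t x)^2 \<le> B * fld t x" by simp
    have 5: "B * (1 - r) * (?u^2 / 2) + B * km * (?n^2 / 2) \<le> B * kin t x"
      using mult_left_mono[OF kin_lower[of t x] B] by (simp add: algebra_simps)
    show ?thesis using 1 2 3 4 5 by (simp add: distrib_left)
  qed
  note i = GJ_int[of t, THEN integrable_abs] L2_funD(2)[OF \<phi>_L2[of t]] L2_funD(2)[OF J_L2[of t]]
  have "(LBINT x. \<bar>G t x * J t x\<bar>) + c / 2 * sqnorm (\<phi> t) + 1 / (2 * c) * sqnorm (J t)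
      = (LBINT x. \<bar>G t x * J t x\<bar> + c / 2 * (\<phi> t x)^2 + 1 / (2 * c) * (J t x)^2)"
    using i by simp
  also have "\<dots> \<le> (LBINT x. B * (kin t x + fld t x))"
    using i kin_int[of t] fld_int[of t]
    by (intro integral_mono pt Bochner_Integration.integrable_add integrable_mult_right) auto
  also have "\<dots> = B * en" using energy_integral[of t] by simp
  finally show ?thesis .
qed

definition "M \<eta> t = (LBINT x. \<eta> x * (kin t x + fld t x))" for \<eta> :: "real \<Rightarrow> real"

text \<open>The kinetic flux and the field flux are bounded together: the estimate of \<open>flux_le_energy\<close> leaves room for
\<open>c / 2 \<integral> \<phi>\<^sup>2 + 1 / (2 c) \<integral> J\<^sup>2\<close>, and this is exactly what \<open>\<integral> \<bar>\<phi> \<Psi>\<bar>\<close> needs after integration in time.\<close>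
lemma weighted_energy_increment:
  assumes w: "weight \<eta> \<eta>' X" and ab: "a < b" and adm: "admissible c B"
  shows "\<bar>M \<eta> b - M \<eta> a\<bar> \<le> B * en * (b - a) + (11/2 * X + 5/4 * c) * K * (b - a)^2"
proof -
  note c = admissibleD(1)[OF adm]
  have ab': "a \<le> b" using ab by simp
  have X: "0 \<le> X" by (rule weightD(6)[OF w])
  define h where "h = b - a"
  have h: "0 < h" using ab by (simp add: h_def)
  let ?\<phi> = "sqnorm (\<phi> a)" and ?J = "\<lambda>s. sqnorm (J s)"
  let ?A = "\<lambda>s. (LBINT x. \<eta> x * kin_t s x) + (LBINT x. \<eta> x * (E a x * J s x))"
  let ?C = "5/2 * X * K + 5/4 * c * K"
  \<comment> \<open>The field terms are taken at the initial time \<open>a\<close>; moving them there from \<open>s\<close> costs \<open>?C h\<close>.\<close>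
  have A: "\<bar>?A s\<bar> \<le> B * en + ?C * h - c / 2 * ?\<phi> - 1 / (2 * c) * ?J s" if s: "a \<le> s" "s \<le> b" for s
  proof -
    have sq: "sqnorm (V a s) \<le> h^2 * K"
    proof -
      have "(s - a)^2 \<le> h^2" using s by (intro power_mono) (auto simp: h_def)
      thus ?thesis by (rule order_trans[OF V_bounds(4)[OF s(1)] mult_right_mono[OF _ K_nonneg]])
    qed
    have L2d: "L2_fun (\<lambda>x. E s x - E a x)" by (intro L2_fun_diff E_L2)
    have i: "integrable lborel (\<lambda>x. E a x * J s x)" "integrable lborel (\<lambda>x. E s x * J s x)"
      by (intro L2_mult_integrable E_L2 J_L2)+
    have "?A s = (LBINT x. \<eta>' x * (G s x * J s x)) - (LBINT x. \<eta> x * ((E s x - E a x) * J s x))"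
      unfolding kinetic_production[OF w] using weight_integrable(1)[OF w i(1)] weight_integrable(1)[OF w i(2)]
      by (simp add: left_diff_distrib right_diff_distrib)
    moreover have "\<bar>LBINT x. \<eta>' x * (G s x * J s x)\<bar> \<le> (LBINT x. \<bar>G s x * J s x\<bar>)"
      by (rule weight_abs_bound(2)[OF w GJ_int])
    moreover have "\<bar>LBINT x. \<eta> x * ((E s x - E a x) * J s x)\<bar> \<le> X * (5/2 * h * K)"
    proof -
      have "(LBINT x. \<bar>(E s x - E a x) * J s x\<bar>) = (LBINT x. \<bar>J s x * (E s x - E a x)\<bar>)"
        by (simp add: mult.commute)
      also have "\<dots> \<le> h / 2 * ?J s + 1 / (2 * h) * (LBINT x. (E s x - E a x)^2)"
        by (rule integral_abs_mult_le[OF J_L2 L2d h])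
      also have "\<dots> \<le> h / 2 * K + 1 / (2 * h) * (4 * (h^2 * K))"
        using J_K field_increment_bounds(4)[OF s(1)] sq h by (intro add_mono mult_left_mono) auto
      also have "\<dots> = 5/2 * h * K" using h by (simp add: field_simps power2_eq_square)
      finally have "X * (LBINT x. \<bar>(E s x - E a x) * J s x\<bar>) \<le> X * (5/2 * h * K)"
        by (rule mult_left_mono[OF _ X])
      thus ?thesis using weight_abs_bound(1)[OF w L2_mult_integrable[OF L2d J_L2], of s] by linarith
    qed
    moreover have "?\<phi> \<le> sqnorm (\<phi> s) + 5/2 * h * K"
    proof -
      have L2: "L2_fun (dphi a s)" "L2_fun (\<lambda>x. \<phi> s x + \<phi> a x)" by (intro dphi_L2 L2_fun_add \<phi>_L2)+
      have "?\<phi> - sqnorm (\<phi> s) = (LBINT x. (\<phi> a x)^2 - (\<phi> s x)^2)"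
        using L2_funD(2)[OF \<phi>_L2] by simp
      also have "\<dots> \<le> (LBINT x. \<bar>(\<phi> s x + \<phi> a x) * dphi a s x\<bar>)"
      proof (rule integral_mono)
        show "integrable lborel (\<lambda>x. (\<phi> a x)^2 - (\<phi> s x)^2)" using L2_funD(2)[OF \<phi>_L2] by simp
        show "integrable lborel (\<lambda>x. \<bar>(\<phi> s x + \<phi> a x) * dphi a s x\<bar>)"
          by (intro integrable_abs L2_mult_integrable L2)
        fix x
        have "(\<phi> a x)^2 - (\<phi> s x)^2 = - ((\<phi> s x + \<phi> a x) * dphi a s x)"
          by (simp add: dphi_def power2_eq_square algebra_simps)
        thus "(\<phi> a x)^2 - (\<phi> s x)^2 \<le> \<bar>(\<phi> s x + \<phi> a x) * dphi a s x\<bar>" by linarith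
      qed
      also have "\<dots> \<le> h / 2 * (LBINT x. (\<phi> s x + \<phi> a x)^2) + 1 / (2 * h) * sqnorm (dphi a s)"
        by (rule integral_abs_mult_le[OF L2(2,1) h])
      also have "\<dots> \<le> h / 2 * (4 * K) + 1 / (2 * h) * (h^2 * K)"
      proof (intro add_mono mult_left_mono)
        show "(LBINT x. (\<phi> s x + \<phi> a x)^2) \<le> 4 * K"
          using integral_square_sum_le[OF \<phi>_L2 \<phi>_L2, of s a] \<phi>_K[of s] \<phi>_K[of a] by linarith
        show "sqnorm (dphi a s) \<le> h^2 * K" using field_increment_bounds(3)[OF s(1)] sq by linarith
      qed (use h in auto)
      also have "\<dots> = 5/2 * h * K" using h by (simp add: field_simps power2_eq_square)
      finally show ?thesis by linarith
    qed
    hence "c / 2 * ?\<phi> \<le> c / 2 * (sqnorm (\<phi> s) + 5/2 * h * K)" using c by (intro mult_left_mono) auto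
    hence "c / 2 * ?\<phi> \<le> c / 2 * sqnorm (\<phi> s) + 5/4 * c * K * h" by (simp add: algebra_simps)
    moreover have "?C * h = X * (5/2 * h * K) + 5/4 * c * K * h" by (simp add: algebra_simps)
    ultimately show ?thesis using flux_le_energy[OF adm, of s] by linarith
  qed
  note KI = kinetic_increment[OF w ab']
  note VB = V_bounds[OF ab']
  have int: "set_integrable lborel {a..b} (\<lambda>s. (B * en + ?C * h - c / 2 * ?\<phi>) - 1 / (2 * c) * ?J s)"
    by (intro set_integral_diff set_integrable_const set_integrable_mult_right VB)
  let ?U = "LBINT s:{a..b}. (B * en + ?C * h - c / 2 * ?\<phi>) - 1 / (2 * c) * ?J s"
  have "\<bar>LBINT s:{a..b}. ?A s\<bar> \<le> ?U"
  proof (rule abs_leI)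
    show "(LBINT s:{a..b}. ?A s) \<le> ?U"
      by (rule set_integral_mono[OF KI(2) int]) (use A in \<open>simp add: abs_le_iff\<close>)
    have "(LBINT s:{a..b}. - ?A s) \<le> ?U"
    proof (rule set_integral_mono[OF _ int])
      show "set_integrable lborel {a..b} (\<lambda>s. - ?A s)"
        using set_integrable_mult_right[of "-1" lborel "{a..b}" ?A] KI(2) by simp
      show "- ?A s \<le> (B * en + ?C * h - c / 2 * ?\<phi>) - 1 / (2 * c) * ?J s" if "s \<in> {a..b}" for s
        using A[of s] that by (simp add: abs_le_iff)
    qed
    moreover have "(LBINT s:{a..b}. - ?A s) = - (LBINT s:{a..b}. ?A s)"
      by (rule set_integral_uminus[OF KI(2)])
    ultimately show "- (LBINT s:{a..b}. ?A s) \<le> ?U" by simp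
  qed
  also have "\<dots> = (LBINT s:{a..b}. B * en + ?C * h - c / 2 * ?\<phi>) - (LBINT s:{a..b}. 1 / (2 * c) * ?J s)"
    by (intro set_integral_diff set_integrable_const set_integrable_mult_right VB)
  also have "\<dots> = h * (B * en + ?C * h - c / 2 * ?\<phi>) - 1 / (2 * c) * (LBINT s:{a..b}. ?J s)"
    using ab by (simp add: set_lebesgue_integral_def h_def)
  finally have kinb: "\<bar>LBINT s:{a..b}. ?A s\<bar> \<le> h * (B * en + ?C * h - c / 2 * ?\<phi>) - 1 / (2 * c) * (LBINT s:{a..b}. ?J s)" .
  \<comment> \<open>The weight \<open>c h\<close> accounts for \<open>\<Psi>\<close> being an integral over a time interval of length \<open>h\<close>.\<close>
  have "(LBINT x. \<bar>\<phi> a x * \<Psi> a b x\<bar>) \<le> (c * h) / 2 * ?\<phi> + 1 / (2 * (c * h)) * sqnorm (\<Psi> a b)"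
    using c h by (intro integral_abs_mult_le \<phi>_L2 \<Psi>_L2 ab') auto
  also have "\<dots> \<le> (c * h) / 2 * ?\<phi> + 1 / (2 * (c * h)) * (h * (LBINT s:{a..b}. ?J s))"
    using field_increment_bounds(1)[OF ab'] VB(2) c h
    by (intro add_left_mono mult_left_mono) (auto simp: h_def)
  also have "\<dots> = h * (c / 2 * ?\<phi>) + 1 / (2 * c) * (LBINT s:{a..b}. ?J s)"
    using h by simp
  finally have fluxb: "(LBINT x. \<bar>\<phi> a x * \<Psi> a b x\<bar>) \<le> h * (c / 2 * ?\<phi>) + 1 / (2 * c) * (LBINT s:{a..b}. ?J s)" .
  have err: "3 * X * sqnorm (V a b) \<le> 3 * X * (h^2 * K)"
    using VB(4) X by (intro mult_left_mono) (auto simp: h_def)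
  have M: "M \<eta> t = (LBINT x. \<eta> x * kin t x) + (LBINT x. \<eta> x * fld t x)" for t
    using weight_integrable(1)[OF w kin_int[of t]] weight_integrable(1)[OF w fld_int[of t]]
    by (simp add: M_def distrib_left)
  let ?F = "(LBINT x. \<eta> x * fld b x) - (LBINT x. \<eta> x * fld a x) - (LBINT x. \<eta> x * (E a x * V a b x))"
  have "M \<eta> b - M \<eta> a = (LBINT s:{a..b}. ?A s) + ?F" using M[of a] M[of b] KI(1) by linarith
  hence "\<bar>M \<eta> b - M \<eta> a\<bar> \<le> \<bar>LBINT s:{a..b}. ?A s\<bar> + \<bar>?F\<bar>" by (simp only: abs_triangle_ineq)
  also have "\<dots> \<le> h * (B * en + ?C * h - c / 2 * ?\<phi>) + h * (c / 2 * ?\<phi>) + 3 * X * (h^2 * K)"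
    using weighted_field_increment[OF w ab'] kinb fluxb err by linarith
  also have "\<dots> = B * en * h + (11/2 * X + 5/4 * c) * K * h^2"
    by (simp add: algebra_simps power2_eq_square)
  finally show ?thesis unfolding h_def .
qed

lemma weighted_energy_Lipschitz:
  assumes w: "weight \<eta> \<eta>' X" and ab: "a < b" and adm: "admissible c B"
  shows "\<bar>M \<eta> b - M \<eta> a\<bar> \<le> B * en * (b - a)"
  by (rule increment_bound_linear[OF weighted_energy_increment[OF w _ adm] ab])

text \<open>Testing Poisson's equation with \<open>\<eta> \<phi>\<close> bounds the weighted field energy by the weighted integral of \<open>n\<^sup>2\<close>. The slope of \<open>\<eta>\<close> produces only
an error independent of the size of \<open>\<eta>\<close>, so the nonlocal field is concentrated where \<open>n\<close> is.\<close>
lemma weighted_energy_le: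
  assumes w: "weight \<eta> \<eta>' X" and nn: "\<And>x. 0 \<le> \<eta> x"
  shows "M \<eta> t \<le> (3 + kp) * (LBINT x. \<eta> x * ((n t x)^2 + (u t x)^2)) + 2 * K"
proof -
  note wi = weight_integrable[OF w]
  let ?q = "\<lambda>x. q_fun (\<phi> t x)"
  have qL2: "L2_fun ?q"
  proof (rule L2_fun_dominated[OF \<phi>_L2[of t]])
    show "?q \<in> borel_measurable borel" by (rule meas)
    show "\<bar>?q x\<bar> \<le> 2 * \<bar>\<phi> t x\<bar>" for x
      using q_fun_increment(2)[OF _ \<phi>_half, of 0 t x] by (simp add: q_fun_def)
  qed
  have q: "(\<phi> t x)^2 / 2 \<le> \<phi> t x * ?q x" for x
    using q_fun_increment(1)[OF _ \<phi>_half, of 0 t x] by (simp add: q_fun_def mult.commute)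
  note i1 = L2_mult_integrable[OF \<phi>_L2 E_L2, of t t] and i2 = L2_mult_integrable[OF n_L2 \<phi>_L2, of t t]
    and i3 = L2_funD(2)[OF E_L2[of t]] and i4 = L2_mult_integrable[OF \<phi>_L2[of t] qL2]
    and i5 = L2_funD(2)[OF n_L2[of t]] and i6 = L2_funD(2)[OF u_L2[of t]]
  have "(LBINT x. \<eta> x * ((E t x)^2 + \<phi> t x * ?q x - n t x * \<phi> t x)) = - (LBINT x. \<eta>' x * (\<phi> t x * E t x))"
  proof (rule weighted_integration_by_parts[OF w _ i1])
    show "((\<lambda>x. \<phi> t x * E t x) has_real_derivative (E t x)^2 + \<phi> t x * ?q x - n t x * \<phi> t x) (at x)" for x
      using DERIV_mult[OF d\<phi>[of t x] dE[of t x]] by (simp add: algebra_simps power2_eq_square)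
    show "integrable lborel (\<lambda>x. (E t x)^2 + \<phi> t x * ?q x - n t x * \<phi> t x)" using i2 i3 i4 by simp
  qed
  moreover have "\<bar>LBINT x. \<eta>' x * (\<phi> t x * E t x)\<bar> \<le> K"
    using weight_abs_bound(2)[OF w i1] integral_abs_mult_le[OF \<phi>_L2 E_L2, of 1 t t] \<phi>_K[of t] E_K[of t] by simp
  ultimately have 1: "(LBINT x. \<eta> x * ((E t x)^2 + \<phi> t x * ?q x - n t x * \<phi> t x)) \<le> K" by linarith
  have pt: "kin t x + fld t x \<le> 2 * ((E t x)^2 + \<phi> t x * ?q x - n t x * \<phi> t x) + (3 + kp) * ((n t x)^2 + (u t x)^2)" for x
  proof -
    have "n t x * \<phi> t x \<le> (n t x)^2 + (\<phi> t x)^2 / 4"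
    proof -
      have "0 \<le> (n t x - \<phi> t x / 2)^2" by simp
      thus ?thesis by (simp add: power2_eq_square algebra_simps)
    qed
    moreover have "fld t x \<le> (E t x)^2 + \<phi> t x * ?q x"
    proof -
      have "1/2 * (E t x)^2 \<le> (E t x)^2" by simp
      thus ?thesis unfolding fld_def using R_pot_le[of "\<phi> t x"] by linarith
    qed
    moreover have "(3 + kp) * ((n t x)^2 + (u t x)^2) = (1 + kp) * ((n t x)^2 + (u t x)^2) + 2 * (n t x)^2 + 2 * (u t x)^2"
      by (simp add: algebra_simps)
    moreover have "0 \<le> (u t x)^2" "0 \<le> (E t x)^2" by simp_all
    moreover have "2 * ((E t x)^2 + \<phi> t x * ?q x - n t x * \<phi> t x) =
        2 * (E t x)^2 + 2 * (\<phi> t x * ?q x) - 2 * (n t x * \<phi> t x)" by simp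
    ultimately show ?thesis using kin_upper[of t x] q[of x] by linarith
  qed
  have "integrable lborel (\<lambda>x. (E t x)^2 + \<phi> t x * ?q x - n t x * \<phi> t x)"
    "integrable lborel (\<lambda>x. (n t x)^2 + (u t x)^2)"
    using i2 i3 i4 i5 i6 by simp_all
  note iR = this[THEN wi(1)]
  have "M \<eta> t \<le> (LBINT x. 2 * (\<eta> x * ((E t x)^2 + \<phi> t x * ?q x - n t x * \<phi> t x)) + (3 + kp) * (\<eta> x * ((n t x)^2 + (u t x)^2)))"
    unfolding M_def
  proof (rule integral_mono)
    show "integrable lborel (\<lambda>x. \<eta> x * (kin t x + fld t x))" by (rule wi[OF energy_integrable])
    show "integrable lborel (\<lambda>x. 2 * (\<eta> x * ((E t x)^2 + \<phi> t x * ?q x - n t x * \<phi> t x)) + (3 + kp) * (\<eta> x * ((n t x)^2 + (u t x)^2)))"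
      using iR by simp
    show "\<eta> x * (kin t x + fld t x) \<le> 2 * (\<eta> x * ((E t x)^2 + \<phi> t x * ?q x - n t x * \<phi> t x)) + (3 + kp) * (\<eta> x * ((n t x)^2 + (u t x)^2))" for x
      using mult_left_mono[OF pt nn[of x], of x] by (simp only: distrib_left mult.left_commute)
  qed
  also have "\<dots> = 2 * (LBINT x. \<eta> x * ((E t x)^2 + \<phi> t x * ?q x - n t x * \<phi> t x)) + (3 + kp) * (LBINT x. \<eta> x * ((n t x)^2 + (u t x)^2))"
    using iR by simp
  finally show ?thesis using 1 by linarith
qed

section \<open>Rigidity of fast compact solutions\<close>

lemma zero_energy_imp_zero:
  assumes "en = 0"
  shows "n t x = 0 \<and> u t x = 0 \<and> \<phi> t x = 0"
proof -
  let ?e = "\<lambda>x. kin t x + fld t x"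
  have nn: "0 \<le> ?e x" for x using kin_nonneg fld_nonneg by (intro add_nonneg_nonneg)
  have "((\<lambda>_. 0 :: real) has_real_derivative ?e x) (at x)"
  proof (rule has_derivative_of_increments)
    show "continuous_on UNIV ?e" by (intro continuous_on_add kin_cont fld_cont)
    fix y z :: real
    have "(LBINT x:{y..z}. ?e x) \<le> (LBINT x. ?e x)"
      unfolding set_lebesgue_integral_def
      using energy_integrable[of t] integrable_imp_set_integrable[OF energy_integrable[of t], of y z] nn
      by (intro integral_mono) (auto simp: set_integrable_def split: split_indicator)
    moreover have "0 \<le> (LBINT x:{y..z}. ?e x)"
      unfolding set_lebesgue_integral_def using nn by (intro integral_nonneg_AE AE_I2) simp
    ultimately show "(LBINT x:{y..z}. ?e x) = 0 - 0" using energy_integral[of t] assms by simp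
  qed
  hence e0: "?e x = 0" using DERIV_unique[OF _ DERIV_const] by blast
  hence k0: "kin t x = 0" and f0: "fld t x = 0"
    using kin_nonneg[of t x] fld_nonneg[of t x] by linarith+
  have "0 \<le> (1 - r) / 2 * (u t x)^2" "0 \<le> km / 2 * (n t x)^2" using r km by simp_all
  hence "(1 - r) / 2 * (u t x)^2 = 0" "km / 2 * (n t x)^2 = 0" using kin_lower[of t x] k0 by linarith+
  moreover have "(1 - 2 * r) / 2 * (\<phi> t x)^2 = 0"
  proof -
    have "(1 - 2 * r) / 2 * (\<phi> t x)^2 \<le> fld t x"
      by (rule order_trans[OF R_\<phi>_lower]) (simp add: fld_def)
    moreover have "0 \<le> (1 - 2 * r) / 2 * (\<phi> t x)^2" using r by simp
    ultimately show ?thesis using f0 by linarith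
  qed
  ultimately show ?thesis using r km by simp
qed

text \<open>Within distance \<open>R\<close> of the centre \<open>z\<close> the weight is at most \<open>R\<close>; outside it is multiplied by the small tail \<open>e\<close>.\<close>
lemma near_center_bound:
  assumes w: "weight \<eta> \<eta>' X" and nn: "\<And>x. 0 \<le> \<eta> x" and near: "\<And>x. \<eta> x \<le> \<bar>x - z\<bar>"
    and R: "0 \<le> R" and tail: "(LBINT x. indicator {x. \<bar>x - z\<bar> > R} x * ((n t x)^2 + (u t x)^2)) \<le> e"
  shows "M \<eta> t \<le> (3 + kp) * (2 * R * D + X * e) + 2 * K"
proof -
  let ?s = "\<lambda>x. (n t x)^2 + (u t x)^2" and ?I = "indicator {x. \<bar>x - z\<bar> > R} :: real \<Rightarrow> real"
  have i: "integrable lborel ?s" using L2_funD(2)[OF n_L2[of t]] L2_funD(2)[OF u_L2[of t]] by simp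
  have "?I \<in> borel_measurable borel" by measurable
  hence iI: "integrable lborel (\<lambda>x. ?I x * ?s x)"
    by (rule integrable_bounded_mult[OF i, of _ 1]) (simp split: split_indicator)
  have X: "0 \<le> X" by (rule weightD(6)[OF w])
  have "(LBINT x. \<eta> x * ?s x) \<le> (LBINT x. R * ?s x + X * (?I x * ?s x))"
  proof (rule integral_mono)
    show "integrable lborel (\<lambda>x. \<eta> x * ?s x)" by (rule weight_integrable(1)[OF w i])
    show "integrable lborel (\<lambda>x. R * ?s x + X * (?I x * ?s x))" 
      by (rule Bochner_Integration.integrable_add[OF integrable_mult_right[OF i] integrable_mult_right[OF iI]])
    fix x
    have "\<eta> x \<le> R + X * ?I x"
      using near[of x] weightD(4)[OF w, of x] R X by (cases "\<bar>x - z\<bar> > R") auto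
    hence "\<eta> x * ?s x \<le> (R + X * ?I x) * ?s x" by (rule mult_right_mono) simp
    thus "\<eta> x * ?s x \<le> R * ?s x + X * (?I x * ?s x)" by (simp only: distrib_right mult.assoc)
  qed
  also have "\<dots> = R * (LBINT x. ?s x) + X * (LBINT x. ?I x * ?s x)"
    using L2_funD(2)[OF n_L2[of t]] L2_funD(2)[OF u_L2[of t]] iI by simp
  also have "\<dots> \<le> R * (2 * D) + X * e"
  proof (intro add_mono mult_left_mono R X tail)
    have "(LBINT x. ?s x) = sqnorm (n t) + sqnorm (u t)"
      using L2_funD(2)[OF n_L2[of t]] L2_funD(2)[OF u_L2[of t]] by simp
    thus "(LBINT x. ?s x) \<le> 2 * D" using n_bd[of t] u_bd[of t] by simp
  qed
  finally have "(3 + kp) * (LBINT x. \<eta> x * ?s x) \<le> (3 + kp) * (2 * R * D + X * e)"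
    using kp by (intro mult_left_mono) (auto simp: mult_ac)
  thus ?thesis using weighted_energy_le[OF w nn, of t] by linarith
qed

text \<open>The energy has to be carried over the distance \<open>y t - y s\<close>: the moment with respect to \<open>y s\<close> is small at time \<open>s\<close>, and at time \<open>t\<close> it is
\<open>(y t - y s) en\<close> minus the moment with respect to \<open>y t\<close>, which is small then. The times may come in either order, so both
directions of motion are covered.\<close>
lemma energy_transport:
  assumes adm: "admissible c B"
    and R: "0 \<le> R"
    and tail: "\<And>t. (LBINT x. indicator {x. \<bar>x - y t\<bar> > R} x * ((n t x)^2 + (u t x)^2)) \<le> e"
    and st: "s \<noteq> t" and y: "y s < y t"
  shows "(y t - y s) * en \<le> B * en * \<bar>t - s\<bar> + 2 * (3 + kp) * (2 * R * D + (y t - y s) * e) + 4 * K"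
proof -
  define a b where "a = y s" and "b = y t"
  have ab: "a < b" using y by (simp add: a_def b_def)
  note W = weight_clamp[OF ab]
  let ?\<eta> = "\<lambda>x. max a (min b x) - a" and ?\<theta> = "\<lambda>x. b - max a (min b x)"
  have s: "M ?\<eta> s \<le> (3 + kp) * (2 * R * D + (b - a) * e) + 2 * K"
    using ab tail[of s] by (intro near_center_bound[OF W(1), where z = a] R) (auto simp: a_def)
  have t: "M ?\<theta> t \<le> (3 + kp) * (2 * R * D + (b - a) * e) + 2 * K"
    using ab tail[of t] by (intro near_center_bound[OF W(2), where z = b] R) (auto simp: b_def)
  have "M ?\<eta> t + M ?\<theta> t = (LBINT x. ?\<eta> x * (kin t x + fld t x) + ?\<theta> x * (kin t x + fld t x))"
    unfolding M_def
    using weight_integrable(1)[OF W(1) energy_integrable[of t]] weight_integrable(1)[OF W(2) energy_integrable[of t]] by simp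
  also have "\<dots> = (LBINT x. (b - a) * (kin t x + fld t x))"
    by (intro Bochner_Integration.integral_cong refl) (simp only: distrib_right[symmetric], simp)
  also have "\<dots> = (b - a) * en" using energy_integral[of t] by simp
  finally have "M ?\<eta> t + M ?\<theta> t = (b - a) * en" .
  moreover have "\<bar>M ?\<eta> t - M ?\<eta> s\<bar> \<le> B * en * \<bar>t - s\<bar>"
  proof (cases "s < t")
    case True
    from weighted_energy_Lipschitz[OF W(1) this adm] True show ?thesis by simp
  next
    case False
    hence "t < s" using st by simp
    from weighted_energy_Lipschitz[OF W(1) this adm] this show ?thesis by (simp add: abs_minus_commute)
  qed
  moreover have "2 * (3 + kp) * (2 * R * D + (b - a) * e) = (3 + kp) * (2 * R * D + (b - a) * e) + (3 + kp) * (2 * R * D + (b - a) * e)"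
    by simp
  ultimately show ?thesis using s t unfolding a_def[symmetric] b_def[symmetric] by linarith
qed

lemma compact_tail:
  assumes y: "L2_compact_center n u y" and e: "0 < e"
  shows "\<exists>R>0. \<forall>t. (LBINT x. indicator {x. \<bar>x - y t\<bar> > R} x * ((n t x)^2 + (u t x)^2)) \<le> e"
proof -
  obtain R where R: "R > 0"
    "(SUP t. \<integral>\<^sup>+x\<in>{x. \<bar>x - y t\<bar> > R}. ennreal ((n t x)^2 + (u t x)^2) \<partial>lborel) < ennreal e"
    using y e unfolding L2_compact_center_def by blast
  have "(LBINT x. indicator {x. \<bar>x - y t\<bar> > R} x * ((n t x)^2 + (u t x)^2)) \<le> e" for t
  proof -
    let ?f = "\<lambda>x. indicator {x. \<bar>x - y t\<bar> > R} x * ((n t x)^2 + (u t x)^2)"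
    have i: "integrable lborel ?f"
    proof (rule integrable_bounded_mult[of _ _ 1])
      show "integrable lborel (\<lambda>x. (n t x)^2 + (u t x)^2)"
        using L2_funD(2)[OF n_L2[of t]] L2_funD(2)[OF u_L2[of t]] by simp
      show "(indicator {x. \<bar>x - y t\<bar> > R} :: real \<Rightarrow> real) \<in> borel_measurable borel" by measurable
    qed (simp split: split_indicator)
    have "ennreal (LBINT x. ?f x) = (\<integral>\<^sup>+x. ennreal (?f x) \<partial>lborel)"
      by (rule nn_integral_eq_integral[OF i, symmetric]) simp
    also have "\<dots> = (\<integral>\<^sup>+x\<in>{x. \<bar>x - y t\<bar> > R}. ennreal ((n t x)^2 + (u t x)^2) \<partial>lborel)"
      by (intro nn_integral_cong) (simp split: split_indicator)
    also have "\<dots> \<le> (SUP t. \<integral>\<^sup>+x\<in>{x. \<bar>x - y t\<bar> > R}. ennreal ((n t x)^2 + (u t x)^2) \<partial>lborel)"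
      by (rule SUP_upper) simp
    also have "\<dots> \<le> ennreal e" using R(2) by simp
    finally show ?thesis using e by simp
  qed
  thus ?thesis using R(1) by blast
qed

lemma fast_compact_solution_vanishes:
  assumes adm: "admissible c B"
    and y: "L2_compact_center n u y" and speed: "\<And>t. \<sigma> \<le> \<bar>deriv y t\<bar>" and \<sigma>: "B < \<sigma>"
  shows "n t x = 0 \<and> u t x = 0 \<and> \<phi> t x = 0"
proof (rule zero_energy_imp_zero, rule ccontr)
  assume "en \<noteq> 0"
  hence E: "0 < en" using en_nonneg by simp
  note B = admissibleD(5)[OF adm]
  define \<kappa> where "\<kappa> = en * (1 - B / \<sigma>)"
  have \<kappa>: "0 < \<kappa>" using E B \<sigma> by (simp add: \<kappa>_def)
  \<comment> \<open>With this tail and this time span, tails and bounded errors together use up less than \<open>\<kappa> \<bar>y T - y 0\<bar>\<close>.\<close>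
  define e where "e = \<kappa> / (8 * (3 + kp))"
  have e: "0 < e" using \<kappa> kp by (simp add: e_def)
  obtain R where R: "R > 0" and tail: "\<And>t. (LBINT x. indicator {x. \<bar>x - y t\<bar> > R} x * ((n t x)^2 + (u t x)^2)) \<le> e"
    using compact_tail[OF y e] by blast
  define Q where "Q = 4 * (3 + kp) * R * D + 4 * K"
  have Q: "0 \<le> Q" using kp R D_nonneg K_nonneg by (simp add: Q_def)
  define T where "T = 2 * (Q + 1) / (\<kappa> * \<sigma>)"
  have T: "0 < T" using Q \<kappa> B \<sigma> by (simp add: T_def)
  have dy: "(y has_real_derivative deriv y t) (at t)" for t
  proof -
    have "y C1_differentiable_on UNIV" using y by (simp add: L2_compact_center_def)
    then obtain Dy where "\<forall>t\<in>UNIV. (y has_vector_derivative Dy t) (at t)"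
      unfolding C1_differentiable_on_def by blast
    hence "(y has_real_derivative Dy t) (at t)" by (simp add: has_real_derivative_iff_has_vector_derivative)
    thus ?thesis using DERIV_imp_deriv by fastforce
  qed
  obtain z where z: "y T - y 0 = (T - 0) * deriv y z" using MVT2[OF T dy] by blast
  define L where "L = \<bar>y T - y 0\<bar>"
  have L: "\<sigma> * T \<le> L"
    using mult_left_mono[OF speed[of z], of T] T by (simp add: L_def z abs_mult mult.commute)
  have Lpos: "0 < L" using L T B \<sigma> by (smt (verit) mult_pos_pos)
  have main: "L * en \<le> B * en * T + 2 * (3 + kp) * (2 * R * D + L * e) + 4 * K"
  proof (cases "y 0 < y T")
    case True
    have "0 \<noteq> T" "0 \<le> R" using T R by simp_all
    from energy_transport[where y = y, OF adm this(2) tail this(1) True] show ?thesis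
      using True T by (simp add: L_def)
  next
    case False
    hence lt: "y T < y 0" using Lpos by (simp add: L_def)
    have "T \<noteq> 0" "0 \<le> R" using T R by simp_all
    from energy_transport[where y = y, OF adm this(2) tail this(1) lt] show ?thesis
      using lt T by (simp add: L_def)
  qed
  have "B * en * T \<le> B * en * (L / \<sigma>)"
    using L B \<sigma> E by (intro mult_left_mono) (auto simp: pos_le_divide_eq mult.commute)
  moreover have "L * en - B * en * (L / \<sigma>) = L * \<kappa>" by (simp add: \<kappa>_def algebra_simps)
  moreover have "2 * (3 + kp) * (2 * R * D + L * e) + 4 * K = Q + L * \<kappa> / 4"
  proof -
    have "2 * (3 + kp) * (L * e) = L * \<kappa> / 4" using kp by (simp add: e_def field_simps)
    thus ?thesis by (simp add: Q_def distrib_left mult_ac)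
  qed
  ultimately have "L * \<kappa> \<le> Q + L * \<kappa> / 4" using main by linarith
  moreover have "\<sigma> * T * \<kappa> = 2 * (Q + 1)" using \<kappa> B \<sigma> by (simp add: T_def field_simps)
  moreover have "\<sigma> * T * \<kappa> \<le> L * \<kappa>" using L \<kappa> by (intro mult_right_mono) auto
  moreover define P where "P = L * \<kappa>"
  ultimately have "P \<le> Q + P / 4" "2 * (Q + 1) \<le> P" by simp_all
  thus False using Q by simp
qed

end

section \<open>Regularity of the given solution and choice of constants\<close>

text \<open>The hypothesis that \<open>f\<close> is everywhere a derivative excludes changes of \<open>f\<close> on a null set, and so turns almost everywhere
statements about \<open>H\<^sup>1\<close> functions into pointwise ones.\<close>
lemma H1_regularity:
  assumes H1: "H1_fun f" and G: "\<And>x. (G has_real_derivative f x) (at x)" and bd: "H1_norm f \<le> d" and d: "0 \<le> d"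
  shows "continuous_on UNIV f" "(f x)^2 \<le> 2 * d^2" "sqnorm f \<le> d^2" "L2_Lipschitz (d^2) f"
proof -
  define g where "g = (SOME g. L2_weak_deriv f g)"
  have f: "L2_fun f" and wd: "L2_weak_deriv f g"
    using H1 someI_ex[of "L2_weak_deriv f"] unfolding H1_fun_def g_def by blast+
  have g: "L2_fun g" using wd by (simp add: L2_weak_deriv_def)
  have nn: "0 \<le> sqnorm f" "0 \<le> sqnorm g" by simp_all
  have "H1_norm f = sqrt (sqnorm f + sqnorm g)" by (simp add: H1_norm_def g_def)
  hence le: "sqnorm f + sqnorm g \<le> d^2"
    using bd by (intro sqrt_le_D) simp
  have FTC: "f (a + s) - f a = (LBINT x:{a..a+s}. g x)" if "s > 0" for a s
    by (rule weak_derivative_FTC[OF f wd G that])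
  show "(f x)^2 \<le> 2 * d^2" using Sobolev_sup_bound[OF f g FTC, of x] le by linarith
  show "sqnorm f \<le> d^2" using le nn by linarith
  show "L2_Lipschitz (d^2) f"
  proof (rule L2_Lipschitz_mono)
    show "L2_Lipschitz (sqnorm g) f"
      by (rule L2_Lipschitz_of_primitive[OF L2_funD(1)[OF f] g]) (rule FTC)
    show "sqnorm g \<le> d^2" using le nn by linarith
  qed
  show "continuous_on UNIV f"
  proof (rule continuous_at_imp_continuous_on, rule ballI)
    fix x
    have gi: "g integrable_on {x-1..x+1}"
      by (rule set_borel_integral_eq_integral(1)[OF L2_set_integrable[OF g]])
    have eq: "f (x - 1) + integral {x-1..z} g = f z" if "z \<in> {x-1<..<x+1}" for z
      using FTC[of "z - (x - 1)" "x - 1"] that set_borel_integral_eq_integral(2)[OF L2_set_integrable[OF g], of "x-1" z] by simp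
    have "continuous_on {x-1..x+1} (\<lambda>z. f (x - 1) + integral {x-1..z} g)"
      by (intro continuous_on_add continuous_on_const indefinite_integral_continuous_1 gi)
    hence "continuous_on {x-1<..<x+1} (\<lambda>z. f (x - 1) + integral {x-1..z} g)"
      by (rule continuous_on_subset) auto
    hence "continuous_on {x-1<..<x+1} f"
      by (rule continuous_on_eq) (rule eq)
    thus "isCont f x" by (simp add: continuous_on_eq_continuous_at)
  qed
qed

lemma enthalpy_slope_continuous:
  assumes "pressure p"
  shows "isCont (\<lambda>s. inverse (1 + s) * deriv p (1 + s)) 0"
proof -
  have "deriv p differentiable (at 1)"
    using assms unfolding pressure_def smooth_on_def by (auto dest!: spec[of _ 1])
  hence "isCont (deriv p) (1 + 0)" using differentiable_imp_continuous_within by simp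
  hence "isCont (\<lambda>s. deriv p (1 + s)) 0" by (intro isCont_o2[of 0 "\<lambda>s. 1 + s" "deriv p"]) simp_all
  thus ?thesis by (intro continuous_intros) simp_all
qed

text \<open>At \<open>\<mu> = 0\<close> all inequalities hold strictly, since \<open>c\<^sup>2 = 1 + k\<close>; they persist for small \<open>\<mu>\<close> by continuity, and for smaller \<open>r\<close> by
monotonicity.\<close>
lemma smallness_parameters:
  fixes k \<epsilon> :: real
  assumes k: "0 < k" and \<epsilon>: "0 < \<epsilon>"
  defines "c \<equiv> sqrt (1 + k)"
  shows "\<exists>\<mu>>0. \<mu> \<le> 1/4 \<and> \<mu> < k \<and> (\<forall>r. 0 < r \<longrightarrow> r \<le> \<mu> \<longrightarrow>
     (1 + r) * r + (1 + r) * (k + \<mu>) / c + (1 + r)^2 / c \<le> (c + \<epsilon>) * (1 - r) \<and>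
     (1 + r) * (k + \<mu>) * c \<le> (c + \<epsilon>) * (k - \<mu>) \<and> c \<le> (c + \<epsilon>) * (1 - 2 * r))"
proof -
  have c: "0 < c" "c^2 = 1 + k" using k by (simp_all add: c_def)
  have cc: "(1 + 0) * 0 + (1 + 0) * (k + 0) / c + (1 + 0)^2 / c = c"
    using c by (simp add: field_simps power2_eq_square)
  have lim: "((\<lambda>\<mu>. \<mu>) \<longlongrightarrow> (0::real)) (at_right 0)" by (rule tendsto_ident_at)
  have "((\<lambda>\<mu>. (c + \<epsilon>) * (1 - \<mu>) - ((1 + \<mu>) * \<mu> + (1 + \<mu>) * (k + \<mu>) / c + (1 + \<mu>)^2 / c)) \<longlongrightarrow>
      (c + \<epsilon>) * (1 - 0) - ((1 + 0) * 0 + (1 + 0) * (k + 0) / c + (1 + 0)^2 / c)) (at_right 0)"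
    using c by (intro tendsto_intros lim) auto
  hence e1: "\<forall>\<^sub>F \<mu> in at_right 0. 0 < (c + \<epsilon>) * (1 - \<mu>) - ((1 + \<mu>) * \<mu> + (1 + \<mu>) * (k + \<mu>) / c + (1 + \<mu>)^2 / c)"
    by (rule order_tendstoD(1)) (use \<epsilon> in \<open>simp only: cc, simp\<close>)
  have "((\<lambda>\<mu>. (c + \<epsilon>) * (k - \<mu>) - (1 + \<mu>) * (k + \<mu>) * c) \<longlongrightarrow> (c + \<epsilon>) * (k - 0) - (1 + 0) * (k + 0) * c) (at_right 0)"
    by (intro tendsto_intros lim)
  hence e2: "\<forall>\<^sub>F \<mu> in at_right 0. 0 < (c + \<epsilon>) * (k - \<mu>) - (1 + \<mu>) * (k + \<mu>) * c"
    by (rule order_tendstoD(1)) (use \<epsilon> k in \<open>simp add: algebra_simps\<close>)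
  have "((\<lambda>\<mu>. (c + \<epsilon>) * (1 - 2 * \<mu>)) \<longlongrightarrow> (c + \<epsilon>) * (1 - 2 * 0)) (at_right 0)"
    by (intro tendsto_intros lim)
  hence e3: "\<forall>\<^sub>F \<mu> in at_right 0. c < (c + \<epsilon>) * (1 - 2 * \<mu>)"
    by (rule order_tendstoD(1)) (use \<epsilon> in simp)
  have e4: "\<forall>\<^sub>F \<mu> in at_right 0. \<mu> < min (1/4) k" by (rule order_tendstoD(2)[OF lim]) (use k in simp)
  have e5: "\<forall>\<^sub>F \<mu> in at_right 0. (0::real) < \<mu>" by (rule eventually_at_right_less)
  obtain \<mu> where \<mu>: "0 < \<mu>" "\<mu> < min (1/4) k" "c < (c + \<epsilon>) * (1 - 2 * \<mu>)"
    "0 < (c + \<epsilon>) * (k - \<mu>) - (1 + \<mu>) * (k + \<mu>) * c"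
    "0 < (c + \<epsilon>) * (1 - \<mu>) - ((1 + \<mu>) * \<mu> + (1 + \<mu>) * (k + \<mu>) / c + (1 + \<mu>)^2 / c)"
    using eventually_happens[OF eventually_conj[OF e1 eventually_conj[OF e2 eventually_conj[OF e3 eventually_conj[OF e4 e5]]]]]
    by auto
  show ?thesis
  proof (intro exI[of _ \<mu>] conjI allI impI)
    fix r assume r: "0 < r" "r \<le> \<mu>"
    have "(1 + r) * r \<le> (1 + \<mu>) * \<mu>" using r by (intro mult_mono) auto
    moreover have "(1 + r) * (k + \<mu>) / c \<le> (1 + \<mu>) * (k + \<mu>) / c"
      using r k \<mu>(1) c by (intro divide_right_mono mult_right_mono) auto
    moreover have "(1 + r)^2 / c \<le> (1 + \<mu>)^2 / c" using r c by (intro divide_right_mono power_mono) auto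
    moreover have "(c + \<epsilon>) * (1 - \<mu>) \<le> (c + \<epsilon>) * (1 - r)" using r c \<epsilon> by (intro mult_left_mono) auto
    ultimately show "(1 + r) * r + (1 + r) * (k + \<mu>) / c + (1 + r)^2 / c \<le> (c + \<epsilon>) * (1 - r)"
      using \<mu>(5) by linarith
    have "(1 + r) * (k + \<mu>) * c \<le> (1 + \<mu>) * (k + \<mu>) * c"
      using r k \<mu>(1) c by (intro mult_right_mono) auto
    thus "(1 + r) * (k + \<mu>) * c \<le> (c + \<epsilon>) * (k - \<mu>)" using \<mu>(4) by linarith
    have "(c + \<epsilon>) * (1 - 2 * \<mu>) \<le> (c + \<epsilon>) * (1 - 2 * r)" using r c \<epsilon> by (intro mult_left_mono) auto
    thus "c \<le> (c + \<epsilon>) * (1 - 2 * r)" using \<mu>(3) by linarith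
  qed (use \<mu> in auto)
qed

text \<open>Poisson's equation exhibits \<open>n\<close> as the derivative of \<open>\<integral> q \<phi> - \<partial>\<^sub>x \<phi>\<close>. Once \<open>n\<close> is continuous, so is \<open>u = J / (1 + n)\<close>, because \<open>J\<close>
is differentiable.\<close>
lemma EP_antiderivatives:
  assumes sol: "EP_solution w n u \<phi>"
  shows "\<exists>F. \<forall>x. (F has_real_derivative n t x) (at x)"
    and "continuous_on UNIV (n t) \<Longrightarrow> \<exists>F. \<forall>x. (F has_real_derivative u t x) (at x)"
proof -
  have P: "\<phi> t differentiable (at x)" "deriv (\<phi> t) differentiable (at x)"
    "- deriv (deriv (\<phi> t)) x + q_fun (\<phi> t x) = n t x" for x
    using sol unfolding EP_solution_def by blast+
  have "continuous_on UNIV (\<phi> t)"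
    using P(1) derivative_continuous[of "\<phi> t" "deriv (\<phi> t)"]
    by (simp add: DERIV_deriv_iff_real_differentiable)
  hence "continuous_on UNIV (\<lambda>x. q_fun (\<phi> t x))" unfolding q_fun_def by (intro continuous_intros)
  then obtain Q where Q: "\<And>x. (Q has_real_derivative q_fun (\<phi> t x)) (at x)"
    using continuous_antiderivative by blast
  have "((\<lambda>x. Q x - deriv (\<phi> t) x) has_real_derivative n t x) (at x)" for x
  proof -
    have "(deriv (\<phi> t) has_real_derivative deriv (deriv (\<phi> t)) x) (at x)"
      using P(2) by (simp add: DERIV_deriv_iff_real_differentiable)
    from DERIV_diff[OF Q[of x] this] show ?thesis using P(3)[of x] by (simp add: algebra_simps)
  qed
  thus "\<exists>F. \<forall>x. (F has_real_derivative n t x) (at x)" by blast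
  assume n: "continuous_on UNIV (n t)"
  let ?J = "\<lambda>z. (1 + n t z) * u t z"
  have "?J differentiable (at x)" for x using sol unfolding EP_solution_def by blast
  hence J: "continuous_on UNIV ?J"
    using derivative_continuous[of ?J "deriv ?J"] by (simp add: DERIV_deriv_iff_real_differentiable)
  have n1: "n t x > -1" for x using sol unfolding EP_solution_def by blast
  have nz: "1 + n t x \<noteq> 0" for x using n1[of x] by linarith
  have "continuous_on UNIV (\<lambda>x. ?J x / (1 + n t x))"
    by (intro continuous_on_divide J continuous_on_add continuous_on_const n) (use nz in blast)
  moreover have "(\<lambda>x. ?J x / (1 + n t x)) = u t" using nz by auto
  ultimately have "continuous_on UNIV (u t)" by (simp only:)
  thus "\<exists>F. \<forall>x. (F has_real_derivative u t x) (at x)" by (rule continuous_antiderivative)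
qed

theorem theorem1p4:
  fixes p :: "real \<Rightarrow> real" and \<epsilon> :: real
  assumes "pressure p" and "\<epsilon> > 0"
  shows "\<exists>\<delta>>0. \<forall>w n u \<phi> y.
     enthalpy p w \<longrightarrow>
     EP_solution w n u \<phi> \<longrightarrow>
     L2_compact_center n u y \<longrightarrow>
     conserves_energy w n u \<phi> \<longrightarrow>
     (INF t. \<bar>deriv y t\<bar>) > sqrt (1 + deriv p 1) + \<epsilon> \<longrightarrow>
     (\<forall>t. H1_fun (n t) \<and> H1_fun (u t)) \<longrightarrow>
     bdd_above (range (\<lambda>t. H1_pair_norm (n t) (u t))) \<longrightarrow>
     (SUP t. H1_pair_norm (n t) (u t)) < \<delta> \<longrightarrow>
     (\<forall>t x. n t x = 0 \<and> u t x = 0 \<and> \<phi> t x = 0)"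
proof -
  define k where "k = deriv p 1"
  define c where "c = sqrt (1 + k)"
  have k: "0 < k" using assms(1) by (simp add: pressure_def k_def)
  have c: "0 < c" using k by (simp add: c_def)
  have "0 < \<epsilon> / 2" using assms(2) by simp
  from smallness_parameters[OF k this, folded c_def] obtain \<mu> where \<mu>: "0 < \<mu>" "\<mu> \<le> 1/4" "\<mu> < k"
    and params: "\<And>r. 0 < r \<Longrightarrow> r \<le> \<mu> \<Longrightarrow>
       (1 + r) * r + (1 + r) * (k + \<mu>) / c + (1 + r)^2 / c \<le> (c + \<epsilon> / 2) * (1 - r) \<and>
       (1 + r) * (k + \<mu>) * c \<le> (c + \<epsilon> / 2) * (k - \<mu>) \<and> c \<le> (c + \<epsilon> / 2) * (1 - 2 * r)"
    by blast
  have "\<exists>\<rho>>0. \<forall>s. \<bar>s\<bar> < \<rho> \<longrightarrow> \<bar>inverse (1 + s) * deriv p (1 + s) - k\<bar> < \<mu>"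
    using enthalpy_slope_continuous[OF assms(1)] \<mu>(1) by (auto simp: continuous_at_real_range k_def)
  then obtain \<rho> where \<rho>: "0 < \<rho>" "\<And>s. \<bar>s\<bar> < \<rho> \<Longrightarrow> \<bar>inverse (1 + s) * deriv p (1 + s) - k\<bar> < \<mu>"
    by blast
  \<comment> \<open>Half of \<open>\<rho>\<close>, because the slope of \<open>w\<close> is controlled on an open interval only.\<close>
  define r where "r = min \<mu> (\<rho> / 2)"
  have r: "0 < r" "r \<le> \<mu>" "r \<le> 1/4" "r < 1" using \<mu> \<rho>(1) by (auto simp: r_def)
  have near: "\<bar>inverse (1 + s) * deriv p (1 + s) - k\<bar> \<le> \<mu>" if "\<bar>s\<bar> \<le> r" for s
    using \<rho>(2)[of s] that \<rho>(1) by (simp add: r_def)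
  show ?thesis
  proof (intro exI[of _ "r / 2"] conjI allI impI)
    show "0 < r / 2" using r by simp
    fix w n u \<phi> y t x
    assume w: "enthalpy p w" and sol: "EP_solution w n u \<phi>" and y: "L2_compact_center n u y"
      and cons: "conserves_energy w n u \<phi>"
      and speed: "sqrt (1 + deriv p 1) + \<epsilon> < (INF t. \<bar>deriv y t\<bar>)"
      and H1: "\<forall>t. H1_fun (n t) \<and> H1_fun (u t)"
      and bdd: "bdd_above (range (\<lambda>t. H1_pair_norm (n t) (u t)))"
      and small: "(SUP t. H1_pair_norm (n t) (u t)) < r / 2"
    have norms: "H1_norm (n t) \<le> r / 2" "H1_norm (u t) \<le> r / 2" for t
    proof -
      have "H1_pair_norm (n t) (u t) \<le> (SUP t. H1_pair_norm (n t) (u t))" by (rule cSUP_upper[OF _ bdd]) simp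
      hence "sqrt ((H1_norm (n t))^2 + (H1_norm (u t))^2) \<le> r / 2" using small by (simp add: H1_pair_norm_def)
      thus "H1_norm (n t) \<le> r / 2" "H1_norm (u t) \<le> r / 2"
        using real_sqrt_sum_squares_ge1 real_sqrt_sum_squares_ge2 order_trans by blast+
    qed
    have r2: "0 \<le> r / 2" using r by simp
    \<comment> \<open>This is why \<open>r / 2\<close> is small enough for the \<open>H\<^sup>1\<close> norm: the Sobolev constant is \<open>sqrt 2\<close>.\<close>
    have sup: "\<bar>z\<bar> \<le> r" if "z^2 \<le> 2 * (r / 2)^2" for z :: real
    proof (rule power2_le_imp_le)
      have "2 * (r / 2)^2 \<le> r^2" by (simp add: power2_eq_square)
      thus "\<bar>z\<bar>^2 \<le> r^2" using that by simp
    qed (use r in simp)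
    have Hn: "H1_fun (n t)" and Hu: "H1_fun (u t)" for t using H1 by auto
    have An: "\<exists>F. \<forall>x. (F has_real_derivative n t x) (at x)" for t by (rule EP_antiderivatives(1)[OF sol])
    have n: "continuous_on UNIV (n t)" "\<And>x. (n t x)^2 \<le> 2 * (r / 2)^2" "sqnorm (n t) \<le> (r / 2)^2"
      "L2_Lipschitz ((r / 2)^2) (n t)" for t
      using An[of t] H1_regularity[OF Hn _ norms(1) r2] by blast+
    have Au: "\<exists>F. \<forall>x. (F has_real_derivative u t x) (at x)" for t by (rule EP_antiderivatives(2)[OF sol n(1)])
    have u: "continuous_on UNIV (u t)" "\<And>x. (u t x)^2 \<le> 2 * (r / 2)^2" "sqnorm (u t) \<le> (r / 2)^2"
      "L2_Lipschitz ((r / 2)^2) (u t)" for t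
      using Au[of t] H1_regularity[OF Hu _ norms(2) r2] by blast+
    note W = enthalpy_near_zero[OF w r(4) near]
    note params_r = params[OF r(1,2)]
    interpret small_EP_solution p w n u \<phi> r "k - \<mu>" "k + \<mu>" "(r / 2)^2"
    proof
      show "\<bar>w s - w s'\<bar> \<le> (k + \<mu>) * \<bar>s - s'\<bar>" if "\<bar>s\<bar> \<le> r" "\<bar>s'\<bar> \<le> r" for s s'
        using W(1) that \<mu>(3) by simp
    qed (use w sol cons r \<mu> k n u sup W(2,3) Hn Hu in \<open>auto simp: H1_fun_def\<close>)
    have sp: "c + \<epsilon> \<le> \<bar>deriv y t\<bar>" for t
    proof -
      have "(INF t. \<bar>deriv y t\<bar>) \<le> \<bar>deriv y t\<bar>"
        by (rule cINF_lower) (auto intro: bdd_belowI[of _ 0])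
      thus ?thesis using speed by (simp add: c_def k_def)
    qed
    have adm: "admissible c (c + \<epsilon> / 2)" using params_r c unfolding admissible_def by blast
    show "n t x = 0" "u t x = 0" "\<phi> t x = 0"
      using fast_compact_solution_vanishes[OF adm y sp, of t x] assms(2) by auto
  qed
qed

end
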